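(* Let $N\in\mathbb{N}\setminus\{0,1\}$. There exists a constant $C$ depending only on $N$ such that, if $u\colon\mathbb{R}^N_+\to\mathbb{R}$ and $v\colon\partial\mathbb{R}^N_+\to\mathbb{R}$ are measurable and satisfy $$\liminf_{s\to1^-}\,(1-s)\int_{\partial\mathbb{R}^N_+}\Bigl(\int_{\mathbb{R}^N_+}\frac{|v(x)-u(y)|}{|x-y|^{N+s}}\,\mathrm{d}y\Bigr)\mathrm{d}x<\infty,$$ then $v\in BV(\partial\mathbb{R}^N_+)$ and $$\int_{\partial\mathbb{R}^N_+}|\mathrm{D}v|\le C\liminf_{s\to1^-}\,(1-s)\int_{\partial\mathbb{R}^N_+}\Bigl(\int_{\mathbb{R}^N_+}\frac{|v(x)-u(y)|}{|x-y|^{N+s}}\,\mathrm{d}y\Bigr)\mathrm{d}x .$$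
   Context: $\mathbb{R}^N_+ = \mathbb{R}^{N-1}\times(0,\infty)$. Its boundary $\partial\mathbb{R}^N_+ = \mathbb{R}^{N-1}\times\{0\}$ is identified with $\mathbb{R}^{N-1}$ and carries the $(N-1)$-dimensional Lebesgue measure; $|x-y|$ is the Euclidean distance in $\mathbb{R}^N$. $BV(\partial\mathbb{R}^N_+)$ is understood in the homogeneous sense: it is the set of functions $v\in L^1_{\mathrm{loc}}(\mathbb{R}^{N-1})$ whose distributional derivative $\mathrm{D}v$ is a finite vector-valued Radon measure on $\mathbb{R}^{N-1}$ (no global integrability of $v$ is required), and $\int_{\partial\mathbb{R}^N_+}|\mathrm{D}v|$ denotes the total variation of that measure. *)

theory Defs
  imports "HOL-Analysis.Analysis"
begin

section \<open>Finite vector measures\<close>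

text \<open>A vector measure is a countably additive set function with values in a normed space. Its
  values are vectors, so it is finite by definition, and taking all sets empty gives
  \<^term>\<open>\<mu> {} = 0\<close>. Only the values on \<^term>\<open>sets M\<close> matter. On the Borel sets of a Euclidean
  space every such set function is a finite Radon measure.\<close>

definition vector_measure :: "'a measure \<Rightarrow> ('a set \<Rightarrow> 'b::real_normed_vector) \<Rightarrow> bool" where
  "vector_measure M \<mu> \<longleftrightarrow>
     (\<forall>A :: nat \<Rightarrow> 'a set. range A \<subseteq> sets M \<longrightarrow> disjoint_family A \<longrightarrow>
        (\<lambda>i. \<mu> (A i)) sums \<mu> (\<Union>i. A i))"

definition total_variation ::
    "'a measure \<Rightarrow> ('a set \<Rightarrow> 'b::real_normed_vector) \<Rightarrow> 'a set \<Rightarrow> ennreal" where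
  "total_variation M \<mu> E =
     (SUP A \<in> {A :: nat \<Rightarrow> 'a set. range A \<subseteq> sets M \<and> disjoint_family A \<and> (\<Union>i. A i) = E}.
        \<Sum>i. ennreal (norm (\<mu> (A i))))"

text \<open>The positive part in the Jordan decomposition of a real-valued vector measure; the negative
  part is the positive part of the opposite set function. Negative values of \<^term>\<open>\<nu>\<close> are
  truncated to zero by \<^const>\<open>ennreal\<close>, which does not change the supremum since the empty set is
  among the competitors.\<close>

definition pos_variation :: "'a measure \<Rightarrow> ('a set \<Rightarrow> real) \<Rightarrow> 'a measure" where
  "pos_variation M \<nu> =
     measure_of (space M) (sets M) (\<lambda>A. SUP B \<in> {B \<in> sets M. B \<subseteq> A}. ennreal (\<nu> B))"

definition signed_integral :: "'a measure \<Rightarrow> ('a set \<Rightarrow> real) \<Rightarrow> ('a \<Rightarrow> real) \<Rightarrow> real" where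
  "signed_integral M \<nu> f =
     (\<integral>x. f x \<partial>pos_variation M \<nu>) - (\<integral>x. f x \<partial>pos_variation M (\<lambda>A. - \<nu> A))"

section \<open>Functions of bounded variation\<close>

primrec continuously_differentiable ::
    "nat \<Rightarrow> ('a::euclidean_space \<Rightarrow> real) \<Rightarrow> bool" where
  "continuously_differentiable 0 f \<longleftrightarrow> continuous_on UNIV f"
| "continuously_differentiable (Suc k) f \<longleftrightarrow>
     (\<forall>x. f differentiable (at x)) \<and>
     (\<forall>b\<in>Basis. continuously_differentiable k (\<lambda>x. frechet_derivative f (at x) b))"

definition test_function :: "('a::euclidean_space \<Rightarrow> real) \<Rightarrow> bool" where
  "test_function \<phi> \<longleftrightarrow>
     (\<forall>k. continuously_differentiable k \<phi>) \<and> compact (closure {x. \<phi> x \<noteq> 0})"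

definition locally_integrable :: "('a::euclidean_space \<Rightarrow> real) \<Rightarrow> bool" where
  "locally_integrable v \<longleftrightarrow> (\<forall>K. compact K \<longrightarrow> v absolutely_integrable_on K)"

text \<open>\<^term>\<open>has_measure_derivative v \<mu>\<close> says that the distributional gradient of the locally
  integrable function \<^term>\<open>v\<close> is the finite vector measure \<^term>\<open>\<mu>\<close>.\<close>

definition has_measure_derivative ::
    "('a::euclidean_space \<Rightarrow> real) \<Rightarrow> ('a set \<Rightarrow> 'a) \<Rightarrow> bool" where
  "has_measure_derivative v \<mu> \<longleftrightarrow>
     vector_measure borel \<mu> \<and>
     (\<forall>\<phi>. test_function \<phi> \<longrightarrow>
        (\<forall>b\<in>Basis. (\<integral>x. v x * frechet_derivative \<phi> (at x) b \<partial>lebesgue)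
                   = - signed_integral borel (\<lambda>A. \<mu> A \<bullet> b) \<phi>))"

text \<open>The homogeneous space: no global integrability of the function is required.\<close>

definition BV :: "('a::euclidean_space \<Rightarrow> real) set" where
  "BV = {v. locally_integrable v \<and> (\<exists>\<mu>. has_measure_derivative v \<mu>)}"

text \<open>The derivative measure of a function in \<^const>\<open>BV\<close> is determined on the Borel sets only, so
  the choice operator picks one of its extensions to arbitrary sets. The total variation does not
  depend on that choice.\<close>

definition measure_derivative :: "('a::euclidean_space \<Rightarrow> real) \<Rightarrow> 'a set \<Rightarrow> 'a" where
  "measure_derivative v = (SOME \<mu>. has_measure_derivative v \<mu>)"

section \<open>The half-space\<close>

definition half_space :: "('a::euclidean_space \<times> real) set" where
  "half_space = UNIV \<times> {0<..}"

text \<open>The double integral of the statement, without the factor \<^term>\<open>1 - s\<close>; the boundary point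
  \<^term>\<open>x\<close> is seen in the ambient space as \<^term>\<open>(x, 0)\<close>.\<close>

definition gap_integral ::
    "nat \<Rightarrow> real \<Rightarrow> ('a::euclidean_space \<times> real \<Rightarrow> real) \<Rightarrow> ('a \<Rightarrow> real) \<Rightarrow> ennreal" where
  "gap_integral N s u v =
     (\<integral>\<^sup>+x. (\<integral>\<^sup>+y. ennreal (\<bar>v x - u y\<bar> / norm ((x, 0) - y) powr (real N + s))
              \<partial>lebesgue_on half_space) \<partial>lebesgue)"

end

theory Submission
  imports Defs
begin

text \<open>
  Write \<omega>(h) for the L^1 norm of x \<mapsto> v(x + h) - v(x). The function u enters only as a
  bridge between two boundary values. If |h| \<le> \<rho>, then x and x + h both lie at distance
  at most 4\<rho> from every point y of a collar at height between \<rho> and 2\<rho> above x,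
  and |v(x + h) - v(x)| \<le> |v(x) - u(y)| + |v(x + h) - u(y)|. Averaging over y and integrating
  over x bounds \<omega>(h) by the part of the gap integral that lives at height about \<rho>
  (\<open>L1_shift_le_collar_gap\<close>). Since \<omega> is subadditive, \<omega>(h) \<le> 2^k \<omega>(2^(-k) h),
  so this estimate can be used at all the scales \<rho> = 2^(-k) |h| simultaneously: the collars
  of different scales are disjoint and the k-th one contributes at least a multiple of
  |h|^(-s) 2^(-k(1-s)) \<omega>(h). The sum of this geometric series is at least 1/(1-s), which
  the factor 1 - s compensates. Letting s tend to 1 gives \<omega>(h) \<le> C |h| L, where L is
  the lower limit in the statement (\<open>L1_shift_le_Liminf_gap\<close>).

  It remains to see that a function whose translates are Lipschitz in L^1, with constant K, has
  bounded variation (\<open>BV_if_L1_shifts_Lipschitz\<close>). Integrating \<omega> over a ball shows that it is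
  locally integrable. Its difference quotients in a coordinate direction are densities of mass at
  most K which converge, tested against smooth functions, to the distributional derivative. So
  the derivative is a measure by weak compactness of bounded sets of measures
  (\<open>weak_limit_of_densities\<close>). The limit measure arises as follows: the set functions given by the
  positive and negative parts of the densities have a cluster point by Tychonoff's theorem, this
  cluster point is a finitely additive content, and its regularization through compact and open
  sets is a Borel measure with the same integrals of continuous functions of compact support.

  Since the derivative measure in the statement is picked by the choice operator, the bound on its
  total variation also needs uniqueness: a signed measure is the difference of its finite positive
  and negative variations (\<open>jordan_decomposition\<close>), and finite measures are determined by their
  integrals of smooth bumps, which approximate the indicators of boxes
  (\<open>test_integrals_determine_measure_sums\<close>).
\<close>

section \<open>Translates in the mean and the gap integral\<close>

text \<open>
  The gap integral rewritten over Borel measure spaces, for which Fubini and measurability of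
  inner integrals are available; \<open>p\<close> stands for the whole exponent N + s.
\<close>
definition half_space_gap ::
    "real \<Rightarrow> ('a::euclidean_space \<times> real \<Rightarrow> real) \<Rightarrow> ('a \<Rightarrow> real) \<Rightarrow> ennreal" where
  "half_space_gap p u v =
     (\<integral>\<^sup>+x. (\<integral>\<^sup>+y. (if 0 < snd y then ennreal (\<bar>v x - u y\<bar> / norm ((x, 0) - y) powr p) else 0)
        \<partial>lborel) \<partial>lborel)"

lemma half_space_measurable: "half_space \<in> sets (borel :: ('a::euclidean_space \<times> real) measure)"
  unfolding half_space_def by (intro borel_open open_Times) auto

text \<open>
  Changing u and v on null sets changes neither the gap integral nor the distributional
  derivative, so from here on both functions can be Borel.
\<close>
lemma gap_integral_Borel_representatives:
  fixes u :: "'a::euclidean_space \<times> real \<Rightarrow> real" and v :: "'a \<Rightarrow> real"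
  assumes u: "u \<in> borel_measurable (lebesgue_on half_space)" and v: "v \<in> borel_measurable lebesgue"
  shows "\<exists>u' v'. u' \<in> borel_measurable borel \<and> v' \<in> borel_measurable borel \<and>
    (AE x in lebesgue. v x = v' x) \<and>
    (\<forall>N s. gap_integral N s u v = half_space_gap (real N + s) u' v')"
proof -
  have H: "half_space \<in> sets (lebesgue :: ('a \<times> real) measure)"
    using half_space_measurable by (intro sets_completionI_sets) simp
  have "(\<lambda>y. if y \<in> half_space then u y else 0) \<in> borel_measurable lebesgue"
    using u H by (simp add: borel_measurable_if)
  then obtain u' where u': "u' \<in> borel_measurable lborel"
    "AE y in lborel. (if y \<in> half_space then u y else 0) = u' y"
    using completion_ex_borel_measurable_real by blast
  obtain v' where v': "v' \<in> borel_measurable lborel" "AE x in lborel. v x = v' x"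
    using completion_ex_borel_measurable_real[OF v] by blast
  have "gap_integral N s u v = half_space_gap (real N + s) u' v'" for N s
  proof -
    have "(\<integral>\<^sup>+y. ennreal (\<bar>v x - u y\<bar> / norm ((x, 0) - y) powr (real N + s)) \<partial>lebesgue_on half_space)
      = (\<integral>\<^sup>+y. (if 0 < snd y then ennreal (\<bar>v x - u' y\<bar> / norm ((x, 0) - y) powr (real N + s)) else 0)
          \<partial>lborel)" for x
    proof -
      have "(\<integral>\<^sup>+y. ennreal (\<bar>v x - u y\<bar> / norm ((x, 0) - y) powr (real N + s)) \<partial>lebesgue_on half_space)
        = (\<integral>\<^sup>+y. ennreal (\<bar>v x - u y\<bar> / norm ((x, 0) - y) powr (real N + s)) * indicator half_space y
            \<partial>lborel)"
        using H by (simp add: nn_integral_restrict_space nn_integral_completion)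
      also have "\<dots> = (\<integral>\<^sup>+y. (if 0 < snd y
          then ennreal (\<bar>v x - u' y\<bar> / norm ((x, 0) - y) powr (real N + s)) else 0) \<partial>lborel)"
        using u'(2) by (intro nn_integral_cong_AE) (auto simp: half_space_def indicator_def elim!: AE_mp)
      finally show ?thesis .
    qed
    note inner = this
    show ?thesis
      unfolding gap_integral_def half_space_gap_def nn_integral_completion inner
      by (rule nn_integral_cong_AE) (rule AE_mp[OF v'(2) AE_I2], intro impI, simp only:)
  qed
  moreover have "AE x in lebesgue. v x = v' x" using v'(2) by (rule AE_completion)
  ultimately show ?thesis using u'(1) v'(1) by (intro exI[of _ u'] exI[of _ v']) simp
qed

definition L1_shift :: "('a::euclidean_space \<Rightarrow> real) \<Rightarrow> 'a \<Rightarrow> ennreal" where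
  "L1_shift v h = (\<integral>\<^sup>+x. ennreal \<bar>v (x + h) - v x\<bar> \<partial>lborel)"

lemma nn_integral_lborel_shift:
  fixes f :: "'a::euclidean_space \<Rightarrow> ennreal"
  assumes [measurable]: "f \<in> borel_measurable borel"
  shows "(\<integral>\<^sup>+x. f (x + h) \<partial>lborel) = (\<integral>\<^sup>+x. f x \<partial>lborel)"
proof -
  have "(\<integral>\<^sup>+x. f x \<partial>lborel) = (\<integral>\<^sup>+x. f x \<partial>distr lborel borel ((+) h))"
    by (simp add: lborel_distr_plus)
  also have "\<dots> = (\<integral>\<^sup>+x. f (x + h) \<partial>lborel)"
    by (subst nn_integral_distr) (auto simp: add.commute)
  finally show ?thesis by simp
qed

lemma L1_shift_add:
  assumes [measurable]: "v \<in> borel_measurable borel"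
  shows "L1_shift v (h + k) \<le> L1_shift v h + L1_shift v k"
proof -
  have "L1_shift v (h + k) \<le> (\<integral>\<^sup>+x. ennreal \<bar>v ((x + k) + h) - v (x + k)\<bar> + ennreal \<bar>v (x + k) - v x\<bar> \<partial>lborel)"
    unfolding L1_shift_def
  proof (rule nn_integral_mono)
    fix x
    have "\<bar>v (x + (h + k)) - v x\<bar> \<le> \<bar>v ((x + k) + h) - v (x + k)\<bar> + \<bar>v (x + k) - v x\<bar>"
      by (simp add: add_ac)
    then show "ennreal \<bar>v (x + (h + k)) - v x\<bar>
        \<le> ennreal \<bar>v ((x + k) + h) - v (x + k)\<bar> + ennreal \<bar>v (x + k) - v x\<bar>"
      by (simp flip: ennreal_plus add: ennreal_leI)
  qed
  also have "\<dots> = (\<integral>\<^sup>+x. ennreal \<bar>v ((x + k) + h) - v (x + k)\<bar> \<partial>lborel) + L1_shift v k"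
    unfolding L1_shift_def by (rule nn_integral_add) measurable
  also have "(\<integral>\<^sup>+x. ennreal \<bar>v ((x + k) + h) - v (x + k)\<bar> \<partial>lborel) = L1_shift v h"
    unfolding L1_shift_def
    by (rule nn_integral_lborel_shift[where f = "\<lambda>x. ennreal \<bar>v (x + h) - v x\<bar>"]) measurable
  finally show ?thesis .
qed

lemma ennreal_mult_assoc: "0 \<le> a \<Longrightarrow> ennreal a * (ennreal b * c) = ennreal (a * b) * c"
  by (simp add: ennreal_mult' mult.assoc)

text \<open>
  Iterating \<open>L1_shift_add\<close> gives \<omega>(h) \<le> 2^k \<omega>(2^(-k) h): increments per unit length
  can only grow when the scale is refined. This is what allows all dyadic scales to be compared
  with the single scale |h|.
\<close>
lemma L1_shift_halving:
  assumes v: "v \<in> borel_measurable borel"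
  shows "ennreal ((1/2) ^ k) * L1_shift v h \<le> L1_shift v ((1/2) ^ k *\<^sub>R h)"
proof (induction k)
  case (Suc k)
  let ?w = "(1/2) ^ Suc k *\<^sub>R h"
  have "(1/2) ^ k *\<^sub>R h = ?w + ?w" by (simp flip: scaleR_add_left)
  then have "L1_shift v ((1/2) ^ k *\<^sub>R h) \<le> L1_shift v ?w + L1_shift v ?w"
    using L1_shift_add[OF v, of ?w ?w] by simp
  with Suc have "ennreal ((1/2) ^ k) * L1_shift v h \<le> 2 * L1_shift v ?w"
    by (simp add: mult_2)
  then have "ennreal (1/2) * (ennreal ((1/2) ^ k) * L1_shift v h) \<le> ennreal (1/2) * (2 * L1_shift v ?w)"
    by (rule mult_left_mono) simp
  also have "\<dots> = L1_shift v ?w"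
  proof -
    have "ennreal (1/2) * (2 * L1_shift v ?w) = (ennreal (1/2) * ennreal 2) * L1_shift v ?w"
      by (simp add: mult.assoc)
    also have "ennreal (1/2) * ennreal 2 = 1" by (subst ennreal_mult[symmetric]) auto
    finally show ?thesis by simp
  qed
  also have "ennreal (1/2) * (ennreal ((1/2) ^ k) * L1_shift v h) = ennreal ((1/2) ^ Suc k) * L1_shift v h"
    by (subst ennreal_mult_assoc) simp_all
  finally show ?case .
qed simp

text \<open>
  The part of the inner integral over the points at height in (\<rho>, 2\<rho>]. The half-open
  range makes the collars of the scales r 2^(-k) disjoint.
\<close>
definition collar_gap ::
    "('a::euclidean_space \<times> real \<Rightarrow> real) \<Rightarrow> ('a \<Rightarrow> real) \<Rightarrow> real \<Rightarrow> 'a \<Rightarrow> ennreal" where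
  "collar_gap u v \<rho> x = (\<integral>\<^sup>+y. (if norm (fst y - x) \<le> 2 * \<rho> \<and> \<rho> < snd y \<and> snd y \<le> 2 * \<rho>
     then ennreal \<bar>v x - u y\<bar> else 0) \<partial>lborel)"

lemma pair_projections_measurable [measurable]:
  "fst \<in> borel_measurable (borel :: ('a::euclidean_space \<times> real) measure)"
  "snd \<in> borel_measurable (borel :: ('a::euclidean_space \<times> real) measure)"
  by (auto intro!: borel_measurable_continuous_onI continuous_intros)

lemma collar_gap_measurable [measurable]:
  assumes [measurable]: "u \<in> borel_measurable borel" "v \<in> borel_measurable borel"
  shows "collar_gap u v \<rho> \<in> borel_measurable borel"
  unfolding collar_gap_def by measurable

lemma emeasure_collar:
  assumes "0 < \<rho>"
  shows "emeasure lborel (cball x \<rho> \<times> {\<rho><..2 * \<rho>} :: ('a::euclidean_space \<times> real) set)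
    = ennreal (unit_ball_vol DIM('a) * \<rho> ^ (DIM('a) + 1))"
proof -
  have "emeasure lborel (cball x \<rho> \<times> {\<rho><..2 * \<rho>} :: ('a \<times> real) set)
      = emeasure lborel (cball x \<rho>) * emeasure lborel {\<rho><..2 * \<rho>}"
    unfolding lborel_prod[symmetric] by (rule lborel.emeasure_pair_measure_Times) auto
  also have "\<dots> = ennreal (unit_ball_vol DIM('a) * \<rho> ^ DIM('a)) * ennreal \<rho>"
    using assms by (simp add: emeasure_cball)
  also have "\<dots> = ennreal (unit_ball_vol DIM('a) * \<rho> ^ (DIM('a) + 1))"
    using assms by (subst ennreal_mult[symmetric]) (auto simp: mult_ac)
  finally show ?thesis .
qed

text \<open>
  Triangle inequality through a point y of the cylinder of radius \<rho> over x, integrated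
  in y. The collars have horizontal radius 2\<rho> so that the one over x + h still contains
  the cylinder over x.
\<close>
lemma increment_le_collar_gaps:
  fixes u :: "'a::euclidean_space \<times> real \<Rightarrow> real"
  assumes [measurable]: "u \<in> borel_measurable borel" "v \<in> borel_measurable borel"
    and \<rho>: "0 < \<rho>" and h: "norm h \<le> \<rho>"
  shows "ennreal (unit_ball_vol DIM('a) * \<rho> ^ (DIM('a) + 1)) * ennreal \<bar>v (x + h) - v x\<bar>
    \<le> collar_gap u v \<rho> x + collar_gap u v \<rho> (x + h)"
proof -
  let ?E = "cball x \<rho> \<times> {\<rho><..2 * \<rho>} :: ('a \<times> real) set"
  have "?E \<in> sets lborel"
    unfolding lborel_prod[symmetric] by (intro pair_measureI) auto
  then have "ennreal (unit_ball_vol DIM('a) * \<rho> ^ (DIM('a) + 1)) * ennreal \<bar>v (x + h) - v x\<bar>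
      = (\<integral>\<^sup>+y. ennreal \<bar>v (x + h) - v x\<bar> * indicator ?E y \<partial>lborel)"
    using emeasure_collar[OF \<rho>, of x] by (simp add: nn_integral_cmult_indicator mult.commute)
  also have "\<dots> \<le> (\<integral>\<^sup>+y.
      (if norm (fst y - x) \<le> 2 * \<rho> \<and> \<rho> < snd y \<and> snd y \<le> 2 * \<rho> then ennreal \<bar>v x - u y\<bar> else 0) +
      (if norm (fst y - (x + h)) \<le> 2 * \<rho> \<and> \<rho> < snd y \<and> snd y \<le> 2 * \<rho>
        then ennreal \<bar>v (x + h) - u y\<bar> else 0) \<partial>lborel)"
  proof (rule nn_integral_mono)
    fix y :: "'a \<times> real"
    show "ennreal \<bar>v (x + h) - v x\<bar> * indicator ?E y \<le>
      (if norm (fst y - x) \<le> 2 * \<rho> \<and> \<rho> < snd y \<and> snd y \<le> 2 * \<rho> then ennreal \<bar>v x - u y\<bar> else 0) +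
      (if norm (fst y - (x + h)) \<le> 2 * \<rho> \<and> \<rho> < snd y \<and> snd y \<le> 2 * \<rho>
        then ennreal \<bar>v (x + h) - u y\<bar> else 0)"
    proof (cases "y \<in> ?E")
      case True
      then have n: "norm (fst y - x) \<le> \<rho>" and t: "\<rho> < snd y" "snd y \<le> 2 * \<rho>"
        by (auto simp: dist_norm norm_minus_commute)
      have "norm (fst y - (x + h)) \<le> norm (fst y - x) + norm h"
        using norm_triangle_ineq4[of "fst y - x" h] by (simp add: algebra_simps)
      then have n': "norm (fst y - (x + h)) \<le> 2 * \<rho>" using n h by linarith
      have "ennreal \<bar>v (x + h) - v x\<bar> \<le> ennreal \<bar>v x - u y\<bar> + ennreal \<bar>v (x + h) - u y\<bar>"
        by (simp flip: ennreal_plus add: ennreal_leI)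
      then show ?thesis using True n n' t \<rho> by simp
    qed simp
  qed
  also have "\<dots> = collar_gap u v \<rho> x + collar_gap u v \<rho> (x + h)"
    unfolding collar_gap_def by (rule nn_integral_add) measurable
  finally show ?thesis .
qed

lemma L1_shift_le_collar_gap:
  fixes u :: "'a::euclidean_space \<times> real \<Rightarrow> real"
  assumes [measurable]: "u \<in> borel_measurable borel" "v \<in> borel_measurable borel"
    and \<rho>: "0 < \<rho>" and h: "norm h \<le> \<rho>"
  shows "ennreal (unit_ball_vol DIM('a) / 2 * \<rho> ^ (DIM('a) + 1)) * L1_shift v h
    \<le> (\<integral>\<^sup>+x. collar_gap u v \<rho> x \<partial>lborel)"
proof -
  let ?c = "unit_ball_vol DIM('a) * \<rho> ^ (DIM('a) + 1)" and ?F = "\<integral>\<^sup>+x. collar_gap u v \<rho> x \<partial>lborel"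
  have "ennreal ?c * L1_shift v h = (\<integral>\<^sup>+x. ennreal ?c * ennreal \<bar>v (x + h) - v x\<bar> \<partial>lborel)"
    unfolding L1_shift_def by (rule nn_integral_cmult[symmetric]) measurable
  also have "\<dots> \<le> (\<integral>\<^sup>+x. collar_gap u v \<rho> x + collar_gap u v \<rho> (x + h) \<partial>lborel)"
    by (intro nn_integral_mono increment_le_collar_gaps assms)
  also have "\<dots> = ?F + (\<integral>\<^sup>+x. collar_gap u v \<rho> (x + h) \<partial>lborel)"
    by (rule nn_integral_add) measurable
  also have "(\<integral>\<^sup>+x. collar_gap u v \<rho> (x + h) \<partial>lborel) = ?F"
    by (rule nn_integral_lborel_shift) measurable
  finally have "ennreal ?c * L1_shift v h \<le> 2 * ?F" by (simp add: mult_2)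
  then have "ennreal (1/2) * (ennreal ?c * L1_shift v h) \<le> ennreal (1/2) * (2 * ?F)"
    by (rule mult_left_mono) simp
  also have "ennreal (1/2) * (2 * ?F) = (ennreal (1/2) * ennreal 2) * ?F"
    by (simp add: mult.assoc)
  also have "ennreal (1/2) * ennreal 2 = 1" by (subst ennreal_mult[symmetric]) auto
  also have "ennreal (1/2) * (ennreal ?c * L1_shift v h)
      = ennreal (unit_ball_vol DIM('a) / 2 * \<rho> ^ (DIM('a) + 1)) * L1_shift v h"
    by (subst ennreal_mult_assoc) simp_all
  finally show ?thesis by simp
qed

text \<open>
  In the collar of scale \<rho> the kernel is at least (4\<rho>)^(-p), and every point y lies in
  at most one of the dyadic collars.
\<close>
lemma sum_dyadic_collars_le_gap:
  fixes u :: "'a::euclidean_space \<times> real \<Rightarrow> real"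
  assumes [measurable]: "u \<in> borel_measurable borel" "v \<in> borel_measurable borel"
    and r: "0 < r" and p: "0 \<le> p"
  shows "(\<Sum>k. ennreal ((4 * (r * (1/2) ^ k)) powr - p) * (\<integral>\<^sup>+x. collar_gap u v (r * (1/2) ^ k) x \<partial>lborel))
    \<le> half_space_gap p u v"
proof -
  define \<rho> where "\<rho> k = r * (1/2) ^ k" for k :: nat
  have \<rho>: "0 < \<rho> k" for k using r by (simp add: \<rho>_def)
  let ?in = "\<lambda>k x y. norm (fst y - x) \<le> 2 * \<rho> k \<and> \<rho> k < snd y \<and> snd y \<le> 2 * \<rho> k"
  let ?t = "\<lambda>k x y. ennreal ((4 * \<rho> k) powr - p) * (if ?in k x y then ennreal \<bar>v x - u y\<bar> else 0)"
  have disj: "j = k" if "?in k x y" "?in j x y" for j k :: nat and x :: 'a and y :: "'a \<times> real"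
  proof -
    \<comment> \<open>The height ranges of two different scales at most touch.\<close>
    have half: "2 * \<rho> b \<le> \<rho> a" if "a < b" for a b :: nat
    proof -
      have "(1/2 :: real) ^ b \<le> (1/2) ^ Suc a" using that by (intro power_decreasing) auto
      then show ?thesis using r by (simp add: \<rho>_def)
    qed
    show ?thesis using that half[of j k] half[of k j] by (cases j k rule: linorder_cases) auto
  qed
  have term_le: "?t k x y \<le> (if 0 < snd y then ennreal (\<bar>v x - u y\<bar> / norm ((x, 0) - y) powr p) else 0)"
    if "?in k x y" for k x y
  proof -
    have pos: "0 < snd y" using that \<rho>[of k] by linarith
    obtain y1 y2 where y: "y = (y1, y2)" by (cases y)
    have "norm ((x, 0) - y) \<le> norm (x - y1) + norm (0 - y2)"
      using norm_Pair_le[of "x - y1" "0 - y2"] by (simp add: y)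
    then have le: "norm ((x, 0) - y) \<le> 4 * \<rho> k"
      using that by (simp add: y norm_minus_commute)
    have "norm ((x, 0) - y) > 0" using pos by (auto simp: y zero_prod_def)
    then have "(4 * \<rho> k) powr - p \<le> norm ((x, 0) - y) powr - p"
      using le p by (intro powr_mono2') auto
    then have "(4 * \<rho> k) powr - p * \<bar>v x - u y\<bar> \<le> \<bar>v x - u y\<bar> / norm ((x, 0) - y) powr p"
      by (simp add: powr_minus divide_inverse mult.commute mult_left_mono)
    then show ?thesis using that pos
      by (simp add: ennreal_mult'[symmetric] ennreal_leI)
  qed
  have "(\<Sum>k. ennreal ((4 * \<rho> k) powr - p) * (\<integral>\<^sup>+x. collar_gap u v (\<rho> k) x \<partial>lborel))
      = (\<Sum>k. (\<integral>\<^sup>+x. ennreal ((4 * \<rho> k) powr - p) * collar_gap u v (\<rho> k) x \<partial>lborel))"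
    by (intro suminf_cong nn_integral_cmult[symmetric]) measurable
  also have "\<dots> = (\<integral>\<^sup>+x. (\<Sum>k. ennreal ((4 * \<rho> k) powr - p) * collar_gap u v (\<rho> k) x) \<partial>lborel)"
    by (rule nn_integral_suminf[symmetric]) measurable
  also have "\<dots> = (\<integral>\<^sup>+x. (\<Sum>k. \<integral>\<^sup>+y. ?t k x y \<partial>lborel) \<partial>lborel)"
    unfolding collar_gap_def
    by (intro nn_integral_cong suminf_cong nn_integral_cmult[symmetric]) measurable
  also have "\<dots> = (\<integral>\<^sup>+x. (\<integral>\<^sup>+y. (\<Sum>k. ?t k x y) \<partial>lborel) \<partial>lborel)"
    by (intro nn_integral_cong nn_integral_suminf[symmetric]) measurable
  also have "\<dots> \<le> half_space_gap p u v"
    unfolding half_space_gap_def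
  proof (intro nn_integral_mono)
    fix x :: 'a and y :: "'a \<times> real"
    show "(\<Sum>k. ?t k x y) \<le> (if 0 < snd y then ennreal (\<bar>v x - u y\<bar> / norm ((x, 0) - y) powr p) else 0)"
    proof (cases "\<exists>k. ?in k x y")
      case True
      then obtain k where k: "?in k x y" by blast
      have "?t j x y = 0" if "j \<notin> {k}" for j
      proof -
        have nin: "\<not> ?in j x y" using disj[OF k] that by blast
        show ?thesis unfolding if_not_P[OF nin] by simp
      qed
      then have "(\<Sum>j. ?t j x y) = (\<Sum>j\<in>{k}. ?t j x y)"
        by (intro suminf_finite) simp_all
      then show ?thesis using term_le[OF k] by simp
    next
      case False
      then have nin: "\<not> ?in k x y" for k by blast
      show ?thesis unfolding if_not_P[OF nin] by simp
    qed
  qed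
  finally show ?thesis by (simp add: \<rho>_def)
qed


text \<open>
  The contributions of the dyadic scales form a geometric series with ratio q = 2^(s-1), and
  1 - q \<le> 1 - s. The constant is kept independent of s by using 4^(-(N+s)) \<ge> 4^(-(N+1)).
\<close>
lemma half_space_gap_lower_bound:
  fixes u :: "'a::euclidean_space \<times> real \<Rightarrow> real"
  assumes u: "u \<in> borel_measurable borel" and v: "v \<in> borel_measurable borel"
    and s: "0 < s" "s < 1" and h: "h \<noteq> 0"
  defines "c \<equiv> 4 powr - (real DIM('a) + 2) * (unit_ball_vol DIM('a) / 2)"
  shows "ennreal (c * norm h powr - s) * L1_shift v h
    \<le> ennreal (1 - s) * half_space_gap (real (DIM('a) + 1) + s) u v"
proof -
  let ?N = "DIM('a) + 1" and ?\<kappa> = "unit_ball_vol DIM('a) / 2"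
  define r where "r = norm h"
  define q where "q = 2 powr (s - 1)"
  define b where "b = 4 powr - (real ?N + s) * ?\<kappa> * r powr - s"
  have r: "0 < r" using h by (simp add: r_def)
  have q: "0 < q" "q < 1" using s by (auto simp: q_def powr_less_one)
  have b: "0 \<le> b" by (simp add: b_def)
  have "ennreal (b * q ^ k) * L1_shift v h
      \<le> ennreal ((4 * (r * (1/2) ^ k)) powr - (real ?N + s)) *
         (\<integral>\<^sup>+x. collar_gap u v (r * (1/2) ^ k) x \<partial>lborel)" for k
  proof -
    let ?\<rho> = "r * (1/2) ^ k"
    have \<rho>: "0 < ?\<rho>" using r by simp
    have "(4 * ?\<rho>) powr - (real ?N + s) * (?\<kappa> * ?\<rho> ^ ?N) * (1/2) ^ k
        = 4 powr - (real ?N + s) * ?\<kappa> * (?\<rho> powr - (real ?N + s) * ?\<rho> powr real ?N) * (1/2) ^ k"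
      by (subst powr_mult) (simp only: powr_realpow[OF \<rho>], simp only: mult_ac)
    also have "?\<rho> powr - (real ?N + s) * ?\<rho> powr real ?N = ?\<rho> powr - s"
      by (subst powr_add[symmetric]) simp
    also have "\<dots> = r powr - s * ((1/2) ^ k) powr - s" using r by (subst powr_mult) auto
    also have "((1/2::real) ^ k) powr - s = (2 powr s) ^ k"
    proof -
      have "((1/2::real) ^ k) powr - s = ((1/2) powr - s) ^ k"
        by (simp add: powr_realpow[symmetric] powr_powr mult.commute powr_power)
      also have "(1/2::real) powr - s = 2 powr s"
        by (simp add: powr_minus powr_divide)
      finally show ?thesis .
    qed
    also have "4 powr - (real ?N + s) * ?\<kappa> * (r powr - s * (2 powr s) ^ k) * (1/2) ^ k
        = b * ((2 powr s) ^ k * (1/2) ^ k)" by (simp add: b_def)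
    also have "(2 powr s) ^ k * (1/2) ^ k = q ^ k"
      by (simp add: q_def powr_diff power_divide)
    finally have eq: "(4 * ?\<rho>) powr - (real ?N + s) * (?\<kappa> * ?\<rho> ^ ?N) * (1/2) ^ k = b * q ^ k" .
    have "ennreal (b * q ^ k) * L1_shift v h
        = ennreal ((4 * ?\<rho>) powr - (real ?N + s)) *
           (ennreal (?\<kappa> * ?\<rho> ^ ?N) * (ennreal ((1/2) ^ k) * L1_shift v h))"
      unfolding eq[symmetric] using \<rho> by (subst ennreal_mult_assoc, simp)+ (simp add: mult_ac)
    also have "\<dots> \<le> ennreal ((4 * ?\<rho>) powr - (real ?N + s)) *
        (ennreal (?\<kappa> * ?\<rho> ^ ?N) * L1_shift v ((1/2) ^ k *\<^sub>R h))"
      by (intro mult_left_mono L1_shift_halving v) auto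
    also have "\<dots> \<le> ennreal ((4 * ?\<rho>) powr - (real ?N + s)) *
         (\<integral>\<^sup>+x. collar_gap u v ?\<rho> x \<partial>lborel)"
      by (intro mult_left_mono L1_shift_le_collar_gap u v \<rho>) (auto simp: r_def mult.commute)
    finally show ?thesis .
  qed
  then have "(\<Sum>k. ennreal (b * q ^ k) * L1_shift v h)
      \<le> (\<Sum>k. ennreal ((4 * (r * (1/2) ^ k)) powr - (real ?N + s)) *
         (\<integral>\<^sup>+x. collar_gap u v (r * (1/2) ^ k) x \<partial>lborel))"
    by (intro suminf_le) auto
  also have "\<dots> \<le> half_space_gap (real ?N + s) u v"
    by (rule sum_dyadic_collars_le_gap[OF u v r]) (use s in auto)
  also have "(\<Sum>k. ennreal (b * q ^ k) * L1_shift v h) = ennreal (b * (1 / (1 - q))) * L1_shift v h"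
  proof -
    have "(\<lambda>k. b * q ^ k) sums (b * (1 / (1 - q)))"
      using q by (intro sums_mult geometric_sums) auto
    then have "(\<Sum>k. ennreal (b * q ^ k)) = ennreal (b * (1 / (1 - q)))"
      using b q by (intro suminf_ennreal_eq) auto
    then show ?thesis by (subst ennreal_suminf_multc) simp
  qed
  finally have "ennreal (1 - s) * (ennreal (b * (1 / (1 - q))) * L1_shift v h)
      \<le> ennreal (1 - s) * half_space_gap (real ?N + s) u v"
    by (rule mult_left_mono) simp
  moreover have "ennreal (c * norm h powr - s) * L1_shift v h
      \<le> ennreal (1 - s) * (ennreal (b * (1 / (1 - q))) * L1_shift v h)"
  proof -
    have "1 + (s - 1) * ln 2 \<le> q"
      unfolding q_def powr_def using exp_ge_add_one_self[of "(s - 1) * ln 2"] by simp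
    moreover have "(s - 1) * 1 \<le> (s - 1) * ln (2::real)"
      using s ln_add_one_self_le_self[of 1] by (intro mult_left_mono_neg) auto
    ultimately have "1 + (s - 1) * 1 \<le> q" by (rule order.trans[OF add_left_mono, rotated])
    then have "1 - q \<le> 1 - s" by simp
    then have one: "1 \<le> (1 - s) * (1 / (1 - q))" using q by (simp add: le_divide_eq)
    have "4 powr - (real DIM('a) + 2) \<le> 4 powr - (real ?N + s)"
      using s by (intro powr_mono) auto
    then have "c * norm h powr - s \<le> b"
      unfolding c_def b_def r_def by (intro mult_right_mono) auto
    also have "b * 1 \<le> b * ((1 - s) * (1 / (1 - q)))"
      using b one by (intro mult_left_mono) auto
    finally have "c * norm h powr - s \<le> (1 - s) * (b * (1 / (1 - q)))" by (simp add: mult_ac)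
    then have "ennreal (c * norm h powr - s) * L1_shift v h
        \<le> ennreal ((1 - s) * (b * (1 / (1 - q)))) * L1_shift v h"
      by (intro mult_right_mono ennreal_leI) auto
    also have "\<dots> = ennreal (1 - s) * (ennreal (b * (1 / (1 - q))) * L1_shift v h)"
      using s by (subst ennreal_mult_assoc) auto
    finally show ?thesis .
  qed
  ultimately show ?thesis by (rule order.trans[rotated])
qed

text \<open>
  As s tends to 1 the factor |h|^(-s) tends to |h|^(-1). Half of the limit value is an
  eventual lower bound, which costs only a factor 2 in the constant and avoids a limit of products
  in which \<omega>(h) may be infinite.
\<close>
lemma L1_shift_le_Liminf_gap:
  fixes u :: "'a::euclidean_space \<times> real \<Rightarrow> real" and v :: "'a \<Rightarrow> real"
  assumes u: "u \<in> borel_measurable borel" and v: "v \<in> borel_measurable borel"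
  defines "C \<equiv> 2 / (4 powr - (real DIM('a) + 2) * (unit_ball_vol DIM('a) / 2))"
  shows "L1_shift v h \<le> ennreal (C * norm h) *
    Liminf (at_left 1) (\<lambda>s. ennreal (1 - s) * half_space_gap (real (DIM('a) + 1) + s) u v)"
proof (cases "h = 0")
  case True
  then show ?thesis by (simp add: L1_shift_def)
next
  case False
  let ?L = "Liminf (at_left 1) (\<lambda>s. ennreal (1 - s) * half_space_gap (real (DIM('a) + 1) + s) u v)"
  define c where "c = 4 powr - (real DIM('a) + 2) * (unit_ball_vol DIM('a) / 2)"
  have c: "0 < c" by (simp add: c_def)
  have h: "0 < norm h" using False by simp
  have lim: "((\<lambda>s. norm h powr - s) \<longlongrightarrow> norm h powr - 1) (at_left 1)"
    using h by (intro tendsto_intros) auto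
  have "0 < norm h powr - 1" using False by simp
  then have "norm h powr - 1 / 2 < norm h powr - 1" by linarith
  with lim have "\<forall>\<^sub>F s in at_left 1. norm h powr - 1 / 2 < norm h powr - s"
    by (rule order_tendstoD(1))
  moreover have "\<forall>\<^sub>F s in at_left 1. s \<in> {0<..<1::real}"
    by (rule eventually_at_leftI[of 0]) auto
  ultimately have "\<forall>\<^sub>F s in at_left 1. ennreal (c * (norm h powr - 1 / 2)) * L1_shift v h
      \<le> ennreal (1 - s) * half_space_gap (real (DIM('a) + 1) + s) u v"
  proof eventually_elim
    case (elim s)
    have "ennreal (c * (norm h powr - 1 / 2)) * L1_shift v h \<le> ennreal (c * norm h powr - s) * L1_shift v h"
      using elim c by (intro mult_right_mono ennreal_leI mult_left_mono) auto
    also have "\<dots> \<le> ennreal (1 - s) * half_space_gap (real (DIM('a) + 1) + s) u v"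
      unfolding c_def by (rule half_space_gap_lower_bound[OF u v]) (use elim False in auto)
    finally show ?case .
  qed
  then have le: "ennreal (c * (norm h powr - 1 / 2)) * L1_shift v h \<le> ?L"
    by (rule Liminf_bounded)
  have "C * c = 2" unfolding C_def c_def[symmetric] using c by simp
  moreover have "norm h * (norm h powr - 1 / 2) = 1 / 2"
    using h by (simp add: powr_minus)
  moreover have "C * norm h * (c * (norm h powr - 1 / 2)) = C * c * (norm h * (norm h powr - 1 / 2))"
    by (simp only: mult_ac)
  ultimately have "C * norm h * (c * (norm h powr - 1 / 2)) = 1" by simp
  then have "L1_shift v h = ennreal (C * norm h * (c * (norm h powr - 1 / 2))) * L1_shift v h"
    by simp
  also have "\<dots> = ennreal (C * norm h) * (ennreal (c * (norm h powr - 1 / 2)) * L1_shift v h)"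
    using c by (subst ennreal_mult_assoc) (auto simp: C_def c_def[symmetric])
  also have "\<dots> \<le> ennreal (C * norm h) * ?L" using le by (rule mult_left_mono) simp
  finally show ?thesis .
qed

section \<open>Weak compactness of densities with bounded mass\<close>

text \<open>
  Tychonoff's theorem for the product topology on functions: a uniformly bounded sequence of
  functions on an arbitrary index set has a cluster point for pointwise convergence. In general no
  subsequence converges, hence the formulation with frequently many indices.
\<close>
lemma bounded_functions_cluster_point:
  fixes T :: "nat \<Rightarrow> 'i \<Rightarrow> 'b::heine_borel"
  assumes bound: "\<And>n i. dist c (T n i) \<le> K"
  shows "\<exists>m. \<forall>I e. finite I \<longrightarrow> 0 < e \<longrightarrow> (\<exists>\<^sub>F n in sequentially. \<forall>i\<in>I. dist (T n i) (m i) < e)"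
proof -
  let ?S = "PiE UNIV (\<lambda>i::'i. cball c K)"
  have "compactin (product_topology (\<lambda>_. euclidean) UNIV) ?S"
    unfolding compactin_PiE by (simp add: compactin_euclidean_iff)
  then have "compact ?S"
    by (simp add: euclidean_product_topology compactin_euclidean_iff)
  moreover have "filtermap T sequentially \<noteq> bot" by (simp add: filtermap_bot_iff)
  moreover have "eventually (\<lambda>f. f \<in> ?S) (filtermap T sequentially)"
    using bound by (simp add: eventually_filtermap PiE_iff)
  ultimately obtain m where m: "inf (nhds m) (filtermap T sequentially) \<noteq> bot"
    unfolding compact_filter by metis
  have "\<exists>\<^sub>F n in sequentially. \<forall>i\<in>I. dist (T n i) (m i) < e" if I: "finite I" and e: "0 < e" for I e
    unfolding frequently_def
  proof
    assume "\<forall>\<^sub>F n in sequentially. \<not> (\<forall>i\<in>I. dist (T n i) (m i) < e)"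
    then have far: "\<forall>\<^sub>F f in filtermap T sequentially. \<not> (\<forall>i\<in>I. dist (f i) (m i) < e)"
      by (simp add: eventually_filtermap)
    let ?V = "PiE UNIV (\<lambda>i. if i \<in> I then ball (m i) e else UNIV)"
    have "finite {i. (if i \<in> I then ball (m i) e else UNIV) \<noteq> UNIV}"
      by (rule finite_subset[OF _ I]) auto
    then have "open ?V" by (intro open_PiE) auto
    moreover have "m \<in> ?V" using e by (simp add: PiE_iff)
    ultimately have "\<forall>\<^sub>F f in nhds m. f \<in> ?V" by (rule eventually_nhds_in_open)
    then have "\<forall>\<^sub>F f in nhds m. \<forall>i\<in>I. dist (f i) (m i) < e"
      by (rule eventually_mono) (auto simp: PiE_iff dist_commute split: if_splits)
    with far have "\<forall>\<^sub>F f in inf (nhds m) (filtermap T sequentially). False"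
      unfolding eventually_inf by blast
    with m show False by (simp add: trivial_limit_def)
  qed
  then show ?thesis by blast
qed

text \<open>
  A finitely additive content on the Borel sets may lose mass in increasing unions. Measuring
  open sets by the contents of their compact subsets restores countable subadditivity, because a
  compact set is covered by finitely many members of any open cover; the induced outer measure makes
  every open set Caratheodory measurable. The resulting measure lies below the content on open sets
  and above it on compact sets, and these two inequalities are all that integration of continuous
  functions with compact support needs.
\<close>
lemma outer_regularization_of_content:
  fixes m :: "'a::euclidean_space set \<Rightarrow> real"
  assumes nonneg: "\<And>A. A \<in> sets borel \<Longrightarrow> 0 \<le> m A"
    and add: "\<And>A B. A \<in> sets borel \<Longrightarrow> B \<in> sets borel \<Longrightarrow> A \<inter> B = {} \<Longrightarrow> m (A \<union> B) = m A + m B"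
  shows "\<exists>\<mu>. finite_measure \<mu> \<and> sets \<mu> = sets borel \<and>
    (\<forall>U. open U \<longrightarrow> measure \<mu> U \<le> m U) \<and> (\<forall>K. compact K \<longrightarrow> m K \<le> measure \<mu> K)"
proof -
  define \<nu> where "\<nu> U = (SUP K\<in>{K. compact K \<and> K \<subseteq> U}. ennreal (m K))" for U
  define out where "out A = (INF U\<in>{U. open U \<and> A \<subseteq> U}. \<nu> U)" for A
  have m_mono: "m A \<le> m B" if "A \<in> sets borel" "B \<in> sets borel" "A \<subseteq> B" for A B
  proof -
    have "m (A \<union> (B - A)) = m A + m (B - A)" using that by (intro add) auto
    moreover have "A \<union> (B - A) = B" using that by auto
    ultimately show ?thesis using nonneg[of "B - A"] that by auto
  qed
  have m_empty: "m {} = 0" using add[of "{}" "{}"] by simp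
  have \<nu>_upper: "ennreal (m K) \<le> \<nu> U" if "compact K" "K \<subseteq> U" for K U
    unfolding \<nu>_def by (rule SUP_upper) (simp add: that)
  have \<nu>_mono: "\<nu> U \<le> \<nu> V" if "U \<subseteq> V" for U V
    unfolding \<nu>_def using that by (intro SUP_subset_mono) auto
  have \<nu>_le: "\<nu> U \<le> ennreal (m U)" if "open U" for U
    unfolding \<nu>_def
  proof (rule SUP_least)
    fix K assume "K \<in> {K. compact K \<and> K \<subseteq> U}"
    then show "ennreal (m K) \<le> ennreal (m U)"
      using that by (intro ennreal_leI m_mono) (auto simp: borel_compact borel_open)
  qed
  have \<nu>_empty: "\<nu> {} = 0" using \<nu>_le[of "{}"] m_empty by simp
  have \<nu>_Un: "\<nu> (U \<union> V) \<le> \<nu> U + \<nu> V" if UV: "open U" "open V" for U V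
    unfolding \<nu>_def[of "U \<union> V"]
  proof (rule SUP_least)
    fix K assume "K \<in> {K. compact K \<and> K \<subseteq> U \<union> V}"
    then have K: "compact K" "K \<subseteq> U \<union> V" by auto
    have "closed (K - U)" "closed (K - V)" "(K - U) \<inter> (K - V) = {}"
      using K UV by (auto intro: closed_Diff compact_imp_closed)
    then obtain O1 O2 where O: "open O1" "open O2" "K - U \<subseteq> O1" "K - V \<subseteq> O2" "O1 \<inter> O2 = {}"
      by (rule separation_normal)
    have c: "compact (K - O1)" "compact (K - O2)"
      using K O by (auto intro: compact_diff)
    \<comment> \<open>The two compact pieces need not be disjoint, hence the set difference.\<close>
    have b: "K - O1 \<in> sets borel" "(K - O2) - (K - O1) \<in> sets borel" "K - O2 \<in> sets borel"
      using c[THEN borel_compact] by (auto simp del: Diff_Diff_Int)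
    have "K = (K - O1) \<union> ((K - O2) - (K - O1))" using O by auto
    then have "m K = m (K - O1) + m ((K - O2) - (K - O1))" using add[OF b(1,2)] by auto
    also have "\<dots> \<le> m (K - O1) + m (K - O2)" using m_mono[OF b(2,3)] by auto
    finally have "ennreal (m K) \<le> ennreal (m (K - O1)) + ennreal (m (K - O2))"
      using nonneg b by (simp flip: ennreal_plus)
    also have "\<dots> \<le> \<nu> U + \<nu> V" by (intro add_mono \<nu>_upper c) (use K O in auto)
    finally show "ennreal (m K) \<le> \<nu> U + \<nu> V" .
  qed
  have \<nu>_UN: "\<nu> (\<Union>i. U i) \<le> (\<Sum>i. \<nu> (U i))" if U: "\<And>i. open (U i)" for U :: "nat \<Rightarrow> 'a set"
    unfolding \<nu>_def[of "\<Union>i. U i"]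
  proof (rule SUP_least)
    fix K assume "K \<in> {K. compact K \<and> K \<subseteq> (\<Union>i. U i)}"
    then have K: "compact K" "K \<subseteq> (\<Union>i. U i)" by auto
    obtain C where C: "finite C" "K \<subseteq> (\<Union>i\<in>C. U i)"
      using compactE_image[OF K(1), of UNIV U] U K(2) by auto
    obtain n where n: "C \<subseteq> {..<n}" using finite_nat_bounded[OF C(1)] by auto
    have fin: "\<nu> (\<Union>i<k. U i) \<le> (\<Sum>i<k. \<nu> (U i))" for k
    proof (induction k)
      case 0
      show ?case by (simp add: \<nu>_empty)
    next
      case (Suc k)
      have "(\<Union>i<Suc k. U i) = (\<Union>i<k. U i) \<union> U k" by (auto simp: less_Suc_eq)
      then have "\<nu> (\<Union>i<Suc k. U i) \<le> \<nu> (\<Union>i<k. U i) + \<nu> (U k)"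
        using U by (auto intro!: \<nu>_Un)
      also have "\<dots> \<le> (\<Sum>i<Suc k. \<nu> (U i))" using Suc by (simp add: add_right_mono)
      finally show ?case .
    qed
    have "ennreal (m K) \<le> \<nu> (\<Union>i<n. U i)"
    proof (rule \<nu>_upper[OF K(1)])
      show "K \<subseteq> (\<Union>i<n. U i)" using C(2) n by auto
    qed
    also have "\<dots> \<le> (\<Sum>i<n. \<nu> (U i))" by (rule fin)
    also have "\<dots> \<le> (\<Sum>i. \<nu> (U i))" by (rule sum_le_suminf) auto
    finally show "ennreal (m K) \<le> (\<Sum>i. \<nu> (U i))" .
  qed
  have out_le: "out A \<le> \<nu> U" if "open U" "A \<subseteq> U" for A U
    unfolding out_def by (rule INF_lower) (simp add: that)
  have out_mono: "out A \<le> out B" if "A \<subseteq> B" for A B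
    unfolding out_def using that by (intro INF_superset_mono) auto
  have out_open: "out U = \<nu> U" if "open U" for U
    by (rule antisym[OF out_le[OF that order_refl]])
      (auto simp: out_def intro!: INF_greatest \<nu>_mono)
  have out_fin: "out A < \<infinity>" for A
  proof -
    have "out A \<le> ennreal (m UNIV)"
      using out_le[of UNIV A] \<nu>_le[of UNIV] by simp
    then show ?thesis
      unfolding infinity_ennreal_def by (rule le_less_trans) (rule ennreal_less_top)
  qed
  have approx: "\<exists>U. open U \<and> A \<subseteq> U \<and> \<nu> U \<le> out A + ennreal e" if "0 < e" for A and e :: real
  proof -
    obtain r where r: "0 \<le> r" "out A = ennreal r"
      using out_fin[of A] by (auto simp: less_top_ennreal)
    then have "out A < out A + ennreal e"
      using that by (simp flip: ennreal_plus add: ennreal_less_iff)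
    then obtain U where "open U" "A \<subseteq> U" "\<nu> U < out A + ennreal e"
      unfolding out_def[of A] INF_less_iff by auto
    then show ?thesis by (auto intro: less_imp_le)
  qed
  have out_UN: "out (\<Union>i. A i) \<le> (\<Sum>i. out (A i))" for A :: "nat \<Rightarrow> 'a set"
  proof (rule ennreal_le_epsilon)
    fix e :: real assume e: "0 < e"
    have "\<forall>i. \<exists>U. open U \<and> A i \<subseteq> U \<and> \<nu> U \<le> out (A i) + ennreal (e * (1/2) ^ Suc i)"
      by (intro allI approx) (simp add: e)
    then obtain U where U: "\<And>i. open (U i)" "\<And>i. A i \<subseteq> U i"
      "\<And>i. \<nu> (U i) \<le> out (A i) + ennreal (e * (1/2) ^ Suc i)" by metis
    have "out (\<Union>i. A i) \<le> \<nu> (\<Union>i. U i)" by (rule out_le) (use U in auto)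
    also have "\<dots> \<le> (\<Sum>i. \<nu> (U i))" by (rule \<nu>_UN[OF U(1)])
    also have "\<dots> \<le> (\<Sum>i. out (A i) + ennreal (e * (1/2) ^ Suc i))"
      by (intro suminf_le U(3)) auto
    also have "\<dots> = (\<Sum>i. out (A i)) + (\<Sum>i. ennreal (e * (1/2) ^ Suc i))"
      by (rule suminf_add[symmetric]) auto
    also have "(\<Sum>i. ennreal (e * (1/2) ^ Suc i)) = ennreal e"
      using sums_mult[OF power_half_series, of e] e by (intro suminf_ennreal_eq) auto
    finally show "out (\<Union>i. A i) \<le> (\<Sum>i. out (A i)) + ennreal e" .
  qed
  have out_empty: "out {} = 0" using out_open[of "{}"] \<nu>_empty by simp
  have oms: "outer_measure_space (Pow UNIV) out"
    unfolding outer_measure_space_def positive_def increasing_def countably_subadditive_def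
    using out_empty out_mono out_UN by simp
  have out_Un: "out (A \<union> B) \<le> out A + out B" for A B
  proof -
    have "out (A \<union> B) \<le> (\<Sum>i. out (binaryset A B i))"
      using out_UN[of "binaryset A B"] by (simp add: UN_binaryset_eq)
    also have "\<dots> = out A + out B" by (rule suminf_binaryset_eq[of out, OF out_empty])
    finally show ?thesis .
  qed
  let ?L = "lambda_system UNIV (Pow UNIV) out"
  interpret PS: sigma_algebra "UNIV :: 'a set" "Pow UNIV" by (rule sigma_algebra_Pow)
  have open_L: "V \<in> ?L" if V: "open V" for V
  proof -
    \<comment> \<open>A compact subset K of U \<inter> V and a compact subset of U - K are disjoint, so their contents
      add up to the content of a compact subset of U.\<close>
    have split_open: "\<nu> (U \<inter> V) + out (U - V) \<le> \<nu> U" if U: "open U" for U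
    proof -
      have "ennreal (m K) + out (U - V) \<le> \<nu> U" if K: "compact K" "K \<subseteq> U \<inter> V" for K
      proof -
        have "out (U - V) \<le> \<nu> (U - K)"
          by (rule out_le) (use K U in \<open>auto intro!: open_Diff compact_imp_closed\<close>)
        then have "ennreal (m K) + out (U - V) \<le> ennreal (m K) + \<nu> (U - K)"
          by (rule add_left_mono)
        also have "\<dots> = (SUP K'\<in>{K'. compact K' \<and> K' \<subseteq> U - K}. ennreal (m K) + ennreal (m K'))"
          unfolding \<nu>_def by (subst ennreal_SUP_add_right) auto
        also have "\<dots> \<le> \<nu> U"
        proof (rule SUP_least)
          fix K' assume "K' \<in> {K'. compact K' \<and> K' \<subseteq> U - K}"
          then have K': "compact K'" "K' \<subseteq> U - K" by auto
          have b: "K \<in> sets borel" "K' \<in> sets borel" using K K' by (auto intro: borel_compact)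
          then have "ennreal (m K) + ennreal (m K') = ennreal (m (K \<union> K'))"
            using K' nonneg by (subst add) (auto simp: ennreal_plus)
          also have "\<dots> \<le> \<nu> U" by (rule \<nu>_upper) (use K K' in auto)
          finally show "ennreal (m K) + ennreal (m K') \<le> \<nu> U" .
        qed
        finally show ?thesis .
      qed
      note le = this
      have "\<nu> (U \<inter> V) + out (U - V) =
          (SUP K\<in>{K. compact K \<and> K \<subseteq> U \<inter> V}. ennreal (m K) + out (U - V))"
        unfolding \<nu>_def by (subst ennreal_SUP_add_left) auto
      also have "\<dots> \<le> \<nu> U" by (rule SUP_least) (simp add: le)
      finally show ?thesis .
    qed
    have "out (X \<inter> V) + out (X - V) \<le> out X" for X
      unfolding out_def[of X]
    proof (rule INF_greatest)
      fix U assume "U \<in> {U. open U \<and> X \<subseteq> U}"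
      then have U: "open U" "X \<subseteq> U" by auto
      have "out (X \<inter> V) + out (X - V) \<le> out (U \<inter> V) + out (U - V)"
        by (intro add_mono out_mono) (use U in auto)
      also have "out (U \<inter> V) = \<nu> (U \<inter> V)" using U V by (intro out_open) auto
      also have "\<nu> (U \<inter> V) + out (U - V) \<le> \<nu> U" by (rule split_open[OF U(1)])
      finally show "out (X \<inter> V) + out (X - V) \<le> \<nu> U" .
    qed
    moreover have "out X \<le> out (X \<inter> V) + out (X - V)" for X
      using out_Un[of "X \<inter> V" "X - V"] by (simp add: Int_Diff_Un)
    ultimately show ?thesis
      unfolding PS.lambda_system_eq by (auto intro: antisym)
  qed
  have ms: "measure_space UNIV ?L out" by (rule PS.caratheodory_lemma[OF oms])
  then interpret L: sigma_algebra UNIV ?L by (simp add: measure_space_def)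
  have borel_L: "sets borel \<subseteq> ?L"
  proof -
    have "{S. open S} \<subseteq> ?L" using open_L by blast
    then have "sigma_sets UNIV {S. open S} \<subseteq> ?L" by (rule L.sigma_sets_subset)
    then show ?thesis unfolding borel_def by (subst sets_measure_of) simp_all
  qed
  define \<mu> where "\<mu> = measure_of UNIV (sets borel) out"
  have sets_\<mu>: "sets \<mu> = sets borel"
    unfolding \<mu>_def using sets.sigma_sets_eq[of borel] by simp
  have em: "emeasure \<mu> A = out A" if "A \<in> sets borel" for A
    unfolding \<mu>_def
  proof (rule emeasure_measure_of_sigma)
    show "sigma_algebra UNIV (sets borel)"
      using sets.sigma_algebra_axioms[of borel] by simp
    show "positive (sets borel) out" by (simp add: positive_def out_empty)
    show "countably_additive (sets borel) out"
    proof (rule countably_additiveI)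
      fix A :: "nat \<Rightarrow> 'a set"
      assume A: "range A \<subseteq> sets borel" "disjoint_family A" "(\<Union>i. A i) \<in> sets borel"
      have ca: "countably_additive ?L out" using ms by (simp add: measure_space_def)
      have "range A \<subseteq> ?L" "(\<Union>i. A i) \<in> ?L" using A borel_L by blast+
      then show "(\<Sum>i. out (A i)) = out (\<Union>i. A i)"
        using ca A(2) unfolding countably_additive_def by simp
    qed
  qed fact
  have "finite_measure \<mu>"
  proof
    show "emeasure \<mu> (space \<mu>) \<noteq> \<infinity>"
      using em[of UNIV] out_fin[of UNIV] sets_eq_imp_space_eq[OF sets_\<mu>] by simp
  qed
  then interpret \<mu>: finite_measure \<mu> .
  have "measure \<mu> U \<le> m U" if "open U" for U
  proof -
    have b: "U \<in> sets borel" using that by (rule borel_open)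
    have "ennreal (measure \<mu> U) \<le> ennreal (m U)"
      using \<nu>_le[OF that] unfolding \<mu>.emeasure_eq_measure[symmetric] em[OF b] out_open[OF that] .
    then show ?thesis by (rule ennreal_le_iff[THEN iffD1, OF nonneg[OF b]])
  qed
  moreover have "m K \<le> measure \<mu> K" if "compact K" for K
  proof -
    have "ennreal (m K) \<le> out K"
      unfolding out_def by (rule INF_greatest) (use that in \<open>auto intro: \<nu>_upper\<close>)
    then have "ennreal (m K) \<le> ennreal (measure \<mu> K)"
      unfolding \<mu>.emeasure_eq_measure[symmetric] em[OF borel_compact[OF that]] .
    then show ?thesis by (rule ennreal_le_iff[THEN iffD1, OF measure_nonneg])
  qed
  ultimately show ?thesis
    by (intro exI[of _ \<mu>]) (simp add: \<open>finite_measure \<mu>\<close> sets_\<mu>)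
qed


text \<open>
  Discrete layer-cake formula with step \<open>h\<close>: up to an error \<open>h\<close>, a number between 0 and
  (J + 1) h equals \<open>h\<close> times the number of levels below it.
\<close>
lemma layer_cake_step:
  fixes t h :: real
  assumes "0 \<le> t" "0 < h"
  shows "(\<Sum>i=1..J. h * of_bool (real i * h \<le> t)) \<le> t"
    and "t \<le> real (Suc J) * h \<Longrightarrow> t \<le> h + (\<Sum>i=1..J. h * of_bool (real i * h < t))"
proof -
  show "(\<Sum>i=1..J. h * of_bool (real i * h \<le> t)) \<le> t"
  proof (induction J)
    case (Suc J)
    show ?case
    proof (cases "real (Suc J) * h \<le> t")
      case True
      have "(\<Sum>i=1..Suc J. h * of_bool (real i * h \<le> t)) \<le> (\<Sum>i=1..Suc J. h)"
        using assms by (intro sum_mono) auto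
      then show ?thesis using True by simp
    next
      case False
      then show ?thesis using Suc by simp
    qed
  qed (use assms in simp)
  show "t \<le> h + (\<Sum>i=1..J. h * of_bool (real i * h < t))" if "t \<le> real (Suc J) * h"
    using that
  proof (induction J)
    case (Suc J)
    show ?case
    proof (cases "real (Suc J) * h < t")
      case True
      have "real i * h < t" if "i \<in> {1..Suc J}" for i
      proof -
        have "real i * h \<le> real (Suc J) * h" using that assms by (intro mult_right_mono) auto
        then show ?thesis using True by linarith
      qed
      then have "(\<Sum>i=1..Suc J. h * of_bool (real i * h < t)) = (\<Sum>i=1..Suc J. h)"
        by (intro sum.cong) auto
      then show ?thesis using Suc.prems by (simp add: algebra_simps)
    next
      case False
      then show ?thesis using Suc by (simp add: algebra_simps)
    qed
  qed simp
qed

text \<open>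
  The lower bound uses the closed superlevel sets and the upper bound the open ones. For a
  continuous function with compact support the former are compact and the latter open, which matches
  the two inequalities available for a regularized content.
\<close>
lemma layer_cake_bounds:
  fixes \<alpha> :: "'a::euclidean_space measure"
  assumes "finite_measure \<alpha>" and s: "sets \<alpha> = sets borel"
    and meas: "\<phi> \<in> borel_measurable borel" and bnd: "\<And>x. 0 \<le> \<phi> x" "\<And>x. \<phi> x \<le> real (Suc J) * h"
    and h: "0 < h"
  shows "(\<Sum>i=1..J. h * measure \<alpha> {x. real i * h \<le> \<phi> x}) \<le> (\<integral>x. \<phi> x \<partial>\<alpha>)"
    and "(\<integral>x. \<phi> x \<partial>\<alpha>) \<le> h * measure \<alpha> UNIV + (\<Sum>i=1..J. h * measure \<alpha> {x. real i * h < \<phi> x})"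
proof -
  interpret finite_measure \<alpha> by fact
  note [measurable_cong] = s
  note [measurable] = meas
  have sp [simp]: "space \<alpha> = UNIV" using sets_eq_imp_space_eq[OF s] by simp
  have int: "integrable \<alpha> \<phi>"
    by (rule integrable_const_bound[where B = "real (Suc J) * h"])
      (use bnd in \<open>auto intro!: AE_I2 simp del: of_nat_Suc\<close>)
  have m1: "{x. real i * h \<le> \<phi> x} \<in> sets \<alpha>" "{x. real i * h < \<phi> x} \<in> sets \<alpha>" for i
    unfolding s by measurable
  have i1: "integrable \<alpha> (\<lambda>x. h * of_bool (real i * h \<le> \<phi> x))"
    "integrable \<alpha> (\<lambda>x. h * of_bool (real i * h < \<phi> x))" for i
    by (rule integrable_const_bound[where B = h]; use h in \<open>auto intro!: AE_I2\<close>)+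
  have e1: "(\<integral>x. h * of_bool (real i * h \<le> \<phi> x) \<partial>\<alpha>) = h * measure \<alpha> {x. real i * h \<le> \<phi> x}"
    "(\<integral>x. h * of_bool (real i * h < \<phi> x) \<partial>\<alpha>) = h * measure \<alpha> {x. real i * h < \<phi> x}" for i
  proof -
    have "(\<lambda>x. h * of_bool (real i * h \<le> \<phi> x)) = (\<lambda>x. h * indicator {x. real i * h \<le> \<phi> x} x)"
      "(\<lambda>x. h * of_bool (real i * h < \<phi> x)) = (\<lambda>x. h * indicator {x. real i * h < \<phi> x} x)"
      by (auto simp: indicator_def)
    then show "(\<integral>x. h * of_bool (real i * h \<le> \<phi> x) \<partial>\<alpha>) = h * measure \<alpha> {x. real i * h \<le> \<phi> x}"
      "(\<integral>x. h * of_bool (real i * h < \<phi> x) \<partial>\<alpha>) = h * measure \<alpha> {x. real i * h < \<phi> x}"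
      by simp_all
  qed
  have "(\<Sum>i=1..J. h * measure \<alpha> {x. real i * h \<le> \<phi> x})
      = (\<integral>x. (\<Sum>i=1..J. h * of_bool (real i * h \<le> \<phi> x)) \<partial>\<alpha>)"
    by (subst Bochner_Integration.integral_sum) (simp_all only: i1 e1)
  also have "\<dots> \<le> (\<integral>x. \<phi> x \<partial>\<alpha>)"
    by (intro integral_mono int Bochner_Integration.integrable_sum i1 layer_cake_step bnd h)
  finally show "(\<Sum>i=1..J. h * measure \<alpha> {x. real i * h \<le> \<phi> x}) \<le> (\<integral>x. \<phi> x \<partial>\<alpha>)" .
  have "(\<integral>x. \<phi> x \<partial>\<alpha>) \<le> (\<integral>x. h + (\<Sum>i=1..J. h * of_bool (real i * h < \<phi> x)) \<partial>\<alpha>)"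
    by (intro integral_mono int Bochner_Integration.integrable_sum Bochner_Integration.integrable_add
        i1 layer_cake_step bnd h integrable_const)
  also have "\<dots> = (\<integral>x. h \<partial>\<alpha>) + (\<integral>x. (\<Sum>i=1..J. h * of_bool (real i * h < \<phi> x)) \<partial>\<alpha>)"
    by (intro Bochner_Integration.integral_add Bochner_Integration.integrable_sum i1 integrable_const)
  also have "(\<integral>x. (\<Sum>i=1..J. h * of_bool (real i * h < \<phi> x)) \<partial>\<alpha>)
      = (\<Sum>i=1..J. h * measure \<alpha> {x. real i * h < \<phi> x})"
    by (subst Bochner_Integration.integral_sum) (simp_all only: i1 e1)
  finally show "(\<integral>x. \<phi> x \<partial>\<alpha>) \<le> h * measure \<alpha> UNIV + (\<Sum>i=1..J. h * measure \<alpha> {x. real i * h < \<phi> x})"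
    by (simp add: mult.commute)
qed

lemma bounded_if_compact_support:
  fixes \<phi> :: "'a::euclidean_space \<Rightarrow> real"
  assumes cont: "continuous_on UNIV \<phi>" and supp: "compact (closure {x. \<phi> x \<noteq> 0})"
  shows "\<exists>B. \<forall>x. \<bar>\<phi> x\<bar> \<le> B"
proof -
  have "bounded (\<phi> ` closure {x. \<phi> x \<noteq> 0})"
    using cont supp by (intro compact_imp_bounded compact_continuous_image)
      (auto intro: continuous_on_subset)
  then obtain B where B: "\<And>x. x \<in> closure {x. \<phi> x \<noteq> 0} \<Longrightarrow> \<bar>\<phi> x\<bar> \<le> B"
    unfolding bounded_real by blast
  have "\<bar>\<phi> x\<bar> \<le> max 0 B" for x
    using B[of x] closure_subset[of "{x. \<phi> x \<noteq> 0}"] by (cases "\<phi> x = 0") auto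
  then show ?thesis by blast
qed

text \<open>
  Finitely many superlevel sets control the integral of \<phi> up to \<delta>. A cluster point of
  set functions only gives information about finitely many sets at a time, so this finiteness is
  what transfers the convergence to integrals.
\<close>
lemma integral_close_if_level_sets_close:
  fixes \<phi> :: "'a::euclidean_space \<Rightarrow> real"
  assumes "finite_measure \<mu>" and s: "sets \<mu> = sets borel"
    and open_le: "\<forall>U. open U \<longrightarrow> measure \<mu> U \<le> m U"
    and compact_ge: "\<forall>C. compact C \<longrightarrow> m C \<le> measure \<mu> C"
    and mass: "measure \<mu> UNIV \<le> K"
    and cont: "continuous_on UNIV \<phi>" and supp: "compact (closure {x. \<phi> x \<noteq> 0})"
    and nonneg: "\<And>x. 0 \<le> \<phi> x" and \<delta>: "0 < \<delta>"
  shows "\<exists>I e. finite I \<and> 0 < e \<and> (\<forall>\<alpha>. finite_measure \<alpha> \<longrightarrow> sets \<alpha> = sets borel \<longrightarrow>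
     measure \<alpha> UNIV \<le> K \<longrightarrow> (\<forall>A\<in>I. \<bar>measure \<alpha> A - m A\<bar> < e) \<longrightarrow>
     \<bar>(\<integral>x. \<phi> x \<partial>\<alpha>) - (\<integral>x. \<phi> x \<partial>\<mu>)\<bar> \<le> \<delta>)"
proof -
  have K: "0 \<le> K" by (rule order.trans[OF measure_nonneg mass])
  define h where "h = \<delta> / (2 * (K + 1))"
  have h: "0 < h" using \<delta> K by (simp add: h_def)
  have hK: "h * K \<le> \<delta> / 2"
  proof -
    have "h * K \<le> h * (K + 1)" using h by (intro mult_left_mono) auto
    also have "\<dots> = \<delta> / 2" using K by (simp add: h_def field_simps)
    finally show ?thesis .
  qed
  obtain B where B: "\<And>x. \<bar>\<phi> x\<bar> \<le> B"
    using bounded_if_compact_support[OF cont supp] by blast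
  have B': "\<phi> x \<le> max 0 B" for x
    using B[of x] by linarith
  obtain J :: nat where J: "max 0 B / h \<le> real J" using real_arch_simple by blast
  have bnd: "\<phi> x \<le> real (Suc J) * h" for x
  proof -
    have "\<phi> x \<le> max 0 B" by (rule B')
    also have "\<dots> \<le> real J * h" using J h by (simp add: divide_le_eq)
    also have "\<dots> \<le> real (Suc J) * h" using h by simp
    finally show ?thesis .
  qed
  define P where "P = (real J + 1) * h"
  have P: "0 < P" using h by (simp add: P_def)
  define e where "e = \<delta> / (2 * P)"
  have e: "0 < e" using \<delta> P by (simp add: e_def)
  have Je: "real J * (h * e) \<le> \<delta> / 2"
  proof -
    have "real J * (h * e) \<le> (real J + 1) * (h * e)" using h e by (intro mult_right_mono) auto
    also have "\<dots> = P * e" by (simp add: P_def)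
    also have "\<dots> = \<delta> / 2" using P by (simp add: e_def)
    finally show ?thesis .
  qed
  define I where "I = (\<lambda>i. {x. real i * h \<le> \<phi> x}) ` {1..J} \<union> (\<lambda>i. {x. real i * h < \<phi> x}) ` {1..J}"
  have [measurable]: "\<phi> \<in> borel_measurable borel" by (rule borel_measurable_continuous_onI[OF cont])
  have op: "open {x. real i * h < \<phi> x}" for i
    by (intro open_Collect_less continuous_on_const cont)
  have co: "compact {x. real i * h \<le> \<phi> x}" if "i \<in> {1..J}" for i
  proof -
    have "{x. real i * h \<le> \<phi> x} \<subseteq> closure {x. \<phi> x \<noteq> 0}"
    proof
      fix x assume "x \<in> {x. real i * h \<le> \<phi> x}"
      moreover have "0 < real i * h" using h that by simp
      ultimately have "x \<in> {x. \<phi> x \<noteq> 0}" by simp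
      then show "x \<in> closure {x. \<phi> x \<noteq> 0}" by (rule subsetD[OF closure_subset])
    qed
    moreover have "closed {x. real i * h \<le> \<phi> x}"
      by (intro closed_Collect_le continuous_on_const cont)
    ultimately show ?thesis using compact_Int_closed[OF supp] by (metis inf.absorb2)
  qed
  have main: "\<bar>(\<integral>x. \<phi> x \<partial>\<alpha>) - (\<integral>x. \<phi> x \<partial>\<mu>)\<bar> \<le> \<delta>"
    if fin: "finite_measure \<alpha>" and s': "sets \<alpha> = sets borel" and mass': "measure \<alpha> UNIV \<le> K"
      and close: "\<forall>A\<in>I. \<bar>measure \<alpha> A - m A\<bar> < e" for \<alpha>
  proof -
    interpret finite_measure \<alpha> by fact
    note [measurable_cong] = s'
    have mono: "measure \<alpha> {x. real i * h < \<phi> x} \<le> measure \<alpha> {x. real i * h \<le> \<phi> x}" for i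
      by (rule finite_measure_mono) (auto simp: s')
    have c1: "m {x. real i * h < \<phi> x} \<le> measure \<alpha> {x. real i * h < \<phi> x} + e"
      and c2: "measure \<alpha> {x. real i * h \<le> \<phi> x} \<le> m {x. real i * h \<le> \<phi> x} + e" if "i \<in> {1..J}" for i
    proof -
      have "{x. real i * h < \<phi> x} \<in> I" "{x. real i * h \<le> \<phi> x} \<in> I"
        unfolding I_def using that by auto
      with close show "m {x. real i * h < \<phi> x} \<le> measure \<alpha> {x. real i * h < \<phi> x} + e"
        and "measure \<alpha> {x. real i * h \<le> \<phi> x} \<le> m {x. real i * h \<le> \<phi> x} + e"
        by (smt (verit))+
    qed
    have sum_e: "(\<Sum>i=1..J. h * (f i + e)) = (\<Sum>i=1..J. h * f i) + real J * (h * e)" for f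
      by (simp add: distrib_left sum.distrib)
    note lc = layer_cake_bounds[OF _ _ _ nonneg bnd h]
    have "(\<integral>x. \<phi> x \<partial>\<mu>) \<le> h * measure \<mu> UNIV + (\<Sum>i=1..J. h * measure \<mu> {x. real i * h < \<phi> x})"
      by (rule lc(2)) (simp_all add: assms(1) s)
    also have "\<dots> \<le> h * K + (\<Sum>i=1..J. h * (measure \<alpha> {x. real i * h \<le> \<phi> x} + e))"
    proof (intro add_mono mult_left_mono sum_mono mass)
      fix i assume i: "i \<in> {1..J}"
      show "measure \<mu> {x. real i * h < \<phi> x} \<le> measure \<alpha> {x. real i * h \<le> \<phi> x} + e"
        using open_le[rule_format, OF op[of i]] c1[OF i] mono[of i] by linarith
    qed (use h in auto)
    also have "\<dots> \<le> h * K + real J * (h * e) + (\<integral>x. \<phi> x \<partial>\<alpha>)"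
      unfolding sum_e using lc(1)[OF fin s'] by simp
    finally have 1: "(\<integral>x. \<phi> x \<partial>\<mu>) \<le> (\<integral>x. \<phi> x \<partial>\<alpha>) + \<delta>" using hK Je by linarith
    have "(\<integral>x. \<phi> x \<partial>\<alpha>) \<le> h * measure \<alpha> UNIV + (\<Sum>i=1..J. h * measure \<alpha> {x. real i * h < \<phi> x})"
      by (rule lc(2)) (simp_all add: fin s')
    also have "\<dots> \<le> h * K + (\<Sum>i=1..J. h * (measure \<mu> {x. real i * h \<le> \<phi> x} + e))"
    proof (intro add_mono mult_left_mono sum_mono mass')
      fix i assume i: "i \<in> {1..J}"
      show "measure \<alpha> {x. real i * h < \<phi> x} \<le> measure \<mu> {x. real i * h \<le> \<phi> x} + e"
        using compact_ge[rule_format, OF co[OF i]] c2[OF i] mono[of i] by linarith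
    qed (use h in auto)
    also have "\<dots> \<le> h * K + real J * (h * e) + (\<integral>x. \<phi> x \<partial>\<mu>)"
      unfolding sum_e using lc(1)[OF assms(1) s] by simp
    finally have 2: "(\<integral>x. \<phi> x \<partial>\<alpha>) \<le> (\<integral>x. \<phi> x \<partial>\<mu>) + \<delta>" using hK Je by linarith
    show ?thesis using 1 2 by linarith
  qed
  have "finite I" by (simp add: I_def)
  then show ?thesis by (intro exI[of _ I] exI[of _ e] conjI allI impI main e)
qed

lemma integrable_bounded_mult:
  fixes f \<phi> :: "'a \<Rightarrow> real"
  assumes f: "integrable M f" and [measurable]: "\<phi> \<in> borel_measurable M" and B: "\<And>x. \<bar>\<phi> x\<bar> \<le> B"
  shows "integrable M (\<lambda>x. \<phi> x * f x)"
proof (rule Bochner_Integration.integrable_bound)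
  show "integrable M (\<lambda>x. B * f x)" using f by simp
  show "AE x in M. norm (\<phi> x * f x) \<le> norm (B * f x)"
  proof (rule AE_I2)
    fix x
    have "\<bar>\<phi> x\<bar> * \<bar>f x\<bar> \<le> \<bar>B\<bar> * \<bar>f x\<bar>" using B[of x] by (intro mult_right_mono) auto
    then show "norm (\<phi> x * f x) \<le> norm (B * f x)" by (simp add: abs_mult)
  qed
  show "(\<lambda>x. \<phi> x * f x) \<in> borel_measurable M"
    using borel_measurable_integrable[OF f] by measurable
qed

text \<open>
  Weak compactness in the form needed here. The positive and negative parts of the
  densities are treated as one sequence of pair-valued set functions, so that both cluster along
  the same indices. A limit of the integrals of \<phi> along the whole sequence must then agree with
  the integrals against the two regularized cluster points.
\<close>
lemma weak_limit_of_densities: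
  fixes g :: "nat \<Rightarrow> 'a::euclidean_space \<Rightarrow> real"
  assumes g: "\<And>n. integrable lborel (g n)" and mass: "\<And>n. (\<integral>x. \<bar>g n x\<bar> \<partial>lborel) \<le> K"
  shows "\<exists>\<mu> \<nu>. finite_measure \<mu> \<and> finite_measure \<nu> \<and> sets \<mu> = sets borel \<and> sets \<nu> = sets borel \<and>
    measure \<mu> UNIV \<le> K \<and> measure \<nu> UNIV \<le> K \<and>
    (\<forall>\<phi> l. continuous_on UNIV \<phi> \<longrightarrow> compact (closure {x. \<phi> x \<noteq> 0}) \<longrightarrow>
       (\<lambda>n. \<integral>x. \<phi> x * g n x \<partial>lborel) \<longlonglongrightarrow> l \<longrightarrow> l = (\<integral>x. \<phi> x \<partial>\<mu>) - (\<integral>x. \<phi> x \<partial>\<nu>))"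
proof -
  \<comment> \<open>The measure whose density is the positive part of f; the negative part of f is the positive
    part of - f.\<close>
  define D where "D f = density lborel (\<lambda>x. ennreal (max 0 (f x)))" for f :: "'a \<Rightarrow> real"
  have [simp]: "sets (D f) = sets borel" for f by (simp add: D_def)
  have [simp]: "space (D f) = UNIV" for f by (simp add: D_def)
  have D_fin: "finite_measure (D f)" and D_mass: "measure (D f) UNIV \<le> (\<integral>x. \<bar>f x\<bar> \<partial>lborel)"
    and D_int: "\<phi> \<in> borel_measurable borel \<Longrightarrow> (\<integral>x. \<phi> x \<partial>D f) = (\<integral>x. max 0 (f x) * \<phi> x \<partial>lborel)"
    if f: "integrable lborel f" for f \<phi>
  proof -
    have [measurable]: "f \<in> borel_measurable borel" using borel_measurable_integrable[OF f] by simp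
    have i: "integrable lborel (\<lambda>x. max 0 (f x))" using f by (intro integrable_max) auto
    have e: "emeasure (D f) UNIV = ennreal (\<integral>x. max 0 (f x) \<partial>lborel)"
      unfolding D_def using i by (subst emeasure_density) (auto simp: nn_integral_eq_integral)
    show "finite_measure (D f)" by (rule finite_measureI) (simp add: e)
    then interpret finite_measure "D f" .
    have "(\<integral>x. max 0 (f x) \<partial>lborel) \<le> (\<integral>x. \<bar>f x\<bar> \<partial>lborel)"
      using i f by (intro integral_mono) auto
    moreover have "measure (D f) UNIV = (\<integral>x. max 0 (f x) \<partial>lborel)"
      unfolding measure_def e by (simp add: integral_nonneg_AE)
    ultimately show "measure (D f) UNIV \<le> (\<integral>x. \<bar>f x\<bar> \<partial>lborel)" by simp
    show "(\<integral>x. \<phi> x \<partial>D f) = (\<integral>x. max 0 (f x) * \<phi> x \<partial>lborel)" if "\<phi> \<in> borel_measurable borel"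
      unfolding D_def using that by (subst integral_density) auto
  qed
  have mg: "integrable lborel (\<lambda>x. - g n x)" for n using g by simp
  note fin = D_fin[OF g] D_fin[OF mg]
  have massP: "measure (D (g n)) UNIV \<le> K" "measure (D (\<lambda>x. - g n x)) UNIV \<le> K" for n
    using D_mass[OF g, of n] D_mass[OF mg, of n] mass[of n] by auto
  define T where "T n A = (measure (D (g n)) A, measure (D (\<lambda>x. - g n x)) A)" for n A
  have "dist 0 (T n A) \<le> K + K" for n A
  proof -
    have "measure (D (g n)) A \<le> K" "measure (D (\<lambda>x. - g n x)) A \<le> K"
      using finite_measure.bounded_measure[OF fin(1), of n A] finite_measure.bounded_measure[OF fin(2), of n A]
        massP[of n] by auto
    moreover have "norm (T n A) \<le> measure (D (g n)) A + measure (D (\<lambda>x. - g n x)) A"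
      using norm_Pair_le[of "measure (D (g n)) A" "measure (D (\<lambda>x. - g n x)) A"] by (simp add: T_def)
    ultimately show ?thesis by simp
  qed
  from bounded_functions_cluster_point[of 0 T, OF this] obtain m where
    m: "\<And>I e. finite I \<Longrightarrow> 0 < e \<Longrightarrow> \<exists>\<^sub>F n in sequentially. \<forall>A\<in>I. dist (T n A) (m A) < e"
    by auto
  define p where "p A = fst (m A)" for A
  define q where "q A = snd (m A)" for A
  have close: "\<exists>\<^sub>F n in sequentially. \<forall>A\<in>I. \<bar>measure (D (g n)) A - p A\<bar> < e \<and>
      \<bar>measure (D (\<lambda>x. - g n x)) A - q A\<bar> < e" if I: "finite I" "0 < e" for I e
  proof (rule frequently_elim1[OF m[OF I]])
    fix n assume n: "\<forall>A\<in>I. dist (T n A) (m A) < e"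
    show "\<forall>A\<in>I. \<bar>measure (D (g n)) A - p A\<bar> < e \<and> \<bar>measure (D (\<lambda>x. - g n x)) A - q A\<bar> < e"
    proof
      fix A assume "A \<in> I"
      with n have "dist (T n A) (m A) < e" by blast
      then show "\<bar>measure (D (g n)) A - p A\<bar> < e \<and> \<bar>measure (D (\<lambda>x. - g n x)) A - q A\<bar> < e"
        using dist_fst_le[of "T n A" "m A"] dist_snd_le[of "T n A" "m A"]
        by (simp add: T_def p_def q_def dist_real_def)
    qed
  qed
  have nonneg: "0 \<le> p A" "0 \<le> q A" for A
  proof -
    have "0 \<le> p A + e \<and> 0 \<le> q A + e" if e: "0 < e" for e
    proof -
      obtain n where "\<bar>measure (D (g n)) A - p A\<bar> < e" "\<bar>measure (D (\<lambda>x. - g n x)) A - q A\<bar> < e"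
        using frequently_ex[OF close[of "{A}" e]] e by auto
      then show ?thesis
        using measure_nonneg[of "D (g n)" A] measure_nonneg[of "D (\<lambda>x. - g n x)" A] by linarith
    qed
    note small = this
    show "0 \<le> p A" "0 \<le> q A" by (rule field_le_epsilon; use small in blast)+
  qed
  have mass_pq: "p UNIV \<le> K" "q UNIV \<le> K"
  proof -
    have "p UNIV \<le> K + e \<and> q UNIV \<le> K + e" if e: "0 < e" for e
    proof -
      obtain n where "\<bar>measure (D (g n)) UNIV - p UNIV\<bar> < e" "\<bar>measure (D (\<lambda>x. - g n x)) UNIV - q UNIV\<bar> < e"
        using frequently_ex[OF close[of "{UNIV}" e]] e by auto
      then show ?thesis using massP[of n] by linarith
    qed
    note small = this
    show "p UNIV \<le> K" "q UNIV \<le> K" by (rule field_le_epsilon; use small in blast)+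
  qed
  have add: "p (A \<union> B) = p A + p B" "q (A \<union> B) = q A + q B"
    if AB: "A \<in> sets borel" "B \<in> sets borel" "A \<inter> B = {}" for A B
  proof -
    have "\<bar>p (A \<union> B) - (p A + p B)\<bar> \<le> 0 + e \<and> \<bar>q (A \<union> B) - (q A + q B)\<bar> \<le> 0 + e" if e: "0 < e" for e
    proof -
      obtain n where n: "\<forall>X\<in>{A, B, A \<union> B}. \<bar>measure (D (g n)) X - p X\<bar> < e / 3 \<and>
          \<bar>measure (D (\<lambda>x. - g n x)) X - q X\<bar> < e / 3"
        using frequently_ex[OF close[of "{A, B, A \<union> B}" "e / 3"]] e by auto
      have "measure (D (g n)) (A \<union> B) = measure (D (g n)) A + measure (D (g n)) B"
        "measure (D (\<lambda>x. - g n x)) (A \<union> B) = measure (D (\<lambda>x. - g n x)) A + measure (D (\<lambda>x. - g n x)) B"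
        by (rule finite_measure.finite_measure_Union; use fin AB in simp)+
      moreover have "\<bar>measure (D (g n)) X - p X\<bar> < e / 3 \<and>
          \<bar>measure (D (\<lambda>x. - g n x)) X - q X\<bar> < e / 3" if "X \<in> {A, B, A \<union> B}" for X
        using n that by blast
      from this[of A] this[of B] this[of "A \<union> B"] have
        "\<bar>measure (D (g n)) A - p A\<bar> < e / 3" "\<bar>measure (D (\<lambda>x. - g n x)) A - q A\<bar> < e / 3"
        "\<bar>measure (D (g n)) B - p B\<bar> < e / 3" "\<bar>measure (D (\<lambda>x. - g n x)) B - q B\<bar> < e / 3"
        "\<bar>measure (D (g n)) (A \<union> B) - p (A \<union> B)\<bar> < e / 3"
        "\<bar>measure (D (\<lambda>x. - g n x)) (A \<union> B) - q (A \<union> B)\<bar> < e / 3"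
        by simp_all
      ultimately show ?thesis by (intro conjI) linarith+
    qed
    note small = this
    have "\<bar>p (A \<union> B) - (p A + p B)\<bar> \<le> 0" "\<bar>q (A \<union> B) - (q A + q B)\<bar> \<le> 0"
      by (rule field_le_epsilon; use small in blast)+
    then show "p (A \<union> B) = p A + p B" "q (A \<union> B) = q A + q B" by auto
  qed
  have "\<exists>\<mu>. finite_measure \<mu> \<and> sets \<mu> = sets borel \<and>
      (\<forall>U. open U \<longrightarrow> measure \<mu> U \<le> p U) \<and> (\<forall>C. compact C \<longrightarrow> p C \<le> measure \<mu> C)"
    by (rule outer_regularization_of_content) (simp_all add: nonneg add)
  then obtain \<mu> where "finite_measure \<mu> \<and> sets \<mu> = sets borel \<and>
      (\<forall>U. open U \<longrightarrow> measure \<mu> U \<le> p U) \<and> (\<forall>C. compact C \<longrightarrow> p C \<le> measure \<mu> C)" ..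
  then have \<mu>: "finite_measure \<mu>" "sets \<mu> = sets borel"
      "\<forall>U. open U \<longrightarrow> measure \<mu> U \<le> p U" "\<forall>C. compact C \<longrightarrow> p C \<le> measure \<mu> C"
    by simp_all
  have "\<exists>\<nu>. finite_measure \<nu> \<and> sets \<nu> = sets borel \<and>
      (\<forall>U. open U \<longrightarrow> measure \<nu> U \<le> q U) \<and> (\<forall>C. compact C \<longrightarrow> q C \<le> measure \<nu> C)"
    by (rule outer_regularization_of_content) (simp_all add: nonneg add)
  then obtain \<nu> where "finite_measure \<nu> \<and> sets \<nu> = sets borel \<and>
      (\<forall>U. open U \<longrightarrow> measure \<nu> U \<le> q U) \<and> (\<forall>C. compact C \<longrightarrow> q C \<le> measure \<nu> C)" ..
  then have \<nu>: "finite_measure \<nu>" "sets \<nu> = sets borel"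
      "\<forall>U. open U \<longrightarrow> measure \<nu> U \<le> q U" "\<forall>C. compact C \<longrightarrow> q C \<le> measure \<nu> C"
    by simp_all
  have mass_\<mu>: "measure \<mu> UNIV \<le> K" "measure \<nu> UNIV \<le> K"
    using \<mu>(3)[rule_format, of UNIV] \<nu>(3)[rule_format, of UNIV] mass_pq by auto
  have pos: "\<exists>I e. finite I \<and> 0 < e \<and> (\<forall>n. (\<forall>A\<in>I. \<bar>measure (D (g n)) A - p A\<bar> < e \<and>
       \<bar>measure (D (\<lambda>x. - g n x)) A - q A\<bar> < e) \<longrightarrow>
       \<bar>(\<integral>x. \<phi> x * g n x \<partial>lborel) - ((\<integral>x. \<phi> x \<partial>\<mu>) - (\<integral>x. \<phi> x \<partial>\<nu>))\<bar> \<le> 2 * \<delta>)"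
    if cont: "continuous_on UNIV \<phi>" and supp: "compact (closure {x. \<phi> x \<noteq> 0})"
      and nn: "\<And>x. 0 \<le> \<phi> x" and \<delta>: "0 < \<delta>" for \<phi> :: "'a \<Rightarrow> real" and \<delta>
  proof -
    have [measurable]: "\<phi> \<in> borel_measurable borel" by (rule borel_measurable_continuous_onI[OF cont])
    obtain I1 e1 where 1: "finite I1" "0 < e1" "\<forall>\<alpha>. finite_measure \<alpha> \<longrightarrow> sets \<alpha> = sets borel \<longrightarrow>
       measure \<alpha> UNIV \<le> K \<longrightarrow> (\<forall>A\<in>I1. \<bar>measure \<alpha> A - p A\<bar> < e1) \<longrightarrow>
       \<bar>(\<integral>x. \<phi> x \<partial>\<alpha>) - (\<integral>x. \<phi> x \<partial>\<mu>)\<bar> \<le> \<delta>"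
      using integral_close_if_level_sets_close[of \<mu> p, OF \<mu> mass_\<mu>(1) cont supp nn \<delta>]
      by (elim exE conjE)
    obtain I2 e2 where 2: "finite I2" "0 < e2" "\<forall>\<alpha>. finite_measure \<alpha> \<longrightarrow> sets \<alpha> = sets borel \<longrightarrow>
       measure \<alpha> UNIV \<le> K \<longrightarrow> (\<forall>A\<in>I2. \<bar>measure \<alpha> A - q A\<bar> < e2) \<longrightarrow>
       \<bar>(\<integral>x. \<phi> x \<partial>\<alpha>) - (\<integral>x. \<phi> x \<partial>\<nu>)\<bar> \<le> \<delta>"
      using integral_close_if_level_sets_close[of \<nu> q, OF \<nu> mass_\<mu>(2) cont supp nn \<delta>]
      by (elim exE conjE)
    have "\<bar>(\<integral>x. \<phi> x * g n x \<partial>lborel) - ((\<integral>x. \<phi> x \<partial>\<mu>) - (\<integral>x. \<phi> x \<partial>\<nu>))\<bar> \<le> 2 * \<delta>"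
      if n: "\<forall>A\<in>I1 \<union> I2. \<bar>measure (D (g n)) A - p A\<bar> < min e1 e2 \<and>
       \<bar>measure (D (\<lambda>x. - g n x)) A - q A\<bar> < min e1 e2" for n
    proof -
      have a: "\<bar>(\<integral>x. \<phi> x \<partial>D (g n)) - (\<integral>x. \<phi> x \<partial>\<mu>)\<bar> \<le> \<delta>"
        by (rule 1(3)[rule_format]) (use fin massP n in auto)
      have b: "\<bar>(\<integral>x. \<phi> x \<partial>D (\<lambda>x. - g n x)) - (\<integral>x. \<phi> x \<partial>\<nu>)\<bar> \<le> \<delta>"
        by (rule 2(3)[rule_format]) (use fin massP n in auto)
      obtain B where B: "\<And>x. \<bar>\<phi> x\<bar> \<le> B"
        using bounded_if_compact_support[OF cont supp] by blast
      have int: "integrable lborel (\<lambda>x. max 0 (f x) * \<phi> x)" if f: "integrable lborel f" for f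
        using integrable_bounded_mult[of lborel "\<lambda>x. max 0 (f x)" \<phi>, OF _ _ B] f
        by (simp add: mult.commute)
      have "(\<integral>x. \<phi> x \<partial>D (g n)) - (\<integral>x. \<phi> x \<partial>D (\<lambda>x. - g n x))
          = (\<integral>x. max 0 (g n x) * \<phi> x - max 0 (- g n x) * \<phi> x \<partial>lborel)"
        using int[OF g] int[OF mg] by (simp add: D_int[OF g] D_int[OF mg])
      also have "\<dots> = (\<integral>x. \<phi> x * g n x \<partial>lborel)"
        by (intro Bochner_Integration.integral_cong refl) (auto simp: max_def)
      finally show ?thesis using a b by linarith
    qed
    note close_imp = this
    show ?thesis
      by (intro exI[of _ "I1 \<union> I2"] exI[of _ "min e1 e2"] conjI allI impI close_imp)
        (simp_all add: 1(1,2) 2(1,2))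
  qed
  have main: "l = (\<integral>x. \<phi> x \<partial>\<mu>) - (\<integral>x. \<phi> x \<partial>\<nu>)"
    if cont: "continuous_on UNIV \<phi>" and supp: "compact (closure {x. \<phi> x \<noteq> 0})"
      and l: "(\<lambda>n. \<integral>x. \<phi> x * g n x \<partial>lborel) \<longlonglongrightarrow> l" for \<phi> :: "'a \<Rightarrow> real" and l
  proof -
    have pp: "continuous_on UNIV (\<lambda>x. max 0 (\<psi> x))" "compact (closure {x. max 0 (\<psi> x) \<noteq> 0})"
      if c: "continuous_on UNIV \<psi>" and s: "compact (closure {x. \<psi> x \<noteq> 0})" for \<psi> :: "'a \<Rightarrow> real"
    proof -
      show "continuous_on UNIV (\<lambda>x. max 0 (\<psi> x))" by (intro continuous_intros c)
      have "closure {x. max 0 (\<psi> x) \<noteq> 0} \<subseteq> closure {x. \<psi> x \<noteq> 0}" by (rule closure_mono) auto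
      then show "compact (closure {x. max 0 (\<psi> x) \<noteq> 0})"
        using compact_Int_closed[OF s closed_closure] by (metis inf.absorb2)
    qed
    let ?p = "\<lambda>x. max 0 (\<phi> x)" and ?n = "\<lambda>x. max 0 (- \<phi> x)"
    have mcont: "continuous_on UNIV (\<lambda>x. - \<phi> x)" and msupp: "compact (closure {x. - \<phi> x \<noteq> 0})"
      using cont supp by (auto intro: continuous_intros)
    note P = pp[OF cont supp] and N = pp[OF mcont msupp]
    have diff: "\<phi> = (\<lambda>x. ?p x - ?n x)" by (auto simp: max_def)
    have [measurable]: "\<phi> \<in> borel_measurable borel" by (rule borel_measurable_continuous_onI[OF cont])
    obtain B where B: "\<And>x. \<bar>\<phi> x\<bar> \<le> B" using bounded_if_compact_support[OF cont supp] by blast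
    have Bp: "\<bar>?p x\<bar> \<le> B" "\<bar>?n x\<bar> \<le> B" for x using B[of x] by (auto simp: max_def abs_if split: if_splits)
    have split_g: "(\<integral>x. \<phi> x * g n x \<partial>lborel)
        = (\<integral>x. ?p x * g n x \<partial>lborel) - (\<integral>x. ?n x * g n x \<partial>lborel)" for n
    proof -
      have "(\<integral>x. ?p x * g n x \<partial>lborel) - (\<integral>x. ?n x * g n x \<partial>lborel)
          = (\<integral>x. ?p x * g n x - ?n x * g n x \<partial>lborel)"
        by (rule Bochner_Integration.integral_diff[symmetric];
            rule integrable_bounded_mult[OF g _ Bp(1)] integrable_bounded_mult[OF g _ Bp(2)]; measurable)
      also have "\<dots> = (\<integral>x. \<phi> x * g n x \<partial>lborel)"
        by (intro Bochner_Integration.integral_cong refl) (auto simp: max_def)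
      finally show ?thesis by simp
    qed
    have split_fin: "(\<integral>x. \<phi> x \<partial>\<gamma>) = (\<integral>x. ?p x \<partial>\<gamma>) - (\<integral>x. ?n x \<partial>\<gamma>)"
      if "finite_measure \<gamma>" and s: "sets \<gamma> = sets borel" for \<gamma>
    proof -
      interpret finite_measure \<gamma> by fact
      note [measurable_cong] = s
      have "integrable \<gamma> ?p" "integrable \<gamma> ?n"
        by (rule integrable_const_bound[where B = B]; use Bp in simp)+
      then have "(\<integral>x. ?p x - ?n x \<partial>\<gamma>) = (\<integral>x. ?p x \<partial>\<gamma>) - (\<integral>x. ?n x \<partial>\<gamma>)"
        by (rule Bochner_Integration.integral_diff)
      then show ?thesis by (subst diff) 
    qed
    have "\<bar>l - ((\<integral>x. \<phi> x \<partial>\<mu>) - (\<integral>x. \<phi> x \<partial>\<nu>))\<bar> \<le> 0 + e" if e: "0 < e" for e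
    proof -
      have e5: "0 < e / 5" using e by simp
      obtain I1 e1 where 1: "finite I1" "0 < e1" "\<forall>n. (\<forall>A\<in>I1. \<bar>measure (D (g n)) A - p A\<bar> < e1 \<and>
         \<bar>measure (D (\<lambda>x. - g n x)) A - q A\<bar> < e1) \<longrightarrow>
         \<bar>(\<integral>x. ?p x * g n x \<partial>lborel) - ((\<integral>x. ?p x \<partial>\<mu>) - (\<integral>x. ?p x \<partial>\<nu>))\<bar> \<le> 2 * (e / 5)"
        using pos[OF P max.cobounded1 e5] by (elim exE conjE)
      obtain I2 e2 where 2: "finite I2" "0 < e2" "\<forall>n. (\<forall>A\<in>I2. \<bar>measure (D (g n)) A - p A\<bar> < e2 \<and>
         \<bar>measure (D (\<lambda>x. - g n x)) A - q A\<bar> < e2) \<longrightarrow>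
         \<bar>(\<integral>x. ?n x * g n x \<partial>lborel) - ((\<integral>x. ?n x \<partial>\<mu>) - (\<integral>x. ?n x \<partial>\<nu>))\<bar> \<le> 2 * (e / 5)"
        using pos[OF N max.cobounded1 e5] by (elim exE conjE)
      have "\<forall>\<^sub>F n in sequentially. dist (\<integral>x. \<phi> x * g n x \<partial>lborel) l < e / 5"
        using l e5 by (rule tendstoD)
      moreover have "\<exists>\<^sub>F n in sequentially. \<forall>A\<in>I1 \<union> I2. \<bar>measure (D (g n)) A - p A\<bar> < min e1 e2 \<and>
         \<bar>measure (D (\<lambda>x. - g n x)) A - q A\<bar> < min e1 e2"
        by (rule close) (simp_all add: 1(1,2) 2(1,2))
      ultimately have "\<exists>\<^sub>F n in sequentially. dist (\<integral>x. \<phi> x * g n x \<partial>lborel) l < e / 5 \<and>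
        (\<forall>A\<in>I1 \<union> I2. \<bar>measure (D (g n)) A - p A\<bar> < min e1 e2 \<and>
         \<bar>measure (D (\<lambda>x. - g n x)) A - q A\<bar> < min e1 e2)"
        by (intro frequently_eventually_conj)
      from frequently_ex[OF this] obtain n where n: "dist (\<integral>x. \<phi> x * g n x \<partial>lborel) l < e / 5"
        "\<forall>A\<in>I1 \<union> I2. \<bar>measure (D (g n)) A - p A\<bar> < min e1 e2 \<and>
         \<bar>measure (D (\<lambda>x. - g n x)) A - q A\<bar> < min e1 e2"
        by auto
      have "\<bar>(\<integral>x. ?p x * g n x \<partial>lborel) - ((\<integral>x. ?p x \<partial>\<mu>) - (\<integral>x. ?p x \<partial>\<nu>))\<bar> \<le> 2 * (e / 5)"
        by (rule 1(3)[rule_format]) (use n(2) in auto)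
      moreover have "\<bar>(\<integral>x. ?n x * g n x \<partial>lborel) - ((\<integral>x. ?n x \<partial>\<mu>) - (\<integral>x. ?n x \<partial>\<nu>))\<bar> \<le> 2 * (e / 5)"
        by (rule 2(3)[rule_format]) (use n(2) in auto)
      ultimately show ?thesis
        using n(1) split_g[of n] split_fin[OF \<mu>(1,2)] split_fin[OF \<nu>(1,2)]
        unfolding dist_real_def by linarith
    qed
    then have "\<bar>l - ((\<integral>x. \<phi> x \<partial>\<mu>) - (\<integral>x. \<phi> x \<partial>\<nu>))\<bar> \<le> 0" by (rule field_le_epsilon)
    then show ?thesis by simp
  qed
  show ?thesis
    using \<mu>(1,2) \<nu>(1,2) mass_\<mu> by (intro exI[of _ \<mu>] exI[of _ \<nu>] conjI allI impI main) assumption+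
qed

section \<open>Variations of a signed measure\<close>

lemma vector_measure_empty:
  assumes "vector_measure M \<mu>" shows "\<mu> {} = 0"
proof -
  have "(\<lambda>i::nat. \<mu> {}) sums \<mu> (\<Union>i::nat. {})"
    using assms unfolding vector_measure_def
    by (elim allE[where x = "\<lambda>_. {}"]) (auto simp: disjoint_family_on_def)
  from summable_LIMSEQ_zero[OF sums_summable[OF this]] show ?thesis by (simp add: LIMSEQ_const_iff)
qed

lemma vector_measure_Un:
  assumes "vector_measure M \<mu>" "A \<in> sets M" "B \<in> sets M" "A \<inter> B = {}"
  shows "\<mu> (A \<union> B) = \<mu> A + \<mu> B"
proof -
  have "range (binaryset A B) \<subseteq> sets M" "disjoint_family (binaryset A B)"
    using assms by (auto simp: binaryset_def disjoint_family_on_def split: if_splits)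
  then have "(\<lambda>i. \<mu> (binaryset A B i)) sums \<mu> (A \<union> B)"
    using assms(1) unfolding vector_measure_def by (metis UN_binaryset_eq)
  moreover have "(\<lambda>i. \<mu> (binaryset A B i)) sums (\<mu> A + \<mu> B)"
    by (rule binaryset_sums) (rule vector_measure_empty[OF assms(1)])
  ultimately show ?thesis by (rule sums_unique2)
qed

lemma vector_measure_Diff:
  assumes "vector_measure M \<mu>" "A \<in> sets M" "B \<in> sets M" "B \<subseteq> A"
  shows "\<mu> (A - B) = \<mu> A - \<mu> B"
proof -
  have "\<mu> ((A - B) \<union> B) = \<mu> (A - B) + \<mu> B"
    by (rule vector_measure_Un) (use assms in auto)
  moreover have "(A - B) \<union> B = A" using assms by auto
  ultimately show ?thesis by simp
qed

text \<open>
  Otherwise the whole space has subsets of arbitrarily large measure. Splitting such a bad set in two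
  pieces of measure at least one, one of the pieces is bad again; the discarded pieces form a
  disjoint sequence whose measures do not tend to zero, against countable additivity.
\<close>
lemma vector_measure_bounded:
  assumes vm: "vector_measure M \<mu>"
  shows "\<exists>K. \<forall>A\<in>sets M. norm (\<mu> A) \<le> K"
proof -
  define bad where "bad A \<longleftrightarrow> A \<in> sets M \<and> (\<forall>K. \<exists>B\<in>sets M. B \<subseteq> A \<and> norm (\<mu> B) > K)" for A
  have step: "\<exists>A'. bad A' \<and> A' \<subseteq> A \<and> 1 \<le> norm (\<mu> (A - A'))" if "bad A" for A
  proof -
    from that have A: "A \<in> sets M" by (simp add: bad_def)
    from that obtain B where B: "B \<in> sets M" "B \<subseteq> A" "norm (\<mu> B) > norm (\<mu> A) + 1"
      unfolding bad_def by blast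
    have D: "\<mu> (A - B) = \<mu> A - \<mu> B" using vm A B by (intro vector_measure_Diff)
    have "norm (\<mu> B) - norm (\<mu> A) \<le> norm (\<mu> (A - B))"
      unfolding D by (metis norm_minus_commute norm_triangle_ineq2)
    then have n: "1 \<le> norm (\<mu> (A - B))" using B by linarith
    have n': "1 \<le> norm (\<mu> B)" using B norm_ge_zero[of "\<mu> A"] by linarith
    show ?thesis
    proof (cases "bad B")
      case True
      then show ?thesis using B n by blast
    next
      case nB: False
      have "bad (A - B)"
      proof (rule ccontr)
        assume "\<not> bad (A - B)"
        then obtain K1 where K1: "\<And>C. C \<in> sets M \<Longrightarrow> C \<subseteq> A - B \<Longrightarrow> norm (\<mu> C) \<le> K1"
          using A B by (force simp: bad_def not_less)
        from nB obtain K2 where K2: "\<And>C. C \<in> sets M \<Longrightarrow> C \<subseteq> B \<Longrightarrow> norm (\<mu> C) \<le> K2"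
          using A B by (force simp: bad_def not_less)
        from that obtain C where C: "C \<in> sets M" "C \<subseteq> A" "norm (\<mu> C) > K1 + K2"
          unfolding bad_def by blast
        have "\<mu> C = \<mu> (C - B) + \<mu> (C \<inter> B)"
          using vector_measure_Un[OF vm, of "C - B" "C \<inter> B"] B C by (auto simp: Un_Diff_Int)
        then have "norm (\<mu> C) \<le> norm (\<mu> (C - B)) + norm (\<mu> (C \<inter> B))"
          by (simp add: norm_triangle_ineq)
        also have "\<dots> \<le> K1 + K2" by (intro add_mono K1 K2) (use B C in auto)
        finally show False using C by simp
      qed
      moreover have "A - (A - B) = B" using B by auto
      ultimately show ?thesis using B n' by (intro exI[of _ "A - B"]) auto
    qed
  qed
  have "\<not> bad (space M)"
  proof
    assume "bad (space M)"
    then have "\<exists>S. \<forall>n. bad (S n) \<and> (S (Suc n) \<subseteq> S n \<and> 1 \<le> norm (\<mu> (S n - S (Suc n))))"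
      by (intro dependent_nat_choice step) blast+
    then obtain S where S: "\<And>n. bad (S n)" "\<And>n. S (Suc n) \<subseteq> S n"
      "\<And>n. 1 \<le> norm (\<mu> (S n - S (Suc n)))" by auto
    have dec: "S n \<subseteq> S m" if "m \<le> n" for m n
      using S(2) that by (rule lift_Suc_antimono_le)
    have "disjoint_family (\<lambda>n. S n - S (Suc n))"
    proof (unfold disjoint_family_on_def, intro ballI impI)
      fix m n :: nat assume "m \<noteq> n"
      then have "S m \<subseteq> S (Suc n) \<or> S n \<subseteq> S (Suc m)"
        using dec[of "Suc n" m] dec[of "Suc m" n] by linarith
      then show "(S m - S (Suc m)) \<inter> (S n - S (Suc n)) = {}" by auto
    qed
    moreover have "range (\<lambda>n. S n - S (Suc n)) \<subseteq> sets M"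
      using S(1) by (auto simp: bad_def)
    ultimately have "(\<lambda>n. \<mu> (S n - S (Suc n))) sums \<mu> (\<Union>n. S n - S (Suc n))"
      using vm unfolding vector_measure_def by simp
    from tendsto_norm_zero[OF summable_LIMSEQ_zero[OF sums_summable[OF this]]]
    have "(1::real) \<le> 0" by (rule LIMSEQ_le_const) (use S(3) in auto)
    then show False by simp
  qed
  then obtain K where "\<forall>B\<in>sets M. B \<subseteq> space M \<longrightarrow> norm (\<mu> B) \<le> K"
    by (auto simp: bad_def not_less)
  then show ?thesis by (intro exI[of _ K]) (simp add: sets.sets_into_space)
qed

lemma vector_measure_bounded_linear:
  assumes "vector_measure M \<mu>" "bounded_linear f"
  shows "vector_measure M (\<lambda>A. f (\<mu> A))"
  unfolding vector_measure_def
proof (intro allI impI)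
  fix A :: "nat \<Rightarrow> 'a set"
  assume "range A \<subseteq> sets M" "disjoint_family A"
  then have "(\<lambda>i. \<mu> (A i)) sums \<mu> (\<Union>i. A i)"
    using assms(1) unfolding vector_measure_def by simp
  then show "(\<lambda>i. f (\<mu> (A i))) sums f (\<mu> (\<Union>i. A i))"
    by (rule bounded_linear.sums[OF assms(2)])
qed

text \<open>
  Sets of negative measure are cut to zero, which the empty set compensates; this is why
  superadditivity distinguishes the signs of the two competitors.
\<close>
lemma countably_additive_pos_variation:
  fixes \<nu> :: "'a set \<Rightarrow> real"
  assumes vm: "vector_measure M \<nu>"
  defines "P \<equiv> \<lambda>A. SUP B \<in> {B \<in> sets M. B \<subseteq> A}. ennreal (\<nu> B)"
  shows "countably_additive (sets M) P"
proof -
  have P_eq: "P A = (SUP B \<in> {B \<in> sets M. B \<subseteq> A}. ennreal (\<nu> B))" for A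
    by (simp add: P_def)
  have upper: "ennreal (\<nu> B) \<le> P A" if "B \<in> sets M" "B \<subseteq> A" for A B
    unfolding P_def using that by (intro SUP_upper) auto
  have super: "P A + P B \<le> P (A \<union> B)" if "A \<in> sets M" "B \<in> sets M" "A \<inter> B = {}" for A B
  proof -
    have "ennreal (\<nu> A') + ennreal (\<nu> B') \<le> P (A \<union> B)"
      if A': "A' \<in> sets M" "A' \<subseteq> A" and B': "B' \<in> sets M" "B' \<subseteq> B" for A' B'
    proof -
      consider "\<nu> A' < 0" | "\<nu> B' < 0" | "\<nu> A' \<ge> 0" "\<nu> B' \<ge> 0" by linarith
      then show ?thesis
      proof cases
        case 1
        then have "ennreal (\<nu> A') + ennreal (\<nu> B') = ennreal (\<nu> B')" by (simp add: ennreal_neg)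
        also have "\<dots> \<le> P (A \<union> B)" by (rule upper) (use B' in auto)
        finally show ?thesis .
      next
        case 2
        then have "ennreal (\<nu> A') + ennreal (\<nu> B') = ennreal (\<nu> A')" by (simp add: ennreal_neg)
        also have "\<dots> \<le> P (A \<union> B)" by (rule upper) (use A' in auto)
        finally show ?thesis .
      next
        case 3
        have "\<nu> (A' \<union> B') = \<nu> A' + \<nu> B'"
          by (rule vector_measure_Un[OF vm]) (use A' B' \<open>A \<inter> B = {}\<close> in auto)
        then have "ennreal (\<nu> A') + ennreal (\<nu> B') = ennreal (\<nu> (A' \<union> B'))"
          using 3 by simp
        also have "\<dots> \<le> P (A \<union> B)" by (rule upper) (use A' B' in auto)
        finally show ?thesis .
      qed
    qed
    note le = this
    have le': "ennreal (\<nu> A') + P B \<le> P (A \<union> B)" if A': "A' \<in> sets M" "A' \<subseteq> A" for A'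
    proof -
      have "ennreal (\<nu> A') + P B = (SUP B' \<in> {C \<in> sets M. C \<subseteq> B}. ennreal (\<nu> A') + ennreal (\<nu> B'))"
        unfolding P_eq[of B] by (subst ennreal_SUP_add_right) (auto intro: exI[of _ "{}"])
      also have "\<dots> \<le> P (A \<union> B)" by (rule SUP_least) (use le[OF A'] in blast)
      finally show ?thesis .
    qed
    have "P A + P B = (SUP A' \<in> {C \<in> sets M. C \<subseteq> A}. ennreal (\<nu> A') + P B)"
      unfolding P_eq[of A] by (subst ennreal_SUP_add_left) (auto intro: exI[of _ "{}"])
    also have "\<dots> \<le> P (A \<union> B)" by (rule SUP_least) (use le' in blast)
    finally show ?thesis .
  qed
  have mono: "P A \<le> P B" if "A \<subseteq> B" for A B
    unfolding P_def using that by (intro SUP_subset_mono) auto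
  show ?thesis
  proof (rule countably_additiveI)
    fix A :: "nat \<Rightarrow> 'a set"
    assume A: "range A \<subseteq> sets M" "disjoint_family A" "(\<Union>i. A i) \<in> sets M"
    show "(\<Sum>i. P (A i)) = P (\<Union>i. A i)"
    proof (rule antisym)
      have "(\<Sum>i<n. P (A i)) \<le> P (\<Union>i<n. A i)" for n
      proof (induction n)
        case (Suc n)
        have "(\<Sum>i<Suc n. P (A i)) \<le> P (\<Union>i<n. A i) + P (A n)"
          using Suc by (simp add: add_right_mono)
        also have "\<dots> \<le> P ((\<Union>i<n. A i) \<union> A n)"
        proof (rule super)
          show "(\<Union>i<n. A i) \<inter> A n = {}"
          proof -
            have "A i \<inter> A n = {}" if "i < n" for i
              using disjoint_family_onD[OF A(2), of i n] that by simp
            then show ?thesis by blast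
          qed
        qed (use A(1) in auto)
        also have "(\<Union>i<n. A i) \<union> A n = (\<Union>i<Suc n. A i)" by (auto simp: less_Suc_eq)
        finally show ?case .
      qed simp
      then have "(\<Sum>i<n. P (A i)) \<le> P (\<Union>i. A i)" for n
        by (rule order.trans) (rule mono, auto)
      then show "(\<Sum>i. P (A i)) \<le> P (\<Union>i. A i)"
        by (rule suminf_le_const[OF summableI])
    next
      show "P (\<Union>i. A i) \<le> (\<Sum>i. P (A i))"
        unfolding P_eq[of "\<Union>i. A i"]
      proof (rule SUP_least)
        fix B assume "B \<in> {B \<in> sets M. B \<subseteq> (\<Union>i. A i)}"
        then have B: "B \<in> sets M" "(\<Union>i. B \<inter> A i) = B" by auto
        have "range (\<lambda>i. B \<inter> A i) \<subseteq> sets M" "disjoint_family (\<lambda>i. B \<inter> A i)"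
          using A B(1) by (auto simp: disjoint_family_on_def)
        then have "(\<lambda>i. \<nu> (B \<inter> A i)) sums \<nu> (\<Union>i. B \<inter> A i)"
          by (rule vm[unfolded vector_measure_def, rule_format])
        then have "(\<lambda>i. \<nu> (B \<inter> A i)) sums \<nu> B" by (simp only: B(2))
        then have lim: "(\<lambda>n. ennreal (\<Sum>i<n. \<nu> (B \<inter> A i))) \<longlonglongrightarrow> ennreal (\<nu> B)"
          unfolding sums_def by (rule tendsto_ennrealI)
        have "ennreal (\<Sum>i<n. \<nu> (B \<inter> A i)) \<le> (\<Sum>i. P (A i))" for n
        proof -
          have "ennreal (\<Sum>i<n. \<nu> (B \<inter> A i)) \<le> ennreal (\<Sum>i<n. max 0 (\<nu> (B \<inter> A i)))"
            by (intro ennreal_leI sum_mono) auto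
          also have "\<dots> = (\<Sum>i<n. ennreal (max 0 (\<nu> (B \<inter> A i))))"
            by (rule sum_ennreal[symmetric]) simp
          also have "\<dots> = (\<Sum>i<n. ennreal (\<nu> (B \<inter> A i)))"
            by (intro sum.cong refl) (simp add: max_def ennreal_neg)
          also have "\<dots> \<le> (\<Sum>i<n. P (A i))"
            by (intro sum_mono upper) (use A B(1) in auto)
          also have "\<dots> \<le> (\<Sum>i. P (A i))" by (rule sum_le_suminf) auto
          finally show ?thesis .
        qed
        then show "ennreal (\<nu> B) \<le> (\<Sum>i. P (A i))"
          by (intro LIMSEQ_le_const2[OF lim]) auto
      qed
    qed
  qed
qed

lemma sets_pos_variation [simp]: "sets (pos_variation M \<nu>) = sets M"
  unfolding pos_variation_def by (simp add: sets.space_closed)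

lemma space_pos_variation [simp]: "space (pos_variation M \<nu>) = space M"
  by (rule sets_eq_imp_space_eq) simp

lemma emeasure_pos_variation:
  assumes "vector_measure M \<nu>" "A \<in> sets M"
  shows "emeasure (pos_variation M \<nu>) A = (SUP B \<in> {B \<in> sets M. B \<subseteq> A}. ennreal (\<nu> B))"
  unfolding pos_variation_def
proof (rule emeasure_measure_of_sigma)
  have "{B \<in> sets M. B \<subseteq> {}} = {{}}" by auto
  then show "positive (sets M) (\<lambda>A. SUP B \<in> {B \<in> sets M. B \<subseteq> A}. ennreal (\<nu> B))"
    using vector_measure_empty[OF assms(1)] by (simp add: positive_def)
  show "sigma_algebra (space M) (sets M)" by (rule sets.sigma_algebra_axioms)
  show "A \<in> sets M" by fact
  show "countably_additive (sets M) (\<lambda>A. SUP B \<in> {B \<in> sets M. B \<subseteq> A}. ennreal (\<nu> B))"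
    by (rule countably_additive_pos_variation[OF assms(1)])
qed

lemma pos_variation_finite:
  assumes vm: "vector_measure M \<nu>"
  shows "finite_measure (pos_variation M \<nu>)"
proof
  obtain K where "\<forall>A\<in>sets M. norm (\<nu> A) \<le> K"
    using vector_measure_bounded[OF vm] ..
  then have K: "\<nu> B \<le> K" if "B \<in> sets M" for B
    using that by (auto dest!: bspec[of _ _ B])
  have "emeasure (pos_variation M \<nu>) (space M) \<le> ennreal K"
    unfolding emeasure_pos_variation[OF vm sets.top]
    by (rule SUP_least) (simp add: ennreal_leI K)
  then have "emeasure (pos_variation M \<nu>) (space M) < \<infinity>"
    unfolding infinity_ennreal_def by (rule le_less_trans) (rule ennreal_less_top)
  then show "emeasure (pos_variation M \<nu>) (space (pos_variation M \<nu>)) \<noteq> \<infinity>"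
    unfolding space_pos_variation by (rule less_imp_neq)
qed

lemma le_measure_pos_variation:
  assumes vm: "vector_measure M \<nu>" and "A \<in> sets M" "B \<in> sets M" "B \<subseteq> A"
  shows "\<nu> B \<le> measure (pos_variation M \<nu>) A"
proof -
  interpret finite_measure "pos_variation M \<nu>" by (rule pos_variation_finite[OF vm])
  have "ennreal (\<nu> B) \<le> emeasure (pos_variation M \<nu>) A"
    unfolding emeasure_pos_variation[OF assms(1,2)] by (rule SUP_upper) (simp add: assms(3,4))
  then show ?thesis
    unfolding emeasure_eq_measure by (rule ennreal_le_iff[THEN iffD1, OF measure_nonneg])
qed

lemma measure_pos_variation_le:
  assumes vm: "vector_measure M \<nu>" and "A \<in> sets M" "0 \<le> c"
    and "\<And>B. B \<in> sets M \<Longrightarrow> B \<subseteq> A \<Longrightarrow> \<nu> B \<le> c"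
  shows "measure (pos_variation M \<nu>) A \<le> c"
proof -
  interpret finite_measure "pos_variation M \<nu>" by (rule pos_variation_finite[OF vm])
  have "emeasure (pos_variation M \<nu>) A \<le> ennreal c"
    unfolding emeasure_pos_variation[OF assms(1,2)]
    by (rule SUP_least) (simp add: ennreal_leI assms(4))
  then show ?thesis
    unfolding emeasure_eq_measure by (rule ennreal_le_iff[THEN iffD1, OF assms(3)])
qed

text \<open>
  Passing from a subset B of A to A - B turns competitors for the positive variation
  into competitors for the negative one, shifted by \<nu>(A).
\<close>
lemma jordan_decomposition:
  fixes \<nu> :: "'a set \<Rightarrow> real"
  assumes vm: "vector_measure M \<nu>" and A: "A \<in> sets M"
  shows "\<nu> A = measure (pos_variation M \<nu>) A - measure (pos_variation M (\<lambda>A. - \<nu> A)) A"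
proof -
  have le: "measure (pos_variation M \<mu>) A \<le> \<mu> A + measure (pos_variation M (\<lambda>A. - \<mu> A)) A"
    if \<mu>: "vector_measure M \<mu>" for \<mu> :: "'a set \<Rightarrow> real"
  proof -
    have \<mu>': "vector_measure M (\<lambda>A. - \<mu> A)"
      by (rule vector_measure_bounded_linear[OF \<mu> bounded_linear_minus[OF bounded_linear_ident]])
    have *: "\<mu> B \<le> \<mu> A + measure (pos_variation M (\<lambda>A. - \<mu> A)) A" if B: "B \<in> sets M" "B \<subseteq> A" for B
      using le_measure_pos_variation[OF \<mu>' A, of "A - B"] vector_measure_Diff[OF \<mu> A B(1) B(2)] A B
      by auto
    show ?thesis
      by (rule measure_pos_variation_le[OF \<mu> A _ *])
        (use *[of "{}"] vector_measure_empty[OF \<mu>] in auto)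
  qed
  have "vector_measure M (\<lambda>A. - \<nu> A)"
    by (rule vector_measure_bounded_linear[OF vm bounded_linear_minus[OF bounded_linear_ident]])
  from le[OF vm] le[OF this] show ?thesis by simp
qed

section \<open>Smooth bumps\<close>

text \<open>
  The family t^(-m) e^(-1/t), extended by zero to t \<le> 0, is closed under differentiation
  up to linear combinations, so smoothness of e^(-1/t) follows by induction for all \<open>m\<close>
  simultaneously.
\<close>
definition flat_exp :: "nat \<Rightarrow> real \<Rightarrow> real" where
  "flat_exp m t = (if t > 0 then (1 / t) ^ m * exp (- (1 / t)) else 0)"

lemma flat_exp_tendsto_0: "(flat_exp m \<longlongrightarrow> 0) (at 0)"
proof -
  have "((\<lambda>t::real. (inverse t) ^ m / exp (inverse t)) \<longlongrightarrow> 0) (at_right 0)"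
    using filterlim_compose[OF tendsto_power_div_exp_0 filterlim_inverse_at_top_right] .
  moreover have "eventually (\<lambda>t::real. (inverse t) ^ m / exp (inverse t) = flat_exp m t) (at_right 0)"
    unfolding eventually_at_filter
    by (auto simp: flat_exp_def exp_minus field_simps)
  ultimately have r: "(flat_exp m \<longlongrightarrow> 0) (at_right 0)"
    using Lim_transform_eventually by blast
  have "eventually (\<lambda>t::real. 0 = flat_exp m t) (at_left 0)"
    unfolding eventually_at_filter by (auto simp: flat_exp_def)
  then have l: "(flat_exp m \<longlongrightarrow> 0) (at_left 0)"
    using Lim_transform_eventually[OF tendsto_const] by blast
  show ?thesis using l r by (rule filterlim_split_at)
qed

lemma flat_exp_has_derivative:
  "(flat_exp m has_real_derivative flat_exp (m + 2) t - m * flat_exp (m + 1) t) (at t)"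
proof -
  consider "t < 0" | "t = 0" | "t > 0" by linarith
  then show ?thesis
  proof cases
    case 1
    have "((\<lambda>t. 0) has_real_derivative 0) (at t)" by simp
    then have "(flat_exp m has_real_derivative 0) (at t)"
      by (rule has_field_derivative_transform_within_open[where S = "{..<0}"])
        (use 1 in \<open>auto simp: flat_exp_def\<close>)
    then show ?thesis using 1 by (simp add: flat_exp_def)
  next
    case 2
    have "eventually (\<lambda>h. flat_exp (m + 1) h = (flat_exp m (0 + h) - flat_exp m 0) / h) (at 0)"
      unfolding eventually_at_filter by (auto simp: flat_exp_def field_simps)
    then have "((\<lambda>h. (flat_exp m (0 + h) - flat_exp m 0) / h) \<longlongrightarrow> 0) (at 0)"
      by (rule Lim_transform_eventually[OF flat_exp_tendsto_0[of "m + 1"]])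
    then have "(flat_exp m has_real_derivative 0) (at 0)" unfolding DERIV_def .
    moreover have "flat_exp j 0 = 0" for j by (simp add: flat_exp_def)
    ultimately show ?thesis using 2 by simp
  next
    case 3
    have "((\<lambda>t. (1 / t) ^ m * exp (- (1 / t))) has_real_derivative
             flat_exp (m + 2) t - m * flat_exp (m + 1) t) (at t)"
    proof -
      have y: "((\<lambda>t. 1 / t) has_real_derivative - ((1 / t) ^ 2)) (at t)"
        using 3 by (auto intro!: derivative_eq_intros simp: power2_eq_square)
      have "((\<lambda>t. exp (- (1 / t))) has_real_derivative exp (- (1 / t)) * (- (- ((1 / t) ^ 2)))) (at t)"
        by (intro DERIV_fun_exp DERIV_minus y)
      note D = DERIV_mult[OF DERIV_power[OF y, of m] this]
      have alg: "real m * (z ^ (m - Suc 0) * - (z ^ 2)) * e + (e * (- (- (z ^ 2)))) * z ^ m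
          = z ^ (m + 2) * e - real m * (z ^ (m + 1) * e)" for z e :: real
        by (cases m) (simp_all add: algebra_simps power2_eq_square)
      have pos: "flat_exp j t = (1 / t) ^ j * exp (- (1 / t))" for j
        using 3 by (simp add: flat_exp_def)
      show ?thesis
        using D unfolding pos alg[symmetric] by (simp add: mult_ac)
    qed
    then show ?thesis
      by (rule has_field_derivative_transform_within_open[where S = "{0<..}"])
        (use 3 in \<open>auto simp: flat_exp_def\<close>)
  qed
qed

lemma continuously_differentiable_SucI:
  assumes "\<And>x. (f has_derivative f' x) (at x)"
    and "\<And>b. b \<in> Basis \<Longrightarrow> continuously_differentiable k (\<lambda>x. f' x b)"
  shows "continuously_differentiable (Suc k) f"
proof -
  have "frechet_derivative f (at x) = f' x" for x
    using frechet_derivative_at[OF assms(1)] by metis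
  then show ?thesis using assms by (auto simp: differentiable_def)
qed

lemma continuously_differentiable_SucD:
  "continuously_differentiable (Suc k) f \<Longrightarrow> continuously_differentiable k f"
proof (induction k arbitrary: f)
  case 0
  then show ?case
    by (auto simp: differentiable_imp_continuous_within intro!: continuous_at_imp_continuous_on)
next
  case (Suc k)
  from Suc.prems have "\<And>x. f differentiable (at x)"
    and "\<And>b. b \<in> Basis \<Longrightarrow> continuously_differentiable (Suc k) (\<lambda>x. frechet_derivative f (at x) b)"
    by auto
  with Suc.IH show ?case by simp
qed

lemma continuously_differentiable_has_derivative:
  "continuously_differentiable (Suc k) f \<Longrightarrow>
     (f has_derivative frechet_derivative f (at x)) (at x)"
  by (simp add: frechet_derivative_works[symmetric])

lemma continuously_differentiable_const: "continuously_differentiable k (\<lambda>x. c)"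
proof (induction k arbitrary: c)
  case (Suc k)
  show ?case
    by (rule continuously_differentiable_SucI[where f' = "\<lambda>x v. 0"]) (auto intro: Suc)
qed simp

lemma continuously_differentiable_add:
  "continuously_differentiable k f \<Longrightarrow> continuously_differentiable k g \<Longrightarrow>
     continuously_differentiable k (\<lambda>x. f x + g x)"
proof (induction k arbitrary: f g)
  case 0
  then show ?case by (simp add: continuous_on_add)
next
  case (Suc k)
  show ?case
  proof (rule continuously_differentiable_SucI)
    fix x show "((\<lambda>x. f x + g x) has_derivative
        (\<lambda>v. frechet_derivative f (at x) v + frechet_derivative g (at x) v)) (at x)"
      using Suc.prems
      by (intro has_derivative_add continuously_differentiable_has_derivative)
  qed (use Suc in auto)
qed

lemma continuously_differentiable_mult:
  "continuously_differentiable k f \<Longrightarrow> continuously_differentiable k g \<Longrightarrow>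
     continuously_differentiable k (\<lambda>x. f x * g x)"
proof (induction k arbitrary: f g)
  case 0
  then show ?case by (simp add: continuous_on_mult)
next
  case (Suc k)
  show ?case
  proof (rule continuously_differentiable_SucI)
    fix x show "((\<lambda>x. f x * g x) has_derivative
        (\<lambda>v. f x * frechet_derivative g (at x) v + frechet_derivative f (at x) v * g x)) (at x)"
      using Suc.prems
      by (intro has_derivative_mult continuously_differentiable_has_derivative)
  next
    fix b :: 'a assume "b \<in> Basis"
    then show "continuously_differentiable k
       (\<lambda>x. f x * frechet_derivative g (at x) b + frechet_derivative f (at x) b * g x)"
      using Suc.prems
      by (intro continuously_differentiable_add Suc.IH)
        (auto intro: continuously_differentiable_SucD simp del: continuously_differentiable.simps
           simp: continuously_differentiable.simps(2))
  qed
qed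

lemma continuously_differentiable_prod:
  assumes "finite I" "\<And>i. i \<in> I \<Longrightarrow> continuously_differentiable k (f i)"
  shows "continuously_differentiable k (\<lambda>x. \<Prod>i\<in>I. f i x)"
  using assms
proof (induction I)
  case empty
  then show ?case by (simp add: continuously_differentiable_const)
next
  case (insert i I)
  then show ?case by (simp add: continuously_differentiable_mult)
qed

lemma continuously_differentiable_flat_exp:
  "continuously_differentiable k (\<lambda>x. flat_exp m (x \<bullet> a + c))"
proof (induction k arbitrary: m)
  case 0
  have "continuous_on UNIV (flat_exp m)"
    by (intro continuous_at_imp_continuous_on) (auto intro: DERIV_isCont flat_exp_has_derivative)
  then have "continuous_on UNIV (flat_exp m \<circ> (\<lambda>x. x \<bullet> a + c))"
    by (intro continuous_on_compose continuous_intros) (auto elim: continuous_on_subset)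
  then show ?case by (simp add: o_def)
next
  case (Suc k)
  let ?f' = "\<lambda>x v. (v \<bullet> a) * (flat_exp (m + 2) (x \<bullet> a + c) + (- real m) * flat_exp (m + 1) (x \<bullet> a + c))"
  show ?case
  proof (rule continuously_differentiable_SucI[where f' = ?f'])
    fix x :: 'a
    have "((\<lambda>x. x \<bullet> a + c) has_derivative (\<lambda>v. v \<bullet> a)) (at x)"
      by (auto intro!: derivative_eq_intros)
    from has_derivative_compose[OF this
        flat_exp_has_derivative[of m "x \<bullet> a + c", unfolded has_field_derivative_def]]
    show "((\<lambda>x. flat_exp m (x \<bullet> a + c)) has_derivative ?f' x) (at x)"
      by (rule has_derivative_eq_rhs) (simp add: fun_eq_iff algebra_simps)
  next
    fix b :: 'a
    show "continuously_differentiable k (\<lambda>x. ?f' x b)"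
      by (rule continuously_differentiable_mult continuously_differentiable_const
          continuously_differentiable_add Suc.IH)+
  qed
qed

text \<open>
  A smooth function which is positive exactly on the open box; it increases to the indicator of
  the box as \<open>n\<close> grows.
\<close>
definition box_bump :: "'a::euclidean_space \<Rightarrow> 'a \<Rightarrow> real \<Rightarrow> 'a \<Rightarrow> real" where
  "box_bump a c n x =
     (\<Prod>b\<in>Basis. flat_exp 0 (n * (x \<bullet> b - a \<bullet> b)) * flat_exp 0 (n * (c \<bullet> b - x \<bullet> b)))"

lemma box_bump_outside:
  assumes "n > 0" "x \<notin> box a c"
  shows "box_bump a c n x = 0"
proof -
  from assms(2) obtain b where b: "b \<in> Basis" "\<not> (a \<bullet> b < x \<bullet> b \<and> x \<bullet> b < c \<bullet> b)"
    by (auto simp: mem_box)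
  then have "flat_exp 0 (n * (x \<bullet> b - a \<bullet> b)) * flat_exp 0 (n * (c \<bullet> b - x \<bullet> b)) = 0"
    using assms(1) by (auto simp: flat_exp_def zero_less_mult_iff)
  with b(1) show ?thesis unfolding box_bump_def by (intro prod_zero) auto
qed

lemma box_bump_bounds: "0 \<le> box_bump a c n x" "box_bump a c n x \<le> 1"
proof -
  have "0 \<le> flat_exp 0 t" "flat_exp 0 t \<le> 1" for t by (auto simp: flat_exp_def)
  then show "0 \<le> box_bump a c n x" "box_bump a c n x \<le> 1"
    unfolding box_bump_def by (auto intro!: prod_nonneg prod_le_1 mult_le_one)
qed

lemma test_function_box_bump:
  assumes "n > 0"
  shows "test_function (box_bump a c n)"
proof -
  have "continuously_differentiable k (box_bump a c n)" for k
  proof -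
    have eq: "box_bump a c n = (\<lambda>x. \<Prod>b\<in>Basis. flat_exp 0 (x \<bullet> (n *\<^sub>R b) + (- n * (a \<bullet> b)))
           * flat_exp 0 (x \<bullet> (- n *\<^sub>R b) + n * (c \<bullet> b)))"
      unfolding box_bump_def
      by (intro ext prod.cong arg_cong2[where f = "(*)"] arg_cong[where f = "flat_exp 0"])
        (simp_all add: algebra_simps)
    show ?thesis unfolding eq
      by (rule continuously_differentiable_prod[OF finite_Basis])
        (rule continuously_differentiable_mult; rule continuously_differentiable_flat_exp)
  qed
  moreover have "closure {x. box_bump a c n x \<noteq> 0} \<subseteq> cbox a c"
  proof (intro closure_minimal subsetI)
    fix x assume "x \<in> {x. box_bump a c n x \<noteq> 0}"
    then show "x \<in> cbox a c"
      using box_bump_outside[OF assms, of x] box_subset_cbox[of a c] by auto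
  qed (rule closed_cbox)
  then have "compact (closure {x. box_bump a c n x \<noteq> 0})"
    by (meson bounded_cbox bounded_subset compact_closure bounded_closure closure_subset)
  ultimately show ?thesis by (simp add: test_function_def)
qed

lemma box_bump_tendsto:
  "(\<lambda>n. box_bump a c (real (Suc n)) x) \<longlonglongrightarrow> indicator (box a c) x"
proof (cases "x \<in> box a c")
  case False
  then show ?thesis by (simp add: box_bump_outside)
next
  case True
  have lim: "(\<lambda>n. flat_exp 0 (real (Suc n) * t)) \<longlonglongrightarrow> 1" if "t > 0" for t
  proof -
    have "(\<lambda>n. exp (- (inverse (real (Suc n)) * (1 / t)))) \<longlonglongrightarrow> exp (- (0 * (1 / t)))"
      by (intro tendsto_intros LIMSEQ_inverse_real_of_nat)
    then show ?thesis using that by (simp add: flat_exp_def field_simps del: of_nat_Suc)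
  qed
  have "(\<lambda>n. box_bump a c (real (Suc n)) x) \<longlonglongrightarrow> (\<Prod>b\<in>(Basis::'a set). 1 * 1)"
    unfolding box_bump_def
    using True by (intro tendsto_prod tendsto_mult lim) (auto simp: mem_box)
  then show ?thesis using True by simp
qed

lemma test_function_continuous: "test_function \<phi> \<Longrightarrow> continuous_on UNIV \<phi>"
  unfolding test_function_def using continuously_differentiable.simps(1) by blast

lemma integral_box_bump_tendsto:
  fixes \<gamma> :: "'a::euclidean_space measure"
  assumes "finite_measure \<gamma>" and s: "sets \<gamma> = sets borel"
  shows "(\<lambda>n. \<integral>x. box_bump l u (real (Suc n)) x \<partial>\<gamma>) \<longlonglongrightarrow> measure \<gamma> (box l u)"
proof -
  interpret finite_measure \<gamma> by fact
  note [measurable_cong] = s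
  have [measurable]: "box_bump l u (real (Suc n)) \<in> borel_measurable borel" for n
    by (intro borel_measurable_continuous_onI test_function_continuous test_function_box_bump) simp
  have "(\<lambda>n. \<integral>x. box_bump l u (real (Suc n)) x \<partial>\<gamma>) \<longlonglongrightarrow> (\<integral>x. indicator (box l u) x \<partial>\<gamma>)"
    by (rule integral_dominated_convergence[where w = "\<lambda>_. 1"])
      (simp_all add: box_bump_bounds box_bump_tendsto del: of_nat_Suc)
  then show ?thesis using s sets_eq_imp_space_eq[OF s] by simp
qed

lemma measure_centered_boxes_tendsto:
  fixes \<gamma> :: "'a::euclidean_space measure"
  assumes "finite_measure \<gamma>" and s: "sets \<gamma> = sets borel"
  shows "(\<lambda>n. measure \<gamma> (box (- (real n *\<^sub>R One)) (real n *\<^sub>R One))) \<longlonglongrightarrow> measure \<gamma> UNIV"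
proof -
  interpret finite_measure \<gamma> by fact
  let ?A = "\<lambda>n::nat. box (- (real n *\<^sub>R One)) (real n *\<^sub>R One) :: 'a set"
  have "incseq ?A"
  proof (intro incseq_SucI subsetI)
    fix n x assume x: "x \<in> ?A n"
    show "x \<in> ?A (Suc n)"
      unfolding mem_box
    proof
      fix b :: 'a assume b: "b \<in> Basis"
      with x have "- real n < x \<bullet> b \<and> x \<bullet> b < real n" by (simp add: mem_box)
      then show "- (real (Suc n) *\<^sub>R One) \<bullet> b < x \<bullet> b \<and> x \<bullet> b < (real (Suc n) *\<^sub>R One) \<bullet> b"
        using b by simp
    qed
  qed
  then have "(\<lambda>n. measure \<gamma> (?A n)) \<longlonglongrightarrow> measure \<gamma> (\<Union>n. ?A n)"
    by (intro finite_Lim_measure_incseq) (auto simp: s)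
  then show ?thesis unfolding UN_box_eq_UNIV .
qed

text \<open>
  Equality of signed measures \<alpha>1 - \<beta>1 = \<beta>2 - \<alpha>2, written additively. The
  equality holds on boxes by approximation with bumps, and the boxes generate the Borel sets.
\<close>
lemma test_integrals_determine_measure_sums:
  fixes \<alpha>1 \<alpha>2 \<beta>1 \<beta>2 :: "'a::euclidean_space measure"
  assumes fin: "finite_measure \<alpha>1" "finite_measure \<alpha>2" "finite_measure \<beta>1" "finite_measure \<beta>2"
    and s: "sets \<alpha>1 = sets borel" "sets \<alpha>2 = sets borel" "sets \<beta>1 = sets borel" "sets \<beta>2 = sets borel"
    and eq: "\<And>\<phi>. test_function \<phi> \<Longrightarrow>
      (\<integral>x. \<phi> x \<partial>\<alpha>1) + (\<integral>x. \<phi> x \<partial>\<alpha>2) = (\<integral>x. \<phi> x \<partial>\<beta>1) + (\<integral>x. \<phi> x \<partial>\<beta>2)"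
    and A: "A \<in> sets borel"
  shows "measure \<alpha>1 A + measure \<alpha>2 A = measure \<beta>1 A + measure \<beta>2 A"
proof -
  have box: "measure \<alpha>1 (box l u) + measure \<alpha>2 (box l u) = measure \<beta>1 (box l u) + measure \<beta>2 (box l u)" for l u
  proof -
    let ?b = "\<lambda>n. box_bump l u (real (Suc n))"
    have "(\<lambda>n. (\<integral>x. ?b n x \<partial>\<alpha>1) + (\<integral>x. ?b n x \<partial>\<alpha>2)) = (\<lambda>n. (\<integral>x. ?b n x \<partial>\<beta>1) + (\<integral>x. ?b n x \<partial>\<beta>2))"
      by (intro ext eq test_function_box_bump) simp
    note E = this
    note L1 = tendsto_add[OF integral_box_bump_tendsto[OF fin(1) s(1), of l u]
        integral_box_bump_tendsto[OF fin(2) s(2), of l u]]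
    note L2 = tendsto_add[OF integral_box_bump_tendsto[OF fin(3) s(3), of l u]
        integral_box_bump_tendsto[OF fin(4) s(4), of l u]]
    show ?thesis by (rule LIMSEQ_unique[OF L1[unfolded E] L2])
  qed
  have univ: "measure \<alpha>1 UNIV + measure \<alpha>2 UNIV = measure \<beta>1 UNIV + measure \<beta>2 UNIV"
    using tendsto_add[OF measure_centered_boxes_tendsto[OF fin(1) s(1)] measure_centered_boxes_tendsto[OF fin(2) s(2)]]
      tendsto_add[OF measure_centered_boxes_tendsto[OF fin(3) s(3)] measure_centered_boxes_tendsto[OF fin(4) s(4)]]
    unfolding box by (rule LIMSEQ_unique)
  let ?E = "range (\<lambda>(a, b). box a b :: 'a set)"
  have gen: "sets borel = sigma_sets UNIV ?E" by (simp add: borel_eq_box)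
  have "Int_stable ?E" "?E \<subseteq> Pow UNIV" by (auto simp: Int_stable_def box_Int_box)
  from this A[unfolded gen] show ?thesis
  proof (induction rule: sigma_sets_induct_disjoint)
    case (basic A)
    then show ?case using box by auto
  next
    case (compl A)
    have c: "measure \<gamma> (UNIV - A) = measure \<gamma> UNIV - measure \<gamma> A"
      if "finite_measure \<gamma>" "sets \<gamma> = sets borel" for \<gamma>
      using finite_measure.finite_measure_compl[OF that(1), of A] compl(1)
        sets_eq_imp_space_eq[OF that(2)] by (simp add: that(2) gen[symmetric])
    show ?case
      using compl(2) univ by (simp add: c[OF fin(1) s(1)] c[OF fin(2) s(2)] c[OF fin(3) s(3)] c[OF fin(4) s(4)])
  next
    case (union A)
    then have u: "range A \<subseteq> sets borel" by (simp add: gen)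
    have sums: "(\<lambda>i. measure \<gamma> (A i)) sums measure \<gamma> (\<Union>i. A i)"
      if "finite_measure \<gamma>" "sets \<gamma> = sets borel" for \<gamma>
      using finite_measure.finite_measure_UNION[OF that(1)] u union(1) that(2) by simp
    show ?case
      using sums_add[OF sums[OF fin(1) s(1)] sums[OF fin(2) s(2)]]
        sums_add[OF sums[OF fin(3) s(3)] sums[OF fin(4) s(4)]]
      unfolding union(3) by (rule sums_unique2)
  qed simp
qed

section \<open>Comparing signed measures by their integrals\<close>

text \<open>
  The discrete layer-cake sums are linear in the measure, hence equal on both sides, and they
  approximate the integrals up to the step size.
\<close>
lemma integrals_eq_if_measure_sums_eq:
  fixes \<alpha>1 \<alpha>2 \<beta>1 \<beta>2 :: "'a::euclidean_space measure" and \<phi> :: "'a \<Rightarrow> real"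
  assumes fin: "finite_measure \<alpha>1" "finite_measure \<alpha>2" "finite_measure \<beta>1" "finite_measure \<beta>2"
    and s: "sets \<alpha>1 = sets borel" "sets \<alpha>2 = sets borel" "sets \<beta>1 = sets borel" "sets \<beta>2 = sets borel"
    and eq: "\<And>A. A \<in> sets borel \<Longrightarrow> measure \<alpha>1 A + measure \<alpha>2 A = measure \<beta>1 A + measure \<beta>2 A"
    and meas: "\<phi> \<in> borel_measurable borel" and B: "\<And>x. \<bar>\<phi> x\<bar> \<le> B"
  shows "(\<integral>x. \<phi> x \<partial>\<alpha>1) + (\<integral>x. \<phi> x \<partial>\<alpha>2) = (\<integral>x. \<phi> x \<partial>\<beta>1) + (\<integral>x. \<phi> x \<partial>\<beta>2)"
proof -
  note [measurable] = meas
  \<comment> \<open>The layer-cake bounds are for nonnegative functions, so \<phi> is shifted by its bound.\<close>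
  let ?\<psi> = "\<lambda>x. \<phi> x + B"
  have \<psi>: "0 \<le> ?\<psi> x" "?\<psi> x \<le> 2 * B" for x using B[of x] by auto
  have shift: "(\<integral>x. ?\<psi> x \<partial>\<gamma>) = (\<integral>x. \<phi> x \<partial>\<gamma>) + B * measure \<gamma> UNIV"
    if "finite_measure \<gamma>" and s: "sets \<gamma> = sets borel" for \<gamma>
  proof -
    interpret finite_measure \<gamma> by fact
    note [measurable_cong] = s
    have "integrable \<gamma> \<phi>" by (rule integrable_const_bound[where B = B]) (use B in simp_all)
    then show ?thesis using sets_eq_imp_space_eq[OF s] by simp
  qed
  let ?m = "measure \<alpha>1 UNIV + measure \<alpha>2 UNIV + measure \<beta>1 UNIV + measure \<beta>2 UNIV"
  let ?d = "\<bar>((\<integral>x. ?\<psi> x \<partial>\<alpha>1) + (\<integral>x. ?\<psi> x \<partial>\<alpha>2)) - ((\<integral>x. ?\<psi> x \<partial>\<beta>1) + (\<integral>x. ?\<psi> x \<partial>\<beta>2))\<bar>"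
  have step: "?d \<le> h * ?m" if h: "0 < h" for h
  proof -
    obtain J :: nat where J: "2 * B / h \<le> real J" using real_arch_simple by blast
    then have "2 * B \<le> real J * h" using h by (simp add: divide_le_eq)
    then have bnd: "?\<psi> x \<le> real (Suc J) * h" for x
      using \<psi>(2)[of x] h by (simp add: algebra_simps)
    define S where "S \<gamma> = (\<Sum>i=1..J. h * measure \<gamma> {x. real i * h \<le> ?\<psi> x})" for \<gamma>
    have close: "S \<gamma> \<le> (\<integral>x. ?\<psi> x \<partial>\<gamma>) \<and> (\<integral>x. ?\<psi> x \<partial>\<gamma>) \<le> h * measure \<gamma> UNIV + S \<gamma>"
      if fg: "finite_measure \<gamma>" and sg: "sets \<gamma> = sets borel" for \<gamma>
    proof -
      interpret finite_measure \<gamma> by fact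
      note [measurable_cong] = sg
      have "?\<psi> \<in> borel_measurable borel" by measurable
      note lc = layer_cake_bounds[OF fg sg this \<psi>(1) bnd h]
      have "(\<Sum>i=1..J. h * measure \<gamma> {x. real i * h < ?\<psi> x}) \<le> S \<gamma>"
        unfolding S_def using h
        by (intro sum_mono mult_left_mono finite_measure_mono) (auto simp: sg)
      then show ?thesis using lc unfolding S_def by linarith
    qed
    have "S \<alpha>1 + S \<alpha>2 = S \<beta>1 + S \<beta>2"
      unfolding S_def sum.distrib[symmetric] distrib_left[symmetric]
      by (intro sum.cong refl arg_cong[where f = "(*) h"] eq) measurable
    moreover have "h * ?m = h * measure \<alpha>1 UNIV + h * measure \<alpha>2 UNIV + h * measure \<beta>1 UNIV + h * measure \<beta>2 UNIV"
      by (simp add: algebra_simps)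
    ultimately show ?thesis
      using close[OF fin(1) s(1)] close[OF fin(2) s(2)] close[OF fin(3) s(3)] close[OF fin(4) s(4)]
        mult_nonneg_nonneg[OF less_imp_le[OF h] measure_nonneg, of \<alpha>1 UNIV]
        mult_nonneg_nonneg[OF less_imp_le[OF h] measure_nonneg, of \<alpha>2 UNIV]
        mult_nonneg_nonneg[OF less_imp_le[OF h] measure_nonneg, of \<beta>1 UNIV]
        mult_nonneg_nonneg[OF less_imp_le[OF h] measure_nonneg, of \<beta>2 UNIV]
      by linarith
  qed
  have "?d \<le> 0 + e" if e: "0 < e" for e
  proof -
    have m: "0 \<le> ?m" by simp
    then have m1: "0 < ?m + 1" by linarith
    have "?d \<le> (e / (?m + 1)) * ?m" by (rule step) (rule divide_pos_pos[OF e m1])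
    also have "\<dots> \<le> (e / (?m + 1)) * (?m + 1)"
      using e m1 by (intro mult_left_mono) simp_all
    also have "\<dots> = e" using m1 by (intro nonzero_eq_divide_eq[THEN iffD1]) simp_all
    finally show ?thesis by simp
  qed
  then have "?d \<le> 0" by (rule field_le_epsilon)
  then have "(\<integral>x. ?\<psi> x \<partial>\<alpha>1) + (\<integral>x. ?\<psi> x \<partial>\<alpha>2) = (\<integral>x. ?\<psi> x \<partial>\<beta>1) + (\<integral>x. ?\<psi> x \<partial>\<beta>2)" by simp
  moreover have "B * measure \<alpha>1 UNIV + B * measure \<alpha>2 UNIV = B * measure \<beta>1 UNIV + B * measure \<beta>2 UNIV"
    using eq[of UNIV] by (simp flip: distrib_left)
  ultimately show ?thesis
    unfolding shift[OF fin(1) s(1)] shift[OF fin(2) s(2)] shift[OF fin(3) s(3)] shift[OF fin(4) s(4)]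
    by linarith
qed

text \<open>
  The signed integral is defined by the minimal decomposition of \<open>\<nu>\<close>, but any other decomposition
  into finite measures gives the same value.
\<close>
lemma signed_integral_eq_diff:
  fixes \<nu> :: "'a::euclidean_space set \<Rightarrow> real" and \<phi> :: "'a \<Rightarrow> real"
  assumes vm: "vector_measure borel \<nu>"
    and fin: "finite_measure P" "finite_measure Q" and s: "sets P = sets borel" "sets Q = sets borel"
    and eq: "\<And>A. A \<in> sets borel \<Longrightarrow> \<nu> A = measure P A - measure Q A"
    and meas: "\<phi> \<in> borel_measurable borel" and B: "\<And>x. \<bar>\<phi> x\<bar> \<le> B"
  shows "signed_integral borel \<nu> \<phi> = (\<integral>x. \<phi> x \<partial>P) - (\<integral>x. \<phi> x \<partial>Q)"
proof -
  have vm': "vector_measure borel (\<lambda>A. - \<nu> A)"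
    by (rule vector_measure_bounded_linear[OF vm bounded_linear_minus[OF bounded_linear_ident]])
  have "(\<integral>x. \<phi> x \<partial>pos_variation borel \<nu>) + (\<integral>x. \<phi> x \<partial>Q)
      = (\<integral>x. \<phi> x \<partial>P) + (\<integral>x. \<phi> x \<partial>pos_variation borel (\<lambda>A. - \<nu> A))"
  proof (rule integrals_eq_if_measure_sums_eq[OF pos_variation_finite[OF vm] fin(2) fin(1)
        pos_variation_finite[OF vm'] sets_pos_variation s(2) s(1) sets_pos_variation _ meas B])
    fix A :: "'a set" assume A: "A \<in> sets borel"
    show "measure (pos_variation borel \<nu>) A + measure Q A
        = measure P A + measure (pos_variation borel (\<lambda>A. - \<nu> A)) A"
      using eq[OF A] jordan_decomposition[OF vm A] by linarith
  qed
  then show ?thesis unfolding signed_integral_def by linarith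
qed

text \<open>
  Uniqueness of the distributional derivative, in one component: the test functions see a signed
  measure only through its positive and negative variations, which are finite.
\<close>
lemma measure_derivative_component_unique:
  fixes \<nu> :: "'a::euclidean_space set \<Rightarrow> real"
  assumes vm: "vector_measure borel \<nu>"
    and fin: "finite_measure P" "finite_measure Q" and s: "sets P = sets borel" "sets Q = sets borel"
    and eq: "\<And>\<phi>. test_function \<phi> \<Longrightarrow> signed_integral borel \<nu> \<phi> = (\<integral>x. \<phi> x \<partial>P) - (\<integral>x. \<phi> x \<partial>Q)"
    and A: "A \<in> sets borel"
  shows "\<nu> A = measure P A - measure Q A"
proof -
  have vm': "vector_measure borel (\<lambda>A. - \<nu> A)"
    by (rule vector_measure_bounded_linear[OF vm bounded_linear_minus[OF bounded_linear_ident]])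
  have "measure (pos_variation borel \<nu>) A + measure Q A
        = measure P A + measure (pos_variation borel (\<lambda>A. - \<nu> A)) A"
  proof (rule test_integrals_determine_measure_sums[OF pos_variation_finite[OF vm] fin(2) fin(1)
        pos_variation_finite[OF vm'] sets_pos_variation s(2) s(1) sets_pos_variation _ A])
    fix \<phi> :: "'a \<Rightarrow> real" assume "test_function \<phi>"
    from eq[OF this] show "(\<integral>x. \<phi> x \<partial>pos_variation borel \<nu>) + (\<integral>x. \<phi> x \<partial>Q)
      = (\<integral>x. \<phi> x \<partial>P) + (\<integral>x. \<phi> x \<partial>pos_variation borel (\<lambda>A. - \<nu> A))"
      unfolding signed_integral_def by linarith
  qed
  with jordan_decomposition[OF vm A] show ?thesis by linarith
qed

section \<open>Difference quotients of functions with Lipschitz translates\<close>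

lemma cball_measurable [measurable]: "cball (c :: 'a::euclidean_space) r \<in> sets borel"
  by simp

text \<open>
  By Fubini, for almost every x the increments |v(x + h) - v(x)| are integrable in h over a
  ball of radius 2R. Such an x exists in the ball of radius R, and the ball of radius 2R
  around it covers the ball of radius R around the origin.
\<close>
lemma integrable_on_balls_if_shifts_finite:
  fixes v :: "'a::euclidean_space \<Rightarrow> real"
  assumes v [measurable]: "v \<in> borel_measurable borel"
    and K: "0 \<le> K" "\<And>h. L1_shift v h \<le> ennreal (K * norm h)" and R: "0 < R"
  shows "integrable lborel (\<lambda>x. indicator (cball 0 R) x * v x)"
proof -
  let ?B = "cball (0::'a) (2 * R)"
  have fub: "(\<integral>\<^sup>+x. (\<integral>\<^sup>+h. indicator ?B h * ennreal \<bar>v (x + h) - v x\<bar> \<partial>lborel) \<partial>lborel)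
      = (\<integral>\<^sup>+h. (\<integral>\<^sup>+x. indicator ?B h * ennreal \<bar>v (x + h) - v x\<bar> \<partial>lborel) \<partial>lborel)"
    by (rule lborel_pair.Fubini'[symmetric]) measurable
  also have "\<dots> = (\<integral>\<^sup>+h. indicator ?B h * L1_shift v h \<partial>lborel)"
    unfolding L1_shift_def by (intro nn_integral_cong nn_integral_cmult) measurable
  also have "\<dots> \<le> (\<integral>\<^sup>+h. ennreal (K * (2 * R)) * indicator ?B h \<partial>lborel)"
  proof (rule nn_integral_mono)
    fix h
    show "indicator ?B h * L1_shift v h \<le> ennreal (K * (2 * R)) * indicator ?B h"
    proof (cases "h \<in> ?B")
      case True
      then have "ennreal (K * norm h) \<le> ennreal (K * (2 * R))"
        using K by (intro ennreal_leI mult_left_mono) auto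
      then show ?thesis using True K(2)[of h] by simp
    qed simp
  qed
  also have "\<dots> = ennreal (K * (2 * R)) * emeasure lborel ?B"
    by (rule nn_integral_cmult_indicator) simp
  also have "\<dots> < \<infinity>"
    using emeasure_lborel_cball_finite[of "0::'a" "2 * R"] by (simp add: ennreal_mult_less_top)
  finally have "(\<integral>\<^sup>+x. (\<integral>\<^sup>+h. indicator ?B h * ennreal \<bar>v (x + h) - v x\<bar> \<partial>lborel) \<partial>lborel) \<noteq> \<infinity>"
    by simp
  then have ae: "AE x in lborel. (\<integral>\<^sup>+h. indicator ?B h * ennreal \<bar>v (x + h) - v x\<bar> \<partial>lborel) \<noteq> \<infinity>"
    by (intro nn_integral_PInf_AE) measurable
  have "\<exists>x\<in>cball 0 R. (\<integral>\<^sup>+h. indicator ?B h * ennreal \<bar>v (x + h) - v x\<bar> \<partial>lborel) \<noteq> \<infinity>"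
  proof (rule ccontr)
    assume "\<not> ?thesis"
    then have "AE x in lborel. x \<notin> cball (0::'a) R" using ae by (auto elim: AE_mp)
    then have "emeasure lborel (cball (0::'a) R) = 0"
      by (subst (asm) AE_iff_measurable[of "cball 0 R"]) auto
    then show False using R unit_ball_vol_pos[of "real DIM('a)"] by (simp add: emeasure_cball)
  qed
  then obtain x where x: "x \<in> cball 0 R"
    "(\<integral>\<^sup>+h. indicator ?B h * ennreal \<bar>v (x + h) - v x\<bar> \<partial>lborel) \<noteq> \<infinity>" by blast
  have "(\<integral>\<^sup>+h. indicator ?B h * ennreal \<bar>v (x + h) - v x\<bar> \<partial>lborel)
      = (\<integral>\<^sup>+h. indicator ?B ((h + x) - x) * ennreal \<bar>v (h + x) - v x\<bar> \<partial>lborel)"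
    by (simp add: add.commute)
  also have "\<dots> = (\<integral>\<^sup>+z. indicator ?B (z - x) * ennreal \<bar>v z - v x\<bar> \<partial>lborel)"
    by (rule nn_integral_lborel_shift[where f = "\<lambda>z. indicator ?B (z - x) * ennreal \<bar>v z - v x\<bar>"]) measurable
  finally have fin: "(\<integral>\<^sup>+z. indicator ?B (z - x) * ennreal \<bar>v z - v x\<bar> \<partial>lborel) < \<infinity>"
    using x(2) by (simp add: less_top)
  have "(\<integral>\<^sup>+z. ennreal (norm (indicator (cball 0 R) z * v z)) \<partial>lborel)
      \<le> (\<integral>\<^sup>+z. indicator ?B (z - x) * ennreal \<bar>v z - v x\<bar> + ennreal \<bar>v x\<bar> * indicator (cball 0 R) z \<partial>lborel)"
  proof (rule nn_integral_mono)
    fix z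
    show "ennreal (norm (indicator (cball 0 R) z * v z))
        \<le> indicator ?B (z - x) * ennreal \<bar>v z - v x\<bar> + ennreal \<bar>v x\<bar> * indicator (cball 0 R) z"
    proof (cases "z \<in> cball 0 R")
      case True
      have "norm (z - x) \<le> norm z + norm x" by (rule norm_triangle_ineq4)
      then have "z - x \<in> ?B" using True x(1) by simp
      moreover have "ennreal \<bar>v z\<bar> \<le> ennreal \<bar>v z - v x\<bar> + ennreal \<bar>v x\<bar>"
        by (simp flip: ennreal_plus add: ennreal_leI)
      ultimately show ?thesis using True by simp
    qed simp
  qed
  also have "\<dots> = (\<integral>\<^sup>+z. indicator ?B (z - x) * ennreal \<bar>v z - v x\<bar> \<partial>lborel)
      + (\<integral>\<^sup>+z. ennreal \<bar>v x\<bar> * indicator (cball (0::'a) R) z \<partial>lborel)"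
    by (rule nn_integral_add) measurable
  also have "(\<integral>\<^sup>+z. ennreal \<bar>v x\<bar> * indicator (cball (0::'a) R) z \<partial>lborel)
      = ennreal \<bar>v x\<bar> * emeasure lborel (cball (0::'a) R)"
    by (rule nn_integral_cmult_indicator) simp
  also have "(\<integral>\<^sup>+z. indicator ?B (z - x) * ennreal \<bar>v z - v x\<bar> \<partial>lborel) + \<dots> < \<infinity>"
    using fin emeasure_lborel_cball_finite[of "0::'a" R] by (simp add: ennreal_mult_less_top)
  finally show ?thesis by (intro integrableI_bounded) simp_all
qed

text \<open>
  A partial derivative vanishes off the support of the test function, hence is again continuous
  with compact support; its bound will dominate the difference quotients.
\<close>
lemma test_function_partial_derivative:
  fixes \<phi> :: "'a::euclidean_space \<Rightarrow> real"
  assumes \<phi>: "test_function \<phi>" and b: "b \<in> Basis"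
  shows "(\<phi> has_derivative frechet_derivative \<phi> (at x)) (at x)"
    and "continuous_on UNIV (\<lambda>x. frechet_derivative \<phi> (at x) b)"
    and "x \<notin> closure {x. \<phi> x \<noteq> 0} \<Longrightarrow> frechet_derivative \<phi> (at x) b = 0"
    and "\<exists>B. \<forall>x. \<bar>frechet_derivative \<phi> (at x) b\<bar> \<le> B"
proof -
  have c1: "continuously_differentiable (Suc 0) \<phi>" using \<phi> by (simp only: test_function_def)
  show der: "(\<phi> has_derivative frechet_derivative \<phi> (at x)) (at x)" for x
    by (rule continuously_differentiable_has_derivative[OF c1])
  show cont: "continuous_on UNIV (\<lambda>x. frechet_derivative \<phi> (at x) b)" using c1 b by simp
  show zero: "frechet_derivative \<phi> (at x) b = 0" if "x \<notin> closure {x. \<phi> x \<noteq> 0}" for x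
  proof -
    have "((\<lambda>_. 0) has_derivative (\<lambda>_. 0)) (at x)" by simp
    then have "(\<phi> has_derivative (\<lambda>_. 0)) (at x)"
    proof (rule has_derivative_transform_within_open)
      show "open (- closure {x. \<phi> x \<noteq> 0})" by (intro open_Compl closed_closure)
      show "x \<in> - closure {x. \<phi> x \<noteq> 0}" using that by simp
      fix y assume "y \<in> - closure {x. \<phi> x \<noteq> 0}"
      then show "0 = \<phi> y" using closure_subset[of "{x. \<phi> x \<noteq> 0}"] by auto
    qed
    from frechet_derivative_at[OF this] show ?thesis by metis
  qed
  have "{x. frechet_derivative \<phi> (at x) b \<noteq> 0} \<subseteq> closure {x. \<phi> x \<noteq> 0}" using zero by auto
  then have "closure {x. frechet_derivative \<phi> (at x) b \<noteq> 0} \<subseteq> closure {x. \<phi> x \<noteq> 0}"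
    by (rule closure_minimal) simp
  moreover have "compact (closure {x. \<phi> x \<noteq> 0})" using \<phi> by (simp add: test_function_def)
  ultimately have "compact (closure {x. frechet_derivative \<phi> (at x) b \<noteq> 0})"
    using compact_Int_closed by (metis closed_closure inf.absorb2)
  with cont show "\<exists>B. \<forall>x. \<bar>frechet_derivative \<phi> (at x) b\<bar> \<le> B" by (rule bounded_if_compact_support)
qed

lemma integral_lborel_shift:
  fixes f :: "'a::euclidean_space \<Rightarrow> real"
  assumes [measurable]: "f \<in> borel_measurable borel"
  shows "(\<integral>x. f (x + h) \<partial>lborel) = (\<integral>x. f x \<partial>lborel)"
    and "integrable lborel f \<Longrightarrow> integrable lborel (\<lambda>x. f (x + h))"
proof -
  have "(\<integral>x. f x \<partial>lborel) = (\<integral>x. f x \<partial>distr lborel borel ((+) h))"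
    by (simp add: lborel_distr_plus)
  also have "\<dots> = (\<integral>x. f (x + h) \<partial>lborel)"
    by (subst integral_distr) (auto simp: add.commute)
  finally show "(\<integral>x. f (x + h) \<partial>lborel) = (\<integral>x. f x \<partial>lborel)" by simp
  assume "integrable lborel f"
  then have "integrable (distr lborel borel ((+) h)) f" by (simp add: lborel_distr_plus)
  then have "integrable lborel (\<lambda>x. f (h + x))" by (subst (asm) integrable_distr_eq) auto
  then show "integrable lborel (\<lambda>x. f (x + h))" by (simp add: add.commute)
qed

text \<open>
  Discrete integration by parts moves the difference quotient to the test function, where it
  converges boundedly. Only the values of v near the support of \<phi> matter, which is expressed by
  the truncation \<open>W\<close> to a ball of radius one more than that of the support, since the step is at
  most one.
\<close>
lemma difference_quotients_converge_weakly:
  fixes v \<phi> :: "'a::euclidean_space \<Rightarrow> real"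
  assumes v [measurable]: "v \<in> borel_measurable borel"
    and loc: "\<And>R. 0 < R \<Longrightarrow> integrable lborel (\<lambda>x. indicator (cball 0 R) x * v x)"
    and \<phi>: "test_function \<phi>" and b: "b \<in> Basis"
  shows "(\<lambda>n. \<integral>x. \<phi> x * ((v (x + (1 / real (Suc n)) *\<^sub>R b) - v x) / (1 / real (Suc n))) \<partial>lborel)
    \<longlonglongrightarrow> - (\<integral>x. v x * frechet_derivative \<phi> (at x) b \<partial>lborel)"
proof -
  define \<psi> where "\<psi> x = frechet_derivative \<phi> (at x) b" for x
  define h where "h n = 1 / real (Suc n)" for n
  have h: "0 < h n" "h n \<le> 1" for n by (auto simp: h_def)
  have h_lim: "h \<longlonglongrightarrow> 0" unfolding h_def using LIMSEQ_inverse_real_of_nat by (simp add: inverse_eq_divide)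
  have cont: "continuous_on UNIV \<phi>" by (rule test_function_continuous[OF \<phi>])
  have supp: "compact (closure {x. \<phi> x \<noteq> 0})" using \<phi> by (simp add: test_function_def)
  note pd = test_function_partial_derivative[OF \<phi> b, folded \<psi>_def]
  have [measurable]: "\<phi> \<in> borel_measurable borel" "\<psi> \<in> borel_measurable borel"
    using cont pd(2) by (auto intro: borel_measurable_continuous_onI)
  obtain B where B: "\<And>x. \<bar>\<phi> x\<bar> \<le> B" using bounded_if_compact_support[OF cont supp] by blast
  obtain M where M: "\<And>x. \<bar>\<psi> x\<bar> \<le> M" using pd(4) by blast
  obtain R where R: "0 < R" "\<And>x. x \<in> closure {x. \<phi> x \<noteq> 0} \<Longrightarrow> norm x \<le> R"
    using compact_imp_bounded[OF supp] by (auto simp: bounded_pos)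
  define W where "W x = indicator (cball 0 (R + 1)) x * v x" for x
  have W: "integrable lborel W" unfolding W_def using R by (intro loc) simp
  have [measurable]: "W \<in> borel_measurable borel" unfolding W_def by measurable
  have \<phi>W: "\<phi> y * v x = \<phi> y * W x" "\<psi> y * v x = \<psi> y * W x" if "norm (x - y) \<le> 1" for x y
  proof -
    have *: "v x = W x" if "norm y \<le> R"
    proof -
      have "norm x \<le> norm (x - y) + norm y" using norm_triangle_ineq[of "x - y" y] by simp
      then show ?thesis using that \<open>norm (x - y) \<le> 1\<close> by (simp add: W_def)
    qed
    show "\<phi> y * v x = \<phi> y * W x" "\<psi> y * v x = \<psi> y * W x"
      using * R(2)[of y] closure_subset[of "{x. \<phi> x \<noteq> 0}"] pd(3)[of y]
      by (cases "y \<in> closure {x. \<phi> x \<noteq> 0}"; auto)+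
  qed
  have nb: "norm b = 1" using b by simp
  have quot: "(\<integral>x. \<phi> x * ((v (x + h n *\<^sub>R b) - v x) / h n) \<partial>lborel)
      = (\<integral>x. W x * ((\<phi> (x - h n *\<^sub>R b) - \<phi> x) / h n) \<partial>lborel)" for n
  proof -
    have e1: "\<phi> x * v (x + h n *\<^sub>R b) = \<phi> ((x + h n *\<^sub>R b) - h n *\<^sub>R b) * W (x + h n *\<^sub>R b)" for x
      using \<phi>W(1)[of "x + h n *\<^sub>R b" x] h[of n] nb by simp
    have e2: "\<phi> x * v x = \<phi> x * W x" for x using \<phi>W(1)[of x x] by simp
    let ?f = "\<lambda>x. \<phi> (x - h n *\<^sub>R b) * W x"
    have i1: "integrable lborel ?f" by (rule integrable_bounded_mult[OF W _ B]) measurable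
    have i2: "integrable lborel (\<lambda>x. \<phi> x * W x)" by (rule integrable_bounded_mult[OF W _ B]) measurable
    have i3: "integrable lborel (\<lambda>x. ?f (x + h n *\<^sub>R b))"
      by (rule integral_lborel_shift(2)[OF _ i1]) measurable
    have "(\<integral>x. \<phi> x * ((v (x + h n *\<^sub>R b) - v x) / h n) \<partial>lborel)
        = (\<integral>x. (?f (x + h n *\<^sub>R b) - \<phi> x * W x) / h n \<partial>lborel)"
      by (intro Bochner_Integration.integral_cong refl)
        (simp only: e1[symmetric] e2[symmetric], simp add: right_diff_distrib)
    also have "\<dots> = ((\<integral>x. ?f (x + h n *\<^sub>R b) \<partial>lborel) - (\<integral>x. \<phi> x * W x \<partial>lborel)) / h n"
      using i2 i3 by simp
    also have "(\<integral>x. ?f (x + h n *\<^sub>R b) \<partial>lborel) = (\<integral>x. ?f x \<partial>lborel)"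
      by (rule integral_lborel_shift(1)[of ?f]) measurable
    also have "((\<integral>x. ?f x \<partial>lborel) - (\<integral>x. \<phi> x * W x \<partial>lborel)) / h n
        = (\<integral>x. (?f x - \<phi> x * W x) / h n \<partial>lborel)"
      using i1 i2 by simp
    also have "\<dots> = (\<integral>x. W x * ((\<phi> (x - h n *\<^sub>R b) - \<phi> x) / h n) \<partial>lborel)"
      by (intro Bochner_Integration.integral_cong refl) (simp add: algebra_simps)
    finally show ?thesis .
  qed
  \<comment> \<open>Restricting \<phi> to the line through x in direction - b gives both the limit of the quotients
    and, by the mean value theorem, a bound for them.\<close>
  have line: "((\<lambda>t. \<phi> (x - t *\<^sub>R b)) has_real_derivative - \<psi> (x - t *\<^sub>R b)) (at t)" for x t
  proof -
    have "((\<lambda>t. x - t *\<^sub>R b) has_derivative (\<lambda>s. - (s *\<^sub>R b))) (at t)"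
      by (auto intro!: derivative_eq_intros)
    from has_derivative_compose[OF this pd(1)]
    have "((\<lambda>t. \<phi> (x - t *\<^sub>R b)) has_derivative
        (\<lambda>s. frechet_derivative \<phi> (at (x - t *\<^sub>R b)) (- (s *\<^sub>R b)))) (at t)" .
    moreover have "frechet_derivative \<phi> (at y) (- (s *\<^sub>R b)) = - \<psi> y * s" for y s
    proof -
      interpret l: bounded_linear "frechet_derivative \<phi> (at y)"
        using pd(1) by (rule has_derivative_bounded_linear)
      show ?thesis using linear_neg[OF l.linear] by (simp add: l.scaleR \<psi>_def)
    qed
    then have "(\<lambda>s. frechet_derivative \<phi> (at (x - t *\<^sub>R b)) (- (s *\<^sub>R b))) = (*) (- \<psi> (x - t *\<^sub>R b))" by (rule ext)
    ultimately show ?thesis unfolding has_field_derivative_def by simp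
  qed
  have dq_lim: "(\<lambda>n. (\<phi> (x - h n *\<^sub>R b) - \<phi> x) / h n) \<longlonglongrightarrow> - \<psi> x" for x
  proof -
    have "((\<lambda>t. (\<phi> (x - (0 + t) *\<^sub>R b) - \<phi> (x - 0 *\<^sub>R b)) / t) \<longlongrightarrow> - \<psi> (x - 0 *\<^sub>R b)) (at 0)"
      using line[of x 0] unfolding DERIV_def .
    then have "((\<lambda>t. (\<phi> (x - t *\<^sub>R b) - \<phi> x) / t) \<longlongrightarrow> - \<psi> x) (at 0)" by simp
    moreover have "filterlim h (at 0) sequentially"
      by (intro filterlim_atI h_lim always_eventually allI) (use h in \<open>simp add: less_imp_neq[symmetric]\<close>)
    ultimately show ?thesis by (rule filterlim_compose)
  qed
  have dq_bound: "\<bar>(\<phi> (x - h n *\<^sub>R b) - \<phi> x) / h n\<bar> \<le> M" for x n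
  proof -
    obtain z where "\<phi> (x - h n *\<^sub>R b) - \<phi> (x - 0 *\<^sub>R b) = (h n - 0) * - \<psi> (x - z *\<^sub>R b)"
      using MVT2[of 0 "h n" "\<lambda>t. \<phi> (x - t *\<^sub>R b)" "\<lambda>t. - \<psi> (x - t *\<^sub>R b)", OF h(1) line] by auto
    then have "(\<phi> (x - h n *\<^sub>R b) - \<phi> x) / h n = - \<psi> (x - z *\<^sub>R b)" using h(1)[of n] by (simp add: field_simps)
    then show ?thesis using M[of "x - z *\<^sub>R b"] by simp
  qed
  have "(\<lambda>n. \<integral>x. W x * ((\<phi> (x - h n *\<^sub>R b) - \<phi> x) / h n) \<partial>lborel) \<longlonglongrightarrow> (\<integral>x. W x * - \<psi> x \<partial>lborel)"
  proof (rule integral_dominated_convergence[where w = "\<lambda>x. M * \<bar>W x\<bar>"])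
    show "integrable lborel (\<lambda>x. M * \<bar>W x\<bar>)" using W by simp
    show "AE x in lborel. (\<lambda>n. W x * ((\<phi> (x - h n *\<^sub>R b) - \<phi> x) / h n)) \<longlonglongrightarrow> W x * - \<psi> x"
      by (intro AE_I2 tendsto_mult tendsto_const dq_lim)
    show "AE x in lborel. norm (W x * ((\<phi> (x - h n *\<^sub>R b) - \<phi> x) / h n)) \<le> M * \<bar>W x\<bar>" for n
    proof (rule AE_I2)
      fix x
      show "norm (W x * ((\<phi> (x - h n *\<^sub>R b) - \<phi> x) / h n)) \<le> M * \<bar>W x\<bar>"
        unfolding real_norm_def abs_mult mult.commute[of "\<bar>W x\<bar>"]
        by (rule mult_right_mono[OF dq_bound]) simp
    qed
  qed measurable
  also have "(\<integral>x. W x * - \<psi> x \<partial>lborel) = - (\<integral>x. v x * \<psi> x \<partial>lborel)"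
  proof -
    have "(\<lambda>x. W x * - \<psi> x) = (\<lambda>x. - (v x * \<psi> x))"
    proof (rule ext)
      fix x
      show "W x * - \<psi> x = - (v x * \<psi> x)" using \<phi>W(2)[of x x] by (auto simp: mult.commute)
    qed
    then show ?thesis by (simp only: Bochner_Integration.integral_minus)
  qed
  finally show ?thesis unfolding quot[symmetric] by (simp only: h_def \<psi>_def)
qed

section \<open>Bounded variation\<close>

text \<open>
  A translation by a step t changes v by at most K t in the mean, so all difference quotients in
  the direction b have mass at most K, and so do both parts of their weak limit.
\<close>
lemma partial_derivative_measures:
  fixes v :: "'a::euclidean_space \<Rightarrow> real"
  assumes v [measurable]: "v \<in> borel_measurable borel"
    and K: "0 \<le> K" "\<And>h. L1_shift v h \<le> ennreal (K * norm h)" and b: "b \<in> Basis"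
  shows "\<exists>P Q. finite_measure P \<and> finite_measure Q \<and> sets P = sets borel \<and> sets Q = sets borel \<and>
    measure P UNIV \<le> K \<and> measure Q UNIV \<le> K \<and>
    (\<forall>\<phi>. test_function \<phi> \<longrightarrow>
      - (\<integral>x. v x * frechet_derivative \<phi> (at x) b \<partial>lborel) = (\<integral>x. \<phi> x \<partial>P) - (\<integral>x. \<phi> x \<partial>Q))"
proof -
  let ?h = "\<lambda>n. 1 / real (Suc n)"
  define g where "g n x = (v (x + ?h n *\<^sub>R b) - v x) / ?h n" for n x
  have nn: "(\<integral>\<^sup>+x. ennreal (norm (g n x)) \<partial>lborel) \<le> ennreal K" for n
  proof -
    have "(\<integral>\<^sup>+x. ennreal (norm (g n x)) \<partial>lborel)
        = (\<integral>\<^sup>+x. ennreal (real (Suc n)) * ennreal \<bar>v (x + ?h n *\<^sub>R b) - v x\<bar> \<partial>lborel)"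
      by (intro nn_integral_cong)
        (simp add: g_def abs_mult ennreal_mult'[symmetric] mult.commute del: of_nat_Suc)
    also have "\<dots> = ennreal (real (Suc n)) * L1_shift v (?h n *\<^sub>R b)"
      unfolding L1_shift_def by (rule nn_integral_cmult) measurable
    also have "\<dots> \<le> ennreal (real (Suc n)) * ennreal (K * norm (?h n *\<^sub>R b))"
      by (intro mult_left_mono K) simp
    also have "\<dots> = ennreal (real (Suc n) * (K * norm (?h n *\<^sub>R b)))"
      by (rule ennreal_mult'[symmetric]) simp
    also have "real (Suc n) * (K * norm (?h n *\<^sub>R b)) = K" using b by simp
    finally show ?thesis .
  qed
  have [measurable]: "g n \<in> borel_measurable borel" for n unfolding g_def by measurable
  have g: "integrable lborel (g n)" for n
  proof (rule integrableI_bounded)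
    show "(\<integral>\<^sup>+x. ennreal (norm (g n x)) \<partial>lborel) < \<infinity>"
      using nn[of n] unfolding infinity_ennreal_def by (rule le_less_trans) (rule ennreal_less_top)
  qed measurable
  have mass: "(\<integral>x. \<bar>g n x\<bar> \<partial>lborel) \<le> K" for n
  proof -
    have "ennreal (\<integral>x. \<bar>g n x\<bar> \<partial>lborel) = (\<integral>\<^sup>+x. ennreal (norm (g n x)) \<partial>lborel)"
      using g[of n] by (subst nn_integral_eq_integral) auto
    with nn[of n] have "ennreal (\<integral>x. \<bar>g n x\<bar> \<partial>lborel) \<le> ennreal K" by simp
    then show ?thesis by (rule ennreal_le_iff[THEN iffD1, OF K(1)])
  qed
  have loc: "integrable lborel (\<lambda>x. indicator (cball 0 R) x * v x)" if "0 < R" for R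
    by (rule integrable_on_balls_if_shifts_finite[OF v K that])
  obtain P where "\<exists>Q. finite_measure P \<and> finite_measure Q \<and> sets P = sets borel \<and> sets Q = sets borel \<and>
    measure P UNIV \<le> K \<and> measure Q UNIV \<le> K \<and>
    (\<forall>\<phi> l. continuous_on UNIV \<phi> \<longrightarrow> compact (closure {x. \<phi> x \<noteq> 0}) \<longrightarrow>
       (\<lambda>n. \<integral>x. \<phi> x * g n x \<partial>lborel) \<longlonglongrightarrow> l \<longrightarrow> l = (\<integral>x. \<phi> x \<partial>P) - (\<integral>x. \<phi> x \<partial>Q))"
    using weak_limit_of_densities[OF g mass] ..
  then obtain Q where Q: "finite_measure P \<and> finite_measure Q \<and> sets P = sets borel \<and> sets Q = sets borel \<and>
    measure P UNIV \<le> K \<and> measure Q UNIV \<le> K \<and>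
    (\<forall>\<phi> l. continuous_on UNIV \<phi> \<longrightarrow> compact (closure {x. \<phi> x \<noteq> 0}) \<longrightarrow>
       (\<lambda>n. \<integral>x. \<phi> x * g n x \<partial>lborel) \<longlonglongrightarrow> l \<longrightarrow> l = (\<integral>x. \<phi> x \<partial>P) - (\<integral>x. \<phi> x \<partial>Q))" ..
  have "- (\<integral>x. v x * frechet_derivative \<phi> (at x) b \<partial>lborel) = (\<integral>x. \<phi> x \<partial>P) - (\<integral>x. \<phi> x \<partial>Q)"
    if \<phi>: "test_function \<phi>" for \<phi>
  proof -
    have "compact (closure {x. \<phi> x \<noteq> 0})" using \<phi> by (simp add: test_function_def)
    moreover have "(\<lambda>n. \<integral>x. \<phi> x * g n x \<partial>lborel)
        \<longlonglongrightarrow> - (\<integral>x. v x * frechet_derivative \<phi> (at x) b \<partial>lborel)"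
      unfolding g_def by (rule difference_quotients_converge_weakly[OF v loc \<phi> b])
    ultimately show ?thesis using Q test_function_continuous[OF \<phi>] by blast
  qed
  with Q show ?thesis by (intro exI[of _ P] exI[of _ Q]) simp
qed

lemma vector_measure_of_components:
  fixes P Q :: "'a::euclidean_space \<Rightarrow> 'a measure"
  assumes P: "\<And>b. b \<in> Basis \<Longrightarrow> finite_measure (P b)" "\<And>b. b \<in> Basis \<Longrightarrow> sets (P b) = sets borel"
    and Q: "\<And>b. b \<in> Basis \<Longrightarrow> finite_measure (Q b)" "\<And>b. b \<in> Basis \<Longrightarrow> sets (Q b) = sets borel"
  shows "vector_measure borel (\<lambda>A. \<Sum>b\<in>Basis. (measure (P b) A - measure (Q b) A) *\<^sub>R b)"
  unfolding vector_measure_def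
proof (intro allI impI)
  fix A :: "nat \<Rightarrow> 'a set" assume A: "range A \<subseteq> sets borel" "disjoint_family A"
  have "(\<lambda>i. measure (P b) (A i)) sums measure (P b) (\<Union>i. A i)"
    "(\<lambda>i. measure (Q b) (A i)) sums measure (Q b) (\<Union>i. A i)" if b: "b \<in> Basis" for b
    using finite_measure.finite_measure_UNION[OF P(1)[OF b]] finite_measure.finite_measure_UNION[OF Q(1)[OF b]]
      A P(2)[OF b] Q(2)[OF b] by simp_all
  then show "(\<lambda>i. \<Sum>b\<in>Basis. (measure (P b) (A i) - measure (Q b) (A i)) *\<^sub>R b)
      sums (\<Sum>b\<in>Basis. (measure (P b) (\<Union>i. A i) - measure (Q b) (\<Union>i. A i)) *\<^sub>R b)"
    by (intro sums_sum sums_scaleR_left sums_diff)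
qed

lemma total_variation_le_component_masses:
  fixes \<mu> :: "'a::euclidean_space set \<Rightarrow> 'a"
  assumes P: "\<And>b. b \<in> Basis \<Longrightarrow> finite_measure (P b)" "\<And>b. b \<in> Basis \<Longrightarrow> sets (P b) = sets borel"
    and Q: "\<And>b. b \<in> Basis \<Longrightarrow> finite_measure (Q b)" "\<And>b. b \<in> Basis \<Longrightarrow> sets (Q b) = sets borel"
    and comp: "\<And>A b. A \<in> sets borel \<Longrightarrow> b \<in> Basis \<Longrightarrow> \<mu> A \<bullet> b = measure (P b) A - measure (Q b) A"
  shows "total_variation borel \<mu> UNIV \<le> ennreal (\<Sum>b\<in>Basis. measure (P b) UNIV + measure (Q b) UNIV)"
  unfolding total_variation_def
proof (rule SUP_least)
  fix A :: "nat \<Rightarrow> 'a set"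
  assume "A \<in> {A. range A \<subseteq> sets borel \<and> disjoint_family A \<and> (\<Union>i. A i) = UNIV}"
  then have A: "range A \<subseteq> sets borel" "disjoint_family A" "(\<Union>i. A i) = UNIV" by simp_all
  let ?f = "\<lambda>i. \<Sum>b\<in>Basis. measure (P b) (A i) + measure (Q b) (A i)"
  have "norm (\<mu> (A i)) \<le> ?f i" for i
  proof -
    have Ai: "A i \<in> sets borel" using A(1) by blast
    have "norm (\<mu> (A i)) \<le> (\<Sum>b\<in>Basis. \<bar>\<mu> (A i) \<bullet> b\<bar>)" by (rule norm_le_l1)
    also have "\<dots> \<le> ?f i"
    proof (rule sum_mono)
      fix b :: 'a assume b: "b \<in> Basis"
      show "\<bar>\<mu> (A i) \<bullet> b\<bar> \<le> measure (P b) (A i) + measure (Q b) (A i)"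
        using measure_nonneg[of "P b" "A i"] measure_nonneg[of "Q b" "A i"]
        unfolding comp[OF Ai b] by linarith
    qed
    finally show ?thesis .
  qed
  then have "(\<Sum>i. ennreal (norm (\<mu> (A i)))) \<le> (\<Sum>i. ennreal (?f i))"
    by (intro suminf_le ennreal_leI) auto
  also have "\<dots> = ennreal (\<Sum>b\<in>Basis. measure (P b) UNIV + measure (Q b) UNIV)"
  proof (rule suminf_ennreal_eq)
    show "0 \<le> ?f i" for i by (intro sum_nonneg) simp
    have "(\<lambda>i. measure (P b) (A i)) sums measure (P b) UNIV"
      "(\<lambda>i. measure (Q b) (A i)) sums measure (Q b) UNIV" if b: "b \<in> Basis" for b
      using finite_measure.finite_measure_UNION[OF P(1)[OF b], of A] finite_measure.finite_measure_UNION[OF Q(1)[OF b], of A]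
        A P(2)[OF b] Q(2)[OF b] by simp_all
    then show "?f sums (\<Sum>b\<in>Basis. measure (P b) UNIV + measure (Q b) UNIV)"
      by (intro sums_sum sums_add)
  qed
  finally show "(\<Sum>i. ennreal (norm (\<mu> (A i)))) \<le> ennreal (\<Sum>b\<in>Basis. measure (P b) UNIV + measure (Q b) UNIV)" .
qed

lemma integral_partial_derivative_cong:
  fixes v w \<phi> :: "'a::euclidean_space \<Rightarrow> real"
  assumes v: "v \<in> borel_measurable lebesgue" and w: "w \<in> borel_measurable borel"
    and vw: "AE x in lebesgue. v x = w x" and \<phi>: "test_function \<phi>" and b: "b \<in> Basis"
  shows "(\<integral>x. v x * frechet_derivative \<phi> (at x) b \<partial>lebesgue)
    = (\<integral>x. w x * frechet_derivative \<phi> (at x) b \<partial>lborel)"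
proof -
  have d: "(\<lambda>x. frechet_derivative \<phi> (at x) b) \<in> borel_measurable borel"
    by (intro borel_measurable_continuous_onI test_function_partial_derivative(2)[OF \<phi> b])
  then have d': "(\<lambda>x. frechet_derivative \<phi> (at x) b) \<in> borel_measurable lebesgue"
    by (intro measurable_completion) simp
  have w': "w \<in> borel_measurable lebesgue" using w by (intro measurable_completion) simp
  have "(\<integral>x. v x * frechet_derivative \<phi> (at x) b \<partial>lebesgue) = (\<integral>x. w x * frechet_derivative \<phi> (at x) b \<partial>lebesgue)"
    by (rule integral_cong_AE)
      (use v w' d' in measurable, rule AE_mp[OF vw AE_I2], simp)
  also have "\<dots> = (\<integral>x. w x * frechet_derivative \<phi> (at x) b \<partial>lborel)"
    by (rule integral_completion) (use w d in simp)
  finally show ?thesis .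
qed

text \<open>
  The function \<open>w\<close> is a Borel representative of \<open>v\<close>. The bound on the total variation
  is proved for whatever measure the choice operator returns: its components agree on Borel sets
  with the differences of the measures constructed from the difference quotients.
\<close>
lemma BV_if_L1_shifts_Lipschitz:
  fixes v w :: "'a::euclidean_space \<Rightarrow> real" and K :: real
  assumes v: "v \<in> borel_measurable lebesgue" and w: "w \<in> borel_measurable borel"
    and vw: "AE x in lebesgue. v x = w x"
    and K: "0 \<le> K" "\<And>h. L1_shift w h \<le> ennreal (K * norm h)"
  shows "v \<in> BV" and "total_variation borel (measure_derivative v) UNIV \<le> ennreal (2 * DIM('a) * K)"
proof -
  have "\<forall>b\<in>Basis. \<exists>P Q. finite_measure P \<and> finite_measure Q \<and> sets P = sets borel \<and> sets Q = sets borel \<and>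
    measure P UNIV \<le> K \<and> measure Q UNIV \<le> K \<and>
    (\<forall>\<phi>. test_function \<phi> \<longrightarrow>
      - (\<integral>x. w x * frechet_derivative \<phi> (at x) b \<partial>lborel) = (\<integral>x. \<phi> x \<partial>P) - (\<integral>x. \<phi> x \<partial>Q))"
    using partial_derivative_measures[OF w K] by (rule ballI)
  from this[THEN bchoice] obtain P where "\<forall>b\<in>Basis. \<exists>Q. finite_measure (P b) \<and> finite_measure Q \<and>
    sets (P b) = sets borel \<and> sets Q = sets borel \<and> measure (P b) UNIV \<le> K \<and> measure Q UNIV \<le> K \<and>
    (\<forall>\<phi>. test_function \<phi> \<longrightarrow>
      - (\<integral>x. w x * frechet_derivative \<phi> (at x) b \<partial>lborel) = (\<integral>x. \<phi> x \<partial>P b) - (\<integral>x. \<phi> x \<partial>Q))" ..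
  from this[THEN bchoice] obtain Q where PQ: "\<forall>b\<in>Basis. finite_measure (P b) \<and> finite_measure (Q b) \<and>
    sets (P b) = sets borel \<and> sets (Q b) = sets borel \<and> measure (P b) UNIV \<le> K \<and> measure (Q b) UNIV \<le> K \<and>
    (\<forall>\<phi>. test_function \<phi> \<longrightarrow>
      - (\<integral>x. w x * frechet_derivative \<phi> (at x) b \<partial>lborel) = (\<integral>x. \<phi> x \<partial>P b) - (\<integral>x. \<phi> x \<partial>Q b))" ..
  have fin: "finite_measure (P b)" "finite_measure (Q b)" and s: "sets (P b) = sets borel" "sets (Q b) = sets borel"
    and mass: "measure (P b) UNIV \<le> K" "measure (Q b) UNIV \<le> K" if "b \<in> Basis" for b
    using PQ that by simp_all
  have weak: "(\<integral>x. v x * frechet_derivative \<phi> (at x) b \<partial>lebesgue) = - ((\<integral>x. \<phi> x \<partial>P b) - (\<integral>x. \<phi> x \<partial>Q b))"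
    if "test_function \<phi>" "b \<in> Basis" for \<phi> b
  proof -
    have "- (\<integral>x. w x * frechet_derivative \<phi> (at x) b \<partial>lborel) = (\<integral>x. \<phi> x \<partial>P b) - (\<integral>x. \<phi> x \<partial>Q b)"
      using PQ that by simp
    then show ?thesis
      unfolding integral_partial_derivative_cong[OF v w vw that] by linarith
  qed
  have component: "vector_measure borel (\<lambda>A. \<mu> A \<bullet> b)" if "vector_measure borel \<mu>" for \<mu> :: "'a set \<Rightarrow> 'a" and b
    by (rule vector_measure_bounded_linear[OF that bounded_linear_inner_left])
  define \<mu> where "\<mu> A = (\<Sum>b\<in>Basis. (measure (P b) A - measure (Q b) A) *\<^sub>R b)" for A
  have vm: "vector_measure borel \<mu>"
    unfolding \<mu>_def by (rule vector_measure_of_components) (use fin s in simp_all)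
  have "has_measure_derivative v \<mu>"
    unfolding has_measure_derivative_def
  proof (intro conjI vm allI impI ballI)
    fix \<phi> :: "'a \<Rightarrow> real" and b :: 'a assume \<phi>: "test_function \<phi>" and b: "b \<in> Basis"
    have cont: "continuous_on UNIV \<phi>" by (rule test_function_continuous[OF \<phi>])
    obtain B where B: "\<And>x. \<bar>\<phi> x\<bar> \<le> B"
      using bounded_if_compact_support[OF cont] \<phi> unfolding test_function_def by blast
    have "signed_integral borel (\<lambda>A. \<mu> A \<bullet> b) \<phi> = (\<integral>x. \<phi> x \<partial>P b) - (\<integral>x. \<phi> x \<partial>Q b)"
    proof (rule signed_integral_eq_diff[OF component[OF vm] fin[OF b] s[OF b] _ _ B])
      show "\<mu> A \<bullet> b = measure (P b) A - measure (Q b) A" for A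
        unfolding \<mu>_def using b by (rule inner_sum_left_Basis)
      show "\<phi> \<in> borel_measurable borel" by (rule borel_measurable_continuous_onI[OF cont])
    qed
    then show "(\<integral>x. v x * frechet_derivative \<phi> (at x) b \<partial>lebesgue) = - signed_integral borel (\<lambda>A. \<mu> A \<bullet> b) \<phi>"
      using weak[OF \<phi> b] by simp
  qed
  note has_derivative = this
  have "locally_integrable v"
    unfolding locally_integrable_def
  proof (intro allI impI)
    fix C :: "'a set" assume C: "compact C"
    obtain R where "0 < R \<and> (\<forall>x\<in>C. norm x \<le> R)"
      using compact_imp_bounded[OF C] unfolding bounded_pos ..
    then have R: "0 < R" "C \<subseteq> cball 0 R" by auto
    have "integrable lborel (\<lambda>x. indicator (cball 0 R) x * w x)"
      by (rule integrable_on_balls_if_shifts_finite[OF w K R(1)])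
    then have "set_integrable lborel (cball 0 R) w" by (simp add: set_integrable_def)
    then have "set_integrable lborel C w"
      by (rule set_integrable_subset) (use C R(2) in \<open>auto intro: borel_compact\<close>)
    then have "integrable lebesgue (\<lambda>x. indicator C x *\<^sub>R w x)"
      unfolding set_integrable_def
      by (subst integrable_completion) (use borel_measurable_integrable in blast)+
    moreover have "integrable lebesgue (\<lambda>x. indicator C x *\<^sub>R w x)
        \<longleftrightarrow> integrable lebesgue (\<lambda>x. indicator C x *\<^sub>R v x)"
    proof (rule integrable_cong_AE)
      have C': "C \<in> sets lebesgue" using borel_compact[OF C] by (intro sets_completionI_sets) simp
      have "w \<in> borel_measurable lebesgue" using w by (intro measurable_completion) simp
      with C' v show "(\<lambda>x. indicator C x *\<^sub>R w x) \<in> borel_measurable lebesgue"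
        "(\<lambda>x. indicator C x *\<^sub>R v x) \<in> borel_measurable lebesgue"
        by (auto intro!: borel_measurable_scaleR borel_measurable_indicator)
      show "AE x in lebesgue. indicator C x *\<^sub>R w x = indicator C x *\<^sub>R v x"
        by (rule AE_mp[OF vw AE_I2]) simp
    qed
    ultimately show "v absolutely_integrable_on C" by (simp add: set_integrable_def)
  qed
  with has_derivative show "v \<in> BV" unfolding BV_def by blast
  have md: "has_measure_derivative v (measure_derivative v)"
    unfolding measure_derivative_def by (rule someI[of "has_measure_derivative v", OF has_derivative])
  then have vm': "vector_measure borel (measure_derivative v)" by (simp add: has_measure_derivative_def)
  have "measure_derivative v A \<bullet> b = measure (P b) A - measure (Q b) A"
    if A: "A \<in> sets borel" and b: "b \<in> Basis" for A b
  proof (rule measure_derivative_component_unique[OF component[OF vm'] fin[OF b] s[OF b] _ A])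
    fix \<phi> :: "'a \<Rightarrow> real" assume \<phi>: "test_function \<phi>"
    have "(\<integral>x. v x * frechet_derivative \<phi> (at x) b \<partial>lebesgue)
        = - signed_integral borel (\<lambda>A. measure_derivative v A \<bullet> b) \<phi>"
      using md \<phi> b unfolding has_measure_derivative_def by simp
    with weak[OF \<phi> b]
    show "signed_integral borel (\<lambda>A. measure_derivative v A \<bullet> b) \<phi> = (\<integral>x. \<phi> x \<partial>P b) - (\<integral>x. \<phi> x \<partial>Q b)"
      by linarith
  qed
  then have "total_variation borel (measure_derivative v) UNIV
      \<le> ennreal (\<Sum>b\<in>Basis. measure (P b) UNIV + measure (Q b) UNIV)"
    by (intro total_variation_le_component_masses fin s)
  also have "\<dots> \<le> ennreal (\<Sum>b\<in>(Basis :: 'a set). K + K)"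
    by (intro ennreal_leI sum_mono add_mono mass)
  also have "(\<Sum>b\<in>(Basis :: 'a set). K + K) = 2 * DIM('a) * K" by simp
  finally show "total_variation borel (measure_derivative v) UNIV \<le> ennreal (2 * DIM('a) * K)" .
qed

theorem theorem8p4:
  fixes N :: nat
  assumes "N \<ge> 2" and "CARD('n::finite) = N - 1"
  shows "\<exists>C::real. C \<ge> 0 \<and>
    (\<forall>(u :: (real ^ 'n) \<times> real \<Rightarrow> real) (v :: real ^ 'n \<Rightarrow> real).
       u \<in> borel_measurable (lebesgue_on half_space) \<longrightarrow>
       v \<in> borel_measurable lebesgue \<longrightarrow>
       Liminf (at_left 1) (\<lambda>s. ennreal (1 - s) * gap_integral N s u v) < \<infinity> \<longrightarrow>
         v \<in> BV \<and>
         total_variation borel (measure_derivative v) UNIV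
           \<le> ennreal C * Liminf (at_left 1) (\<lambda>s. ennreal (1 - s) * gap_integral N s u v))"
proof -
  let ?d = "DIM(real ^ 'n)"
  have N: "N = ?d + 1" using assms by simp
  define C0 where "C0 = 2 / (4 powr - (real ?d + 2) * (unit_ball_vol ?d / 2))"
  have C0: "0 \<le> C0" by (simp add: C0_def)
  have "v \<in> BV \<and> total_variation borel (measure_derivative v) UNIV
           \<le> ennreal (2 * ?d * C0) * Liminf (at_left 1) (\<lambda>s. ennreal (1 - s) * gap_integral N s u v)"
    if u: "u \<in> borel_measurable (lebesgue_on half_space)" and v: "v \<in> borel_measurable lebesgue"
      and fin: "Liminf (at_left 1) (\<lambda>s. ennreal (1 - s) * gap_integral N s u v) < \<infinity>"
    for u :: "(real ^ 'n) \<times> real \<Rightarrow> real" and v :: "real ^ 'n \<Rightarrow> real"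
  proof -
    obtain u' v' where u': "u' \<in> borel_measurable borel" and v': "v' \<in> borel_measurable borel"
      and vv': "AE x in lebesgue. v x = v' x"
      and gap: "\<forall>N s. gap_integral N s u v = half_space_gap (real N + s) u' v'"
      using gap_integral_Borel_representatives[OF u v] by (elim exE conjE)
    let ?L = "Liminf (at_left 1) (\<lambda>s. ennreal (1 - s) * gap_integral N s u v)"
    obtain l where l: "0 \<le> l" "?L = ennreal l"
      using fin by (auto simp: less_top_ennreal)
    have shift: "L1_shift v' h \<le> ennreal (C0 * l * norm h)" for h
    proof -
      have "L1_shift v' h \<le> ennreal (C0 * norm h) * ?L"
        unfolding gap[rule_format] N C0_def by (rule L1_shift_le_Liminf_gap[OF u' v'])
      also have "\<dots> = ennreal (C0 * l * norm h)"
        unfolding l(2) using C0 l(1) by (subst ennreal_mult[symmetric]) (simp_all add: mult_ac)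
      finally show ?thesis .
    qed
    have K: "0 \<le> C0 * l" using C0 l(1) by simp
    note BV = BV_if_L1_shifts_Lipschitz[OF v v' vv' K shift]
    have "ennreal (2 * ?d * (C0 * l)) = ennreal (2 * ?d * C0) * ?L"
      unfolding l(2) using C0 by (subst ennreal_mult'[symmetric]) (simp_all add: mult.assoc)
    with BV show ?thesis by simp
  qed
  then show ?thesis by (intro exI[of _ "2 * ?d * C0"] conjI allI impI) (simp_all add: C0)
qed

end
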